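(* Let $m\geq 2$ be an integer with $m\not\equiv 3 \bmod 4$, let $r(m)$ be the integer defined in the context, and let $s$ be an integer with $s\geq r(m)$. Then $sm-1\leq \mathrm{TC}_s(\mathbb{R}P^m)\leq sm$. Moreover, if $m$ is even, then $\mathrm{TC}_s(\mathbb{R}P^m)=sm$.
   Context: Higher topological complexity (reduced). For an integer $s\geq 2$ and a path connected space $X$, let $J_s$ be the wedge of $s$ ordered copies of $[0,1]$, with $0\in[0,1]$ as base point, and let $e_s\colon X^{J_s}\to X^s$ be the evaluation fibration $e_s(f_1,\ldots,f_s)=(f_1(1),\ldots,f_s(1))$. Then $\mathrm{TC}_s(X)+1$ is the smallest cardinality of an open cover $\{U_i\}$ of $X^s$ such that $e_s$ admits a continuous section on each $U_i$. Definition of $r(m)$. Let $m$ be a positive integer such that $m+1$ is not a power of $2$. (The integers $m\geq2$ with $m\not\equiv3\bmod 4$ satisfy this.) Let $e=e(m)\geq 0$ be the integer defined by $m\equiv 2^{e}-1 \bmod 2^{e+1}$, i.e. the length of the block of consecutive ones ending the binary expansion of $m$ ($e=0$ if $m$ is even). Let $k$ be the least positive integer with $2^k>m$, and set $d_0=2^k-m-1$, which is a positive integer divisible by $2^e$. Let $t=(d_0-2^e)/2^e$ and, for $1\leq \ell\leq t$, let $d_\ell=d_0-2^e\ell$ (so $d_0>d_1>\cdots>d_t=2^e$). Define non-negative integers $r_\ell$, $0\leq\ell\leq t$, recursively by $$r_\ell=\begin{cases}\left\lfloor \dfrac{m-(2^e-1)-\sum_{i=0}^{\ell-1}d_i r_i}{d_\ell}\right\rfloor,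 & \text{if } \binom{m+d_\ell}{d_\ell}\equiv 1 \bmod 2;\\[2mm] 0, & \text{otherwise.}\end{cases}$$ Finally, $r(m)=1+\sum_{\ell=0}^{t} r_\ell$. (One has $r(m)\geq2$.) *)

theory Defs
  imports "HOL-Analysis.Analysis"
begin

section \<open>Quotient topologies\<close>

text \<open>The quotient of \<^term>\<open>X\<close> that identifies the points having the same image under \<^term>\<open>q\<close>;
  the points of the quotient are the values of \<^term>\<open>q\<close>.\<close>

definition quotient_topology :: "'a topology \<Rightarrow> ('a \<Rightarrow> 'b) \<Rightarrow> 'b topology" where
  "quotient_topology X q =
     topology (\<lambda>V. V \<subseteq> q ` topspace X \<and> openin X {x \<in> topspace X. q x \<in> V})"

lemma istopology_quotient:
  "istopology (\<lambda>V. V \<subseteq> q ` topspace X \<and> openin X {x \<in> topspace X. q x \<in> V})"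
proof -
  have 1: "{x \<in> topspace X. q x \<in> S \<inter> T} = {x \<in> topspace X. q x \<in> S} \<inter> {x \<in> topspace X. q x \<in> T}"
    for S T by blast
  have 2: "{x \<in> topspace X. q x \<in> \<Union>\<K>} = (\<Union>K\<in>\<K>. {x \<in> topspace X. q x \<in> K})" for \<K>
    by blast
  show ?thesis
    unfolding istopology_def
  proof (intro conjI allI impI)
    fix S T
    assume "S \<subseteq> q ` topspace X \<and> openin X {x \<in> topspace X. q x \<in> S}"
      and "T \<subseteq> q ` topspace X \<and> openin X {x \<in> topspace X. q x \<in> T}"
    then show "S \<inter> T \<subseteq> q ` topspace X" and "openin X {x \<in> topspace X. q x \<in> S \<inter> T}"
      unfolding 1 by (simp_all add: openin_Int le_infI1)
  next
    fix \<K>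
    assume "\<forall>K\<in>\<K>. K \<subseteq> q ` topspace X \<and> openin X {x \<in> topspace X. q x \<in> K}"
    then show "\<Union>\<K> \<subseteq> q ` topspace X" and "openin X {x \<in> topspace X. q x \<in> \<Union>\<K>}"
      unfolding 2 by blast+
  qed
qed

lemma openin_quotient_topology:
  "openin (quotient_topology X q) V \<longleftrightarrow>
     V \<subseteq> q ` topspace X \<and> openin X {x \<in> topspace X. q x \<in> V}"
  unfolding quotient_topology_def topology_inverse'[OF istopology_quotient] by (rule refl)

lemma topspace_quotient_topology: "topspace (quotient_topology X q) = q ` topspace X"
proof
  show "topspace (quotient_topology X q) \<subseteq> q ` topspace X"
    using openin_topspace[of "quotient_topology X q"] unfolding openin_quotient_topology by (rule conjunct1)
  have "{x \<in> topspace X. q x \<in> q ` topspace X} = topspace X" by blast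
  then have "openin (quotient_topology X q) (q ` topspace X)"
    by (simp add: openin_quotient_topology)
  then show "q ` topspace X \<subseteq> topspace (quotient_topology X q)"
    by (rule openin_subset)
qed

lemma quotient_map_quotient_topology: "quotient_map X (quotient_topology X q) q"
  by (simp add: quotient_map_def topspace_quotient_topology openin_quotient_topology)


section \<open>Real projective space\<close>

definition real_projective_space :: "nat \<Rightarrow> (nat \<Rightarrow> real) set topology" where
  "real_projective_space m = quotient_topology (nsphere m) (\<lambda>x. {x, (\<lambda>i. - x i)})"


section \<open>Mapping spaces with the compact-open topology\<close>

text \<open>Maps are extensional outside the domain, so that they are determined by their values on
  \<^term>\<open>topspace X\<close>.\<close>

definition mapping_space :: "'a topology \<Rightarrow> 'b topology \<Rightarrow> ('a \<Rightarrow> 'b) topology" where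
  "mapping_space X Y =
     topology_generated_by
       {{f \<in> extensional (topspace X). continuous_map X Y f \<and> f ` K \<subseteq> U} | K U.
          compactin X K \<and> openin Y U}"

lemma topspace_mapping_space:
  "topspace (mapping_space X Y) = {f \<in> extensional (topspace X). continuous_map X Y f}"
proof -
  have "{f \<in> extensional (topspace X). continuous_map X Y f} =
          {f \<in> extensional (topspace X). continuous_map X Y f \<and> f ` {} \<subseteq> {}}" by simp
  moreover have "compactin X {}" "openin Y {}" by simp_all
  ultimately have "{f \<in> extensional (topspace X). continuous_map X Y f} \<in>
       {{f \<in> extensional (topspace X). continuous_map X Y f \<and> f ` K \<subseteq> U} | K U.
          compactin X K \<and> openin Y U}" by blast
  then show ?thesis
    unfolding mapping_space_def topology_generated_by_topspace by (intro equalityI) blast+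
qed


section \<open>Higher topological complexity\<close>

text \<open>The wedge \<open>J\<^sub>s\<close>: the disjoint union of \<^term>\<open>s\<close> copies of the unit interval, where
  \<^term>\<open>(i, t)\<close> is the point \<^term>\<open>t\<close> of the copy \<^term>\<open>i\<close> (with \<open>i = 0, \<dots>, s - 1\<close>),
  with all the points \<^term>\<open>(i, 0)\<close> identified.\<close>

definition wedge_proj :: "nat \<times> real \<Rightarrow> nat \<times> real" where
  "wedge_proj = (\<lambda>(i, t). if t = 0 then (0, 0) else (i, t))"

definition interval_wedge :: "nat \<Rightarrow> (nat \<times> real) topology" where
  "interval_wedge s =
     quotient_topology (sum_topology (\<lambda>_. top_of_set {0..1}) {..<s}) wedge_proj"

definition power_space :: "nat \<Rightarrow> 'a topology \<Rightarrow> (nat \<Rightarrow> 'a) topology" where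
  "power_space s X = product_topology (\<lambda>_. X) {..<s}"

definition wedge_eval :: "nat \<Rightarrow> (nat \<times> real \<Rightarrow> 'a) \<Rightarrow> (nat \<Rightarrow> 'a)" where
  "wedge_eval s f = (\<lambda>i\<in>{..<s}. f (wedge_proj (i, 1)))"

definition has_eval_section :: "nat \<Rightarrow> 'a topology \<Rightarrow> (nat \<Rightarrow> 'a) set \<Rightarrow> bool" where
  "has_eval_section s X U \<longleftrightarrow>
     (\<exists>\<sigma>. continuous_map (subtopology (power_space s X) U)
             (mapping_space (interval_wedge s) X) \<sigma> \<and>
          (\<forall>x\<in>U. wedge_eval s (\<sigma> x) = x))"

text \<open>The infimum is a minimum whenever a finite cover exists, and \<open>\<infinity>\<close> otherwise.\<close>

definition higher_TC :: "nat \<Rightarrow> 'a topology \<Rightarrow> enat" where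
  "higher_TC s X =
     Inf {enat (card \<U>) | \<U>. finite \<U> \<and> (\<forall>U\<in>\<U>. openin (power_space s X) U) \<and>
            \<Union>\<U> = topspace (power_space s X) \<and> (\<forall>U\<in>\<U>. has_eval_section s X U)} - 1"


section \<open>The number r(m)\<close>

definition rp_e :: "nat \<Rightarrow> nat" where
  "rp_e m = (THE e. m mod 2 ^ (e + 1) = 2 ^ e - 1)"

definition rp_k :: "nat \<Rightarrow> nat" where
  "rp_k m = (LEAST k. 0 < k \<and> m < 2 ^ k)"

definition rp_d :: "nat \<Rightarrow> nat \<Rightarrow> nat" where
  "rp_d m l = (2 ^ rp_k m - m - 1) - 2 ^ rp_e m * l"

definition rp_t :: "nat \<Rightarrow> nat" where
  "rp_t m = (rp_d m 0 - 2 ^ rp_e m) div 2 ^ rp_e m"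

text \<open>The truncated subtractions below are harmless for \<^term>\<open>m + 1\<close> not a power of two and
  \<^term>\<open>l \<le> rp_t m\<close>: each \<open>r\<^sub>l\<close> is the integer quotient by \<open>d\<^sub>l\<close> of what the preceding ones leave,
  so the numerator never becomes negative.\<close>

function rp_r_seq :: "nat \<Rightarrow> nat \<Rightarrow> nat" where
  "rp_r_seq m l =
     (if ((m + rp_d m l) choose (rp_d m l)) mod 2 = 1
      then (m - (2 ^ rp_e m - 1) - (\<Sum>i<l. rp_d m i * rp_r_seq m i)) div rp_d m l
      else 0)"
  by pat_completeness auto
termination
  by (relation "inv_image less_than snd") auto

declare rp_r_seq.simps [simp del]

definition rp_r :: "nat \<Rightarrow> nat" where
  "rp_r m = 1 + (\<Sum>l\<le>rp_t m. rp_r_seq m l)"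

end

theory Submission
  imports Defs "HOL-Library.Z2"
begin

text \<open>
  Upper bound: \<open>\<real>P\<^sup>m\<close> is a union of \<open>m + 1\<close> Schubert cells, and disjoint open neighbourhoods of the
  products of cells of total dimension \<open>d\<close>, for \<open>d = 0, \<dots>, sm\<close>, carry sections because each neighbourhood
  contracts in \<open>(\<real>P\<^sup>m)\<^sup>s\<close>.

  Lower bound: over an open set with a section the line bundles \<open>L\<^sub>i \<otimes> L\<^sub>s\<^sub>-\<^sub>1\<close> are trivial, so a cover by
  \<open>n\<close> such sets would kill every product of \<open>n\<close> classes \<open>x\<^sub>i + x\<^sub>s\<^sub>-\<^sub>1\<close> in the mod 2 cohomology of
  \<open>(\<real>P\<^sup>m)\<^sup>s\<close>. The numbers \<open>r\<^sub>\<ell>\<close> provide exponents \<open>m + d i\<close> with odd binomial coefficients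
  \<open>(m + d i) choose m\<close> for which the product is nonzero. In place of cohomology, the product of one-cochains is
  summed over the flags of an equivariant cubical subdivision of \<open>(S\<^sup>m)\<^sup>s\<close>, one flag for each orbit. This sum depends only on
  the cohomology classes of the cochains, since every element of a flag can be replaced in exactly one way.
\<close>

section \<open>Flags of cells in powers of the cubical sphere\<close>

text \<open>A section over \<open>U j\<close> gives more than a vanishing class: a nowhere zero real
  function near the preimage of \<open>U j\<close> in the product of spheres, changing sign under
  the antipodal maps of two factors. Its sign labels cells by bits. Away from \<open>U j\<close> no
  such function is available, but a cochain need not be continuous, so any label with the same
  behaviour under the antipodal maps completes it. If n sets cover, a nonzero product of sm classes
  (n differences, padded by copies of x_(s-1)) yields a flag along which label j changes at step j,
  for every j. On a fine subdivision the whole flag lies where one of the n functions is defined and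
  has constant sign; with j the index of that function, step j is contradictory. Monomials are
  evaluated by representing the repeated factors x_i by signs of different coordinates, after which
  at most one orbit of flags contributes. The gap for odd m comes from the excesses: when m is 1
  modulo 4 all \<open>d\<^sub>\<ell>\<close> are even, so they add up to m - 1 at best, and one
  factor is lost.\<close>

declare add_bit_eq_xor [simp del] mult_bit_eq_and [simp del]
declare split_paired_All [simp del] split_paired_Ex [simp del]

lemma bit_add_self [simp]: "x + x = (0::bit)" "x + (x + y) = (y::bit)"
  by (cases x; cases y; simp)+

lemma sum_involution_bit:
  fixes w :: "'a \<Rightarrow> bit"
  assumes "finite A" "\<And>a. a \<in> A \<Longrightarrow> t a \<in> A" "\<And>a. a \<in> A \<Longrightarrow> t (t a) = a"
    "\<And>a. a \<in> A \<Longrightarrow> t a \<noteq> a" "\<And>a. a \<in> A \<Longrightarrow> w (t a) = w a"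
  shows "sum w A = 0"
  using assms
proof (induction "card A" arbitrary: A rule: less_induct)
  case less
  show ?case
  proof (cases "A = {}")
    case False
    then obtain a where a: "a \<in> A" by blast
    let ?B = "A - {a, t a}"
    have "sum w ?B = 0"
    proof (rule less.hyps)
      show "card ?B < card A"
        using a less.prems(1) by (intro psubset_card_mono) auto
      fix b assume b: "b \<in> ?B"
      then have "t b \<noteq> a" "t b \<noteq> t a" using less.prems(3) a by (metis DiffD1 DiffD2 insertI1 insertI2)+
      then show "t b \<in> ?B" using b less.prems(2) by blast
    qed (use less.prems in auto)
    moreover have "A = insert a (insert (t a) ?B)" using a less.prems(2) by blast
    then have "sum w A = sum w (insert a (insert (t a) ?B))" by simp
    then have "sum w A = w a + (w (t a) + sum w ?B)"
      using less.prems(1,4) a by (subst (asm) sum.insert; force)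
    ultimately show ?thesis using less.prems(5) a by simp
  qed simp
qed

locale cube_power =
  fixes s m :: nat and M :: int
  assumes M_even: "even M" and M_pos: "0 < M" and s_pos: "0 < s" and m_pos: "0 < m"
begin

definition coords :: "(nat \<times> nat) set" where
  "coords = {..<s} \<times> {..m}"

text \<open>A cell of \<open>(\<partial>[-M, M]\<^bsup>m+1\<^esup>)\<^sup>s\<close>, where \<open>M\<close> is even, is represented by an integral point: an even coordinate
  stands for a vertex of the line subdivided at the even integers, an odd coordinate for the open edge around it.
  Index \<open>(i, k)\<close> is the \<open>k\<close>-th coordinate of the \<open>i\<close>-th factor. The relation \<open>step\<close> below is covering in the
  face order, so that flags are the top simplices of the barycentric subdivision.\<close>

definition cells :: "(nat \<times> nat \<Rightarrow> int) set" where
  "cells = {v. (\<forall>p. p \<notin> coords \<longrightarrow> v p = 0) \<and> (\<forall>p\<in>coords. \<bar>v p\<bar> \<le> M) \<and>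
              (\<forall>i<s. \<exists>k\<le>m. \<bar>v (i, k)\<bar> = M)}"

definition step :: "(nat \<times> nat \<Rightarrow> int) \<Rightarrow> (nat \<times> nat \<Rightarrow> int) \<Rightarrow> bool" where
  "step u w \<longleftrightarrow> (\<exists>p\<in>coords. \<exists>d\<in>{1, -1}. even (u p) \<and> w = u(p := u p + d))"

text \<open>Each of the \<open>s * m\<close> steps makes one more coordinate odd, so a flag runs
  from a vertex to a top cell. The zero function beyond makes a flag determined by these
  entries.\<close>

definition flags :: "(nat \<Rightarrow> nat \<times> nat \<Rightarrow> int) set" where
  "flags = {c. (\<forall>j\<le>s*m. c j \<in> cells) \<and> (\<forall>j>s*m. c j = (\<lambda>_. 0)) \<and>
              (\<forall>p. even (c 0 p)) \<and> (\<forall>j<s*m. step (c j) (c (Suc j)))}"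

definition odd_coords :: "(nat \<times> nat \<Rightarrow> int) \<Rightarrow> (nat \<times> nat) set" where
  "odd_coords v = {p\<in>coords. odd (v p)}"

lemma finite_coords [simp]: "finite coords"
  by (simp add: coords_def)

lemma finite_odd_coords [simp]: "finite (odd_coords v)"
  by (simp add: odd_coords_def)

lemma finite_cells: "finite cells"
proof (rule finite_subset)
  show "cells \<subseteq> {f. \<forall>x. (x \<in> coords \<longrightarrow> f x \<in> {-M..M}) \<and> (x \<notin> coords \<longrightarrow> f x = 0)}"
    by (auto simp: cells_def abs_le_iff)
qed (intro finite_set_of_finite_funs, auto)

lemma finite_flags: "finite flags"
proof (rule finite_subset)
  show "flags \<subseteq> {f. \<forall>x. (x \<in> {..s*m} \<longrightarrow> f x \<in> cells) \<and> (x \<notin> {..s*m} \<longrightarrow> f x = (\<lambda>_. 0))}"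
    by (auto simp: flags_def)
qed (intro finite_set_of_finite_funs, auto simp: finite_cells)

lemma cell_extreme:
  assumes "v \<in> cells" "i < s"
  obtains k where "k \<le> m" "(i, k) \<in> coords" "\<bar>v (i, k)\<bar> = M" "even (v (i, k))"
proof -
  obtain k where "k \<le> m" "\<bar>v (i, k)\<bar> = M"
    using assms by (auto simp: cells_def)
  moreover then have "even (v (i, k))" using M_even by (metis even_abs_add_iff add.right_neutral)
  ultimately show thesis using assms(2) that by (auto simp: coords_def)
qed

lemma odd_coord_less:
  assumes "v \<in> cells" "odd (v p)"
  shows "p \<in> coords" "\<bar>v p\<bar> < M"
proof -
  show p: "p \<in> coords" using assms by (auto simp: cells_def)
  have "\<bar>v p\<bar> \<noteq> M" using M_even assms(2) by (metis even_abs_add_iff add.right_neutral)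
  then show "\<bar>v p\<bar> < M" using assms p by (force simp: cells_def)
qed

lemma step_odd_coords:
  assumes "step u w"
  shows "card (odd_coords w) = Suc (card (odd_coords u))"
proof -
  obtain p d where p: "p \<in> coords" "d \<in> {1, -1}" "even (u p)" "w = u(p := u p + d)"
    using assms unfolding step_def by blast
  then have "odd_coords w = insert p (odd_coords u)" "p \<notin> odd_coords u"
    by (auto simp: odd_coords_def)
  then show ?thesis by simp
qed

lemma flag_odd_card:
  assumes "c \<in> flags" "j \<le> s * m"
  shows "card (odd_coords (c j)) = j"
  using assms(2)
proof (induction j)
  case 0
  then show ?case using assms(1) by (simp add: flags_def odd_coords_def)
next
  case (Suc j)
  have "step (c j) (c (Suc j))" using assms(1) Suc.prems by (simp add: flags_def)
  then show ?case using step_odd_coords Suc by simp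
qed

text \<open>A step moves only an even coordinate and makes it odd for good, so a coordinate still
  even at position j has not moved before.\<close>

lemma flag_even_const:
  assumes "c \<in> flags" "j \<le> s * m" "even (c j p)" "i \<le> j"
  shows "c i p = c j p"
  using assms(4,2,3)
proof (induction j rule: dec_induct)
  case (step n)
  have "step (c n) (c (Suc n))" using assms(1) step.prems by (simp add: flags_def)
  then have "c n p = c (Suc n) p"
    using step.prems(2) unfolding step_def by (auto split: if_splits)
  then show ?case using step by simp
qed simp

text \<open>One of the m + 1 coordinates of each factor is extreme, hence even, which leaves at most
  m odd ones. A total of sm leaves no slack in any factor.\<close>

lemma top_cell_even:
  assumes "w \<in> cells" "card (odd_coords w) = s * m" "i < s"
  shows "\<exists>k\<le>m. \<bar>w (i, k)\<bar> = M \<and> (\<forall>k'\<le>m. even (w (i, k')) \<longrightarrow> k' = k)"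
proof -
  let ?O = "\<lambda>i. {k. k \<le> m \<and> odd (w (i, k))}"
  have le: "card (?O i) \<le> m" if i: "i < s" for i
  proof -
    obtain k where k: "k \<le> m" "even (w (i, k))" using cell_extreme[OF assms(1) i] by metis
    then have "?O i \<subseteq> {..m} - {k}" by auto
    then have "card (?O i) \<le> card ({..m} - {k})" by (intro card_mono) auto
    also have "\<dots> = m" using k by simp
    finally show ?thesis .
  qed
  have "odd_coords w = Sigma {..<s} ?O" by (auto simp: odd_coords_def coords_def)
  then have "(\<Sum>i<s. card (?O i)) = (\<Sum>i<s. m)"
    using assms(2) by (simp add: card_SigmaI)
  then have *: "card (?O i) = m"
    using sum_mono_inv[of "\<lambda>i. card (?O i)" "{..<s}" "\<lambda>_. m" i] le assms(3) by simp
  obtain k where k: "k \<le> m" "\<bar>w (i, k)\<bar> = M" "even (w (i, k))"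
    using cell_extreme[OF assms(1,3)] by metis
  have "?O i = {..m} - {k}"
    by (rule card_subset_eq) (use k * in auto)
  then show ?thesis using k by (intro exI[of _ k]) auto
qed

section \<open>Exchanging one element of a flag\<close>

lemma flag_upd_iff:
  assumes "c \<in> flags" "l \<le> s * m"
  shows "c(l := u) \<in> flags \<longleftrightarrow> u \<in> cells \<and> (l = 0 \<longrightarrow> (\<forall>p. even (u p))) \<and>
           (0 < l \<longrightarrow> step (c (l - 1)) u) \<and> (l < s * m \<longrightarrow> step u (c (Suc l)))"
proof
  assume c': "c(l := u) \<in> flags"
  have "(c(l := u)) l \<in> cells" using c' assms(2) unfolding flags_def by blast
  moreover have "\<forall>p. even ((c(l := u)) 0 p)" using c' unfolding flags_def by blast
  moreover have st: "step ((c(l := u)) j) ((c(l := u)) (Suc j))" if "j < s * m" for j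
    using c' that unfolding flags_def by blast
  ultimately show "u \<in> cells \<and> (l = 0 \<longrightarrow> (\<forall>p. even (u p))) \<and>
           (0 < l \<longrightarrow> step (c (l - 1)) u) \<and> (l < s * m \<longrightarrow> step u (c (Suc l)))"
  proof (intro conjI impI)
    assume "0 < l"
    then show "step (c (l - 1)) u" using st[of "l - 1"] assms(2) by (cases l) auto
  qed (use st[of l] in auto)
next
  assume u: "u \<in> cells \<and> (l = 0 \<longrightarrow> (\<forall>p. even (u p))) \<and>
           (0 < l \<longrightarrow> step (c (l - 1)) u) \<and> (l < s * m \<longrightarrow> step u (c (Suc l)))"
  have "step ((c(l := u)) j) ((c(l := u)) (Suc j))" if "j < s * m" for j
    using u assms(1) that unfolding flags_def by auto
  moreover have "(c(l := u)) j \<in> cells" if "j \<le> s * m" for j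
    using u assms(1) that unfolding flags_def by auto
  moreover have "(c(l := u)) j = (\<lambda>_. 0)" if "j > s * m" for j
    using assms that unfolding flags_def by auto
  moreover have "even ((c(l := u)) 0 p)" for p
    using u assms(1) unfolding flags_def by auto
  ultimately show "c(l := u) \<in> flags" unfolding flags_def by blast
qed

lemma stepE:
  assumes "step u w"
  obtains p d where "p \<in> coords" "d \<in> {1, -1}" "even (u p)" "w = u(p := u p + d)"
  using assms unfolding step_def by blast

lemma stepI:
  assumes "p \<in> coords" "d \<in> {1, -1}" "even (u p)" "w = u(p := u p + d)"
  shows "step u w"
  using assms unfolding step_def by blast

text \<open>The edge \<open>c 1\<close> has two endpoints, one on either side along its only odd
  coordinate.\<close>

lemma partner_bottom:
  assumes c: "c \<in> flags"
  shows "\<exists>u. u \<noteq> c 0 \<and> c(0 := u) \<in> flags \<and> (\<forall>u'. c(0 := u') \<in> flags \<longrightarrow> u' = c 0 \<or> u' = u)"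
proof -
  have N: "0 < s * m" using s_pos m_pos by simp
  have cells: "c 0 \<in> cells" "c 1 \<in> cells" and ev: "\<And>p. even (c 0 p)" and st: "step (c 0) (c 1)"
    using c N unfolding flags_def by auto
  obtain p d where p: "p \<in> coords" "d \<in> {1, -1}" "c 1 = (c 0)(p := c 0 p + d)"
    using st by (elim stepE)
  have od: "odd (c 1 q) \<longleftrightarrow> q = p" for q using p ev by auto
  define u where "u = (c 0)(p := c 0 p + 2 * d)"
  have lt: "\<bar>c 1 p\<bar> < M" using odd_coord_less[OF cells(2)] od by blast
  have "u \<in> cells"
  proof -
    have "\<exists>k\<le>m. \<bar>u (i, k)\<bar> = M" if i: "i < s" for i
    proof -
      obtain k where k: "k \<le> m" "\<bar>c 1 (i, k)\<bar> = M" "even (c 1 (i, k))"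
        using cell_extreme[OF cells(2) i] by metis
      then have "(i, k) \<noteq> p" using od by blast
      then have "u (i, k) = c 1 (i, k)" using p by (simp add: u_def)
      then show ?thesis using k by auto
    qed
    moreover have "\<bar>u q\<bar> \<le> M" if "q \<in> coords" for q
    proof (cases "q = p")
      case True
      then show ?thesis using lt p by (auto simp: u_def)
    next
      case False
      then show ?thesis using cells(1) that by (auto simp: u_def cells_def)
    qed
    moreover have "u q = 0" if "q \<notin> coords" for q
      using cells(1) that p(1) by (auto simp: u_def cells_def)
    ultimately show ?thesis unfolding cells_def by blast
  qed
  moreover have evu: "even (u q)" for q using ev by (simp add: u_def)
  moreover have "step u (c 1)"
    by (rule stepI[of p "- d"]) (use p ev evu in \<open>auto simp: u_def\<close>)
  ultimately have "c(0 := u) \<in> flags" using flag_upd_iff[OF c, of 0 u] by simp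
  moreover have "u \<noteq> c 0"
  proof
    assume "u = c 0"
    then have "u p = c 0 p" by simp
    then show False using p by (auto simp: u_def)
  qed
  moreover have "u' = c 0 \<or> u' = u" if "c(0 := u') \<in> flags" for u'
  proof -
    have ev': "\<And>q. even (u' q)" and "step u' (c 1)"
      using that flag_upd_iff[OF c, of 0 u'] N by auto
    then obtain q e where q: "q \<in> coords" "e \<in> {1, -1}" "c 1 = u'(q := u' q + e)"
      by (elim stepE)
    then have "odd (c 1 q)" using ev' by auto
    then have [simp]: "q = p" using od by blast
    have "u' r = c 0 r" if "r \<noteq> p" for r
      using that fun_cong[OF q(3), of r] fun_cong[OF p(3), of r] by simp
    moreover have "u' p = c 0 p + d - e"
      using fun_cong[OF q(3), of p] fun_cong[OF p(3), of p] by simp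
    ultimately have "u' = (c 0)(p := c 0 p + d - e)" by (auto simp: fun_eq_iff)
    then show ?thesis using p(2) q(2) by (auto simp: u_def)
  qed
  ultimately show ?thesis by blast
qed

text \<open>The diamond property: two coordinates become odd between positions l and l + 2, and they
  can do so in either order.\<close>

lemma partner_middle:
  assumes c: "c \<in> flags" and l: "Suc l < s * m"
  shows "\<exists>u. u \<noteq> c (Suc l) \<and> c(Suc l := u) \<in> flags \<and>
             (\<forall>u'. c(Suc l := u') \<in> flags \<longrightarrow> u' = c (Suc l) \<or> u' = u)"
proof -
  let ?u = "c l" and ?v = "c (Suc l)" and ?w = "c (Suc (Suc l))"
  have cells: "?u \<in> cells" "?v \<in> cells" "?w \<in> cells" and st: "step ?u ?v" "step ?v ?w"
    using c l unfolding flags_def by auto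
  obtain p d where p: "p \<in> coords" "d \<in> {1, -1}" "even (?u p)" "?v = ?u(p := ?u p + d)"
    using st(1) by (elim stepE)
  obtain q e where q: "q \<in> coords" "e \<in> {1, -1}" "even (?v q)" "?w = ?v(q := ?v q + e)"
    using st(2) by (elim stepE)
  have odp: "odd (?v p)" using p by auto
  then have pq: "p \<noteq> q" using q(3) by blast
  have vq: "?v q = ?u q" using p(4) pq by simp
  have w: "?w = ?u(p := ?u p + d, q := ?u q + e)" using p(4) q(4) pq by auto
  define x where "x = ?u(q := ?u q + e)"
  have wx: "?w = x(p := x p + d)" using w pq by (auto simp: x_def fun_eq_iff)
  have "x \<in> cells"
  proof -
    have "\<exists>k\<le>m. \<bar>x (i, k)\<bar> = M" if i: "i < s" for i
    proof -
      obtain k where k: "k \<le> m" "\<bar>?w (i, k)\<bar> = M" "even (?w (i, k))"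
        using cell_extreme[OF cells(3) i] by metis
      moreover have "odd (?w p)" "odd (?w q)" using q odp pq by auto
      ultimately have "(i, k) \<noteq> p" "(i, k) \<noteq> q" by auto
      then have "x (i, k) = ?w (i, k)" using w by (simp add: x_def)
      then show ?thesis using k by auto
    qed
    moreover have "\<bar>x r\<bar> \<le> M" if "r \<in> coords" for r
    proof (cases "r = p")
      case True
      then have "x r = ?u r" using pq by (simp add: x_def)
      then show ?thesis using cells(1) that by (simp add: cells_def)
    next
      case False
      then have "x r = ?w r" using w by (simp add: x_def)
      then show ?thesis using cells(3) that by (simp add: cells_def)
    qed
    moreover have "x r = 0" if "r \<notin> coords" for r
      using cells(1) that q(1) by (auto simp: x_def cells_def)
    ultimately show ?thesis unfolding cells_def by blast
  qed
  moreover have "step ?u x"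
    by (rule stepI[of q e]) (use q vq x_def in auto)
  moreover have "step x ?w"
    by (rule stepI[of p d]) (use p pq wx in \<open>auto simp: x_def\<close>)
  ultimately have "c(Suc l := x) \<in> flags" using flag_upd_iff[OF c, of "Suc l" x] l by simp
  moreover have "x \<noteq> ?v"
  proof
    assume "x = ?v"
    then have "x q = ?v q" by simp
    then show False using q(2) vq by (auto simp: x_def)
  qed
  moreover have "y = ?v \<or> y = x" if "c(Suc l := y) \<in> flags" for y
  proof -
    have "step ?u y" "step y ?w"
      using that flag_upd_iff[OF c, of "Suc l" y] l by auto
    then obtain p' d' q' e' where
      y: "p' \<in> coords" "d' \<in> {1, -1}" "even (?u p')" "y = ?u(p' := ?u p' + d')"
      and y': "q' \<in> coords" "e' \<in> {1, -1}" "even (y q')" "?w = y(q' := y q' + e')"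
      by (elim stepE)
    have "odd (y p')" using y by auto
    then have pq': "p' \<noteq> q'" using y'(3) by blast
    have w': "?w = ?u(p' := ?u p' + d', q' := ?u q' + e')"
      using y(4) y'(4) pq' by auto
    have "?w p' \<noteq> ?u p'" using w' pq' y(2) by auto
    then have "p' = p \<or> p' = q" using w by (auto split: if_splits)
    moreover have "?w p' = ?u p' + d'" using w' pq' by simp
    ultimately show ?thesis using y(4) w pq p(4) by (auto simp: x_def)
  qed
  ultimately show ?thesis by blast
qed

lemma cells_updI:
  assumes "v \<in> cells" "p \<in> coords" "\<bar>z\<bar> \<le> M" "k \<le> m" "(fst p, k) \<noteq> p" "\<bar>v (fst p, k)\<bar> = M"
  shows "v(p := z) \<in> cells"
proof -
  have "\<exists>k\<le>m. \<bar>(v(p := z)) (i, k)\<bar> = M" if "i < s" for i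
  proof (cases "i = fst p")
    case True
    then show ?thesis using assms by (intro exI[of _ k]) auto
  next
    case False
    then have "(i, k') \<noteq> p" for k' by auto
    then show ?thesis using assms(1) that unfolding cells_def by auto
  qed
  moreover have "\<bar>(v(p := z)) q\<bar> \<le> M" if "q \<in> coords" for q
    using assms(1,3) that by (auto simp: cells_def)
  moreover have "(v(p := z)) q = 0" if "q \<notin> coords" for q
    using assms(1,2) that by (auto simp: cells_def)
  ultimately show ?thesis unfolding cells_def by blast
qed

text \<open>A cell of codimension one lies in two top cells, as in any closed manifold. On a ridge
  of the cube two coordinates are extreme and either can be released inwards; otherwise one
  coordinate is free to move in both directions.\<close>

lemma partner_top:
  assumes c: "c \<in> flags" and N: "s * m = Suc l"
  shows "\<exists>u. u \<noteq> c (Suc l) \<and> c(Suc l := u) \<in> flags \<and>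
             (\<forall>u'. c(Suc l := u') \<in> flags \<longrightarrow> u' = c (Suc l) \<or> u' = u)"
proof -
  let ?u = "c l" and ?w = "c (Suc l)"
  have cells: "?u \<in> cells" "?w \<in> cells" and st: "step ?u ?w"
    using c N unfolding flags_def by auto
  have upd: "c(Suc l := y) \<in> flags \<longleftrightarrow> y \<in> cells \<and> step ?u y" for y
    using flag_upd_iff[OF c, of "Suc l" y] N by simp
  have od: "card (odd_coords ?u) = l" "card (odd_coords ?w) = s * m"
    using flag_odd_card[OF c] N by auto
  obtain p d where p: "p \<in> coords" "d \<in> {1, -1}" "even (?u p)" "?w = ?u(p := ?u p + d)"
    using st by (elim stepE)
  define i where "i = fst p"
  have i: "i < s" using p(1) by (auto simp: i_def coords_def)
  have odp: "odd (?w p)" using p by auto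
  then obtain k where k: "k \<le> m" "\<bar>?w (i, k)\<bar> = M" "\<And>k'. k' \<le> m \<Longrightarrow> even (?w (i, k')) \<Longrightarrow> k' = k"
    using top_cell_even[OF cells(2) od(2) i] by metis
  let ?q = "(i, k)"
  have evq: "even (?w ?q)" using cell_extreme[OF cells(2) i] k(3) by metis
  then have pq: "p \<noteq> ?q" using odp by blast
  have uq: "?u ?q = ?w ?q" using p(4) pq by simp
  have q: "?q \<in> coords" "even (?u ?q)" "\<bar>?u ?q\<bar> = M" using i k(1,2) uq evq by (auto simp: coords_def)
  have up: "\<bar>?u p\<bar> \<le> M" using cells(1) p(1) by (simp add: cells_def)
  \<comment> \<open>In another factor only one coordinate is even, and that one has to stay extreme.
    In the factor of \<open>p\<close> the even coordinates are \<open>p\<close> and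
    \<open>?q\<close>.\<close>
  have only: "\<exists>r e. (r = p \<or> r = ?q) \<and> e \<in> {1, -1} \<and> y = ?u(r := ?u r + e)"
    if y: "y \<in> cells" "step ?u y" for y
  proof -
    obtain r e where r: "r \<in> coords" "e \<in> {1, -1}" "even (?u r)" "y = ?u(r := ?u r + e)"
      using y(2) by (elim stepE)
    have "r = p \<or> r = ?q"
    proof (rule ccontr)
      assume n: "\<not> (r = p \<or> r = ?q)"
      obtain i' k1 where r': "r = (i', k1)" "i' < s" "k1 \<le> m" using r(1) by (auto simp: coords_def)
      have "even (?w r)" using r(3) p(4) n by simp
      then have ii: "i' \<noteq> i" using k(3) r' n by blast
      have evw: "even (?w (i', k'))" if "even (?u (i', k'))" for k'
      proof -
        have "(i', k') \<noteq> p" using ii by (auto simp: i_def)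
        then show ?thesis using that p(4) by simp
      qed
      obtain k2 where k2: "k2 \<le> m" "even (y (i', k2))" using cell_extreme[OF y(1) r'(2)] by metis
      have "odd (y r)" using r by auto
      then have "k2 \<noteq> k1" using k2 r' by blast
      then have "even (?u (i', k2))" using k2 r(4) r' by simp
      moreover have "even (?u (i', k1))" using r(3) r' by simp
      ultimately show False using top_cell_even[OF cells(2) od(2) r'(2)] evw k2(1) r'(3) \<open>k2 \<noteq> k1\<close>
        by metis
    qed
    then show ?thesis using r by blast
  qed
  show ?thesis
  proof (cases "\<bar>?u p\<bar> = M")
    case True
    \<comment> \<open>The ridge case: \<open>?q\<close> is released instead of \<open>p\<close>, and
      the sign of \<open>e\<close> points into the cube.\<close>
    define e where "e = (if ?u ?q > 0 then -1 else 1 :: int)"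
    define x where "x = ?u(?q := ?u ?q + e)"
    have "x \<in> cells" unfolding x_def
      by (rule cells_updI[OF cells(1) q(1), of _ "snd p"])
        (use q M_pos p(1) True pq in \<open>auto simp: e_def i_def coords_def\<close>)
    moreover have "step ?u x"
      by (rule stepI[of ?q e]) (use q in \<open>auto simp: x_def e_def\<close>)
    moreover have "x \<noteq> ?w"
    proof
      assume "x = ?w"
      then have "x ?q = ?w ?q" by simp
      then show False using uq by (auto simp: x_def e_def split: if_splits)
    qed
    moreover have "y = ?w \<or> y = x" if y: "y \<in> cells" "step ?u y" for y
    proof -
      obtain r e' where r: "r = p \<or> r = ?q" "e' \<in> {1, -1}" "y = ?u(r := ?u r + e')"
        using only[OF y] by blast
      have "\<bar>?u p + d\<bar> \<le> M" "\<bar>?u r + e'\<bar> \<le> M"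
        using cells(2) p(1,4) y(1) r(1,3) q(1) by (auto simp: cells_def)
      then show ?thesis
        using r p(2,4) True q(3) M_pos by (auto simp: x_def e_def abs_le_iff abs_if split: if_splits)
    qed
    ultimately show ?thesis unfolding upd by blast
  next
    case False
    define x where "x = ?u(p := ?u p - d)"
    have "x \<in> cells" unfolding x_def
      by (rule cells_updI[OF cells(1) p(1), of _ k])
        (use q k(1) p(2) up False pq in \<open>auto simp: i_def\<close>)
    moreover have "step ?u x"
      by (rule stepI[of p "- d"]) (use p in \<open>auto simp: x_def\<close>)
    moreover have "x \<noteq> ?w"
    proof
      assume "x = ?w"
      then have "x p = ?w p" by simp
      then show False using p by (auto simp: x_def)
    qed
    moreover have "y = ?w \<or> y = x" if y: "y \<in> cells" "step ?u y" for y
    proof -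
      obtain r e' where r: "r = p \<or> r = ?q" "e' \<in> {1, -1}" "y = ?u(r := ?u r + e')"
        using only[OF y] by blast
      have "r \<noteq> ?q"
      proof
        assume rq: "r = ?q"
        obtain k' where k': "k' \<le> m" "\<bar>y (i, k')\<bar> = M" "even (y (i, k'))"
          using cell_extreme[OF y(1) i] by metis
        have "odd (y ?q)" using r(2,3) rq q(2) by auto
        then have "k' \<noteq> k" using k'(3) by blast
        then have yu: "y (i, k') = ?u (i, k')" using r(3) rq by simp
        then have "(i, k') \<noteq> p" using k'(2) False by auto
        then have "even (?w (i, k'))" using yu k'(3) p(4) by simp
        then show False using k(3) k'(1) \<open>k' \<noteq> k\<close> by blast
      qed
      then show ?thesis using r p(2,4) by (auto simp: x_def)
    qed
    ultimately show ?thesis unfolding upd by blast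
  qed
qed

definition partner :: "nat \<Rightarrow> (nat \<Rightarrow> nat \<times> nat \<Rightarrow> int) \<Rightarrow> nat \<Rightarrow> nat \<times> nat \<Rightarrow> int" where
  "partner l c = c(l := (THE u. u \<noteq> c l \<and> c(l := u) \<in> flags))"

lemma partner_exists:
  assumes "c \<in> flags" "l \<le> s * m"
  shows "\<exists>u. u \<noteq> c l \<and> c(l := u) \<in> flags \<and> (\<forall>u'. c(l := u') \<in> flags \<longrightarrow> u' = c l \<or> u' = u)"
proof (cases l)
  case (Suc l')
  then show ?thesis
    using assms partner_middle[of c l'] partner_top[of c l'] by (cases "l = s * m") auto
qed (use partner_bottom assms in auto)

lemma partner:
  assumes "c \<in> flags" "l \<le> s * m"
  shows "partner l c \<in> flags" "partner l c l \<noteq> c l" "j \<noteq> l \<Longrightarrow> partner l c j = c j"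
    "c' \<in> flags \<Longrightarrow> c' l \<noteq> c l \<Longrightarrow> (\<And>j. j \<noteq> l \<Longrightarrow> c' j = c j) \<Longrightarrow> partner l c = c'"
proof -
  obtain u where u: "u \<noteq> c l" "c(l := u) \<in> flags" "\<And>u'. c(l := u') \<in> flags \<Longrightarrow> u' = c l \<or> u' = u"
    using partner_exists[OF assms] by blast
  then have "(THE u. u \<noteq> c l \<and> c(l := u) \<in> flags) = u" by (intro the_equality) auto
  then have pu: "partner l c = c(l := u)" by (simp add: partner_def)
  then show "partner l c \<in> flags" "partner l c l \<noteq> c l" "j \<noteq> l \<Longrightarrow> partner l c j = c j"
    using u by auto
  assume c': "c' \<in> flags" "c' l \<noteq> c l" "\<And>j. j \<noteq> l \<Longrightarrow> c' j = c j"
  then have "c' = c(l := c' l)" by (auto simp: fun_eq_iff)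
  then show "partner l c = c'" using u(3)[of "c' l"] c' pu by metis
qed

end

lemma bit_add_eq: "a + b = c \<Longrightarrow> a = c + (b::bit)"
  by (cases a; cases b) auto

text \<open>Each summand is the difference of two consecutive mixed products, which have factors
  \<open>x\<close> before a position and factors \<open>y\<close> from it on.\<close>

lemma telescope_bit:
  fixes x y :: "nat \<Rightarrow> bit"
  assumes "a \<le> n"
  shows "(\<Prod>k\<in>{a..<n}. y k) +
           (\<Sum>l\<in>{a..<n}. (\<Prod>k\<in>{a..<l}. x k) * (x l + y l) * (\<Prod>k\<in>{Suc l..<n}. y k)) =
         (\<Prod>k\<in>{a..<n}. x k)"
  using assms
proof (induction n rule: dec_induct)
  case (step n)
  have "(\<Prod>k\<in>{a..<Suc n}. y k) +
          (\<Sum>l\<in>{a..<Suc n}. (\<Prod>k\<in>{a..<l}. x k) * (x l + y l) * (\<Prod>k\<in>{Suc l..<Suc n}. y k)) =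
        ((\<Prod>k\<in>{a..<n}. y k) +
          (\<Sum>l\<in>{a..<n}. (\<Prod>k\<in>{a..<l}. x k) * (x l + y l) * (\<Prod>k\<in>{Suc l..<n}. y k))) * y n +
        (\<Prod>k\<in>{a..<n}. x k) * (x n + y n)"
    using step.hyps by (simp add: sum_distrib_left sum_distrib_right algebra_simps prod.atLeastLessThan_Suc)
  also have "\<dots> = (\<Prod>k\<in>{a..<Suc n}. x k)"
    unfolding step.IH using step.hyps by (simp add: algebra_simps prod.atLeastLessThan_Suc)
  finally show ?case .
qed simp

context cube_power
begin

section \<open>The group of signs and its orbits of flags\<close>

definition flip :: "(nat \<Rightarrow> int) \<Rightarrow> (nat \<times> nat \<Rightarrow> int) \<Rightarrow> nat \<times> nat \<Rightarrow> int" where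
  "flip \<epsilon> v = (\<lambda>p. \<epsilon> (fst p) * v p)"

definition signs :: "(nat \<Rightarrow> int) set" where
  "signs = {\<epsilon>. \<forall>i. \<epsilon> i \<in> {1, -1}}"

lemma signsD: "\<epsilon> \<in> signs \<Longrightarrow> \<epsilon> i = 1 \<or> \<epsilon> i = -1"
  by (auto simp: signs_def)

lemma flip_flip [simp]:
  assumes "\<epsilon> \<in> signs"
  shows "flip \<epsilon> (flip \<epsilon> v) = v"
proof
  show "flip \<epsilon> (flip \<epsilon> v) p = v p" for p
    unfolding flip_def using signsD[OF assms, of "fst p"] by auto
qed

lemma abs_flip [simp]: "\<epsilon> \<in> signs \<Longrightarrow> \<bar>flip \<epsilon> v p\<bar> = \<bar>v p\<bar>"
  unfolding flip_def using signsD[of \<epsilon> "fst p"] by auto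

lemma even_flip [simp]: "\<epsilon> \<in> signs \<Longrightarrow> even (flip \<epsilon> v p) \<longleftrightarrow> even (v p)"
  unfolding flip_def using signsD[of \<epsilon> "fst p"] by auto

lemma flip_eq_0_iff [simp]: "\<epsilon> \<in> signs \<Longrightarrow> flip \<epsilon> v p = 0 \<longleftrightarrow> v p = 0"
  unfolding flip_def using signsD[of \<epsilon> "fst p"] by auto

lemma flip_cells [simp]: "\<epsilon> \<in> signs \<Longrightarrow> flip \<epsilon> v \<in> cells \<longleftrightarrow> v \<in> cells"
  by (simp add: cells_def)

lemma flip_step:
  assumes "\<epsilon> \<in> signs" "step u w"
  shows "step (flip \<epsilon> u) (flip \<epsilon> w)"
  using assms(2)
proof (elim stepE)
  fix p d assume p: "p \<in> coords" "d \<in> {1, -1}" "even (u p)" "w = u(p := u p + d)"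
  show ?thesis
  proof (rule stepI[of p "\<epsilon> (fst p) * d"])
    show "flip \<epsilon> w = (flip \<epsilon> u)(p := flip \<epsilon> u p + \<epsilon> (fst p) * d)"
      by (auto simp: flip_def p fun_eq_iff algebra_simps)
  qed (use p assms(1) signsD[of \<epsilon> "fst p"] in auto)
qed

lemma flip_flags:
  assumes "\<epsilon> \<in> signs" "c \<in> flags"
  shows "(\<lambda>j. flip \<epsilon> (c j)) \<in> flags"
  using assms(2) flip_step[OF assms(1)] unfolding flags_def
  by (auto simp: assms(1) flip_def[of _ "\<lambda>_. 0"])

text \<open>The action on cells is free in the first s signs, because every factor has a coordinate
  of absolute value M > 0.\<close>

lemma flip_fixed:
  assumes "\<epsilon> \<in> signs" "v \<in> cells" "flip \<epsilon> v = v" "i < s"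
  shows "\<epsilon> i = 1"
proof -
  obtain k where "\<bar>v (i, k)\<bar> = M" using cell_extreme[OF assms(2,4)] by metis
  moreover have "\<epsilon> i * v (i, k) = v (i, k)" using fun_cong[OF assms(3), of "(i, k)"] by (simp add: flip_def)
  ultimately show ?thesis using M_pos by auto
qed

text \<open>The sign of the coordinate \<open>(i, k)\<close>; the leading coordinate of the factor breaks ties, so that the sign
  bit changes under the antipodal map of the factor also where the coordinate vanishes.\<close>

definition leading :: "nat \<Rightarrow> (nat \<times> nat \<Rightarrow> int) \<Rightarrow> int" where
  "leading i v = v (i, LEAST k. v (i, k) \<noteq> 0)"

definition sgn_bit :: "nat \<Rightarrow> nat \<Rightarrow> (nat \<times> nat \<Rightarrow> int) \<Rightarrow> bit" where
  "sgn_bit i k v = of_bool ((if v (i, k) \<noteq> 0 then v (i, k) else leading i v) < 0)"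

lemma leading_nonzero:
  assumes "v \<in> cells" "i < s"
  shows "leading i v \<noteq> 0"
proof -
  obtain k where "\<bar>v (i, k)\<bar> = M" using cell_extreme[OF assms] by metis
  then have "v (i, k) \<noteq> 0" using M_pos by auto
  then show ?thesis unfolding leading_def by (rule LeastI)
qed

lemma sgn_bit_flip:
  assumes "v \<in> cells" "i < s" "\<epsilon> \<in> signs"
  shows "sgn_bit i k (flip \<epsilon> v) = sgn_bit i k v + of_bool (\<epsilon> i = -1)"
proof -
  have [simp]: "leading i (flip \<epsilon> v) = \<epsilon> i * leading i v"
    unfolding leading_def flip_eq_0_iff[OF assms(3)] by (simp add: flip_def)
  have "flip \<epsilon> v (i, k) = \<epsilon> i * v (i, k)" by (simp add: flip_def)
  then show ?thesis
    using signsD[OF assms(3), of i] leading_nonzero[OF assms(1,2)] by (auto simp: sgn_bit_def)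
qed

text \<open>One flag from each orbit: flipping factor i toggles the bit \<open>sgn_bit i 0\<close>
  of the vertex \<open>c 0\<close>.\<close>

definition based :: "(nat \<Rightarrow> nat \<times> nat \<Rightarrow> int) set" where
  "based = {c\<in>flags. \<forall>i<s. sgn_bit i 0 (c 0) = 0}"

lemma finite_based [simp]: "finite based"
  using finite_flags by (auto simp: based_def)

text \<open>Signs of index s and beyond act trivially on cells; fixing them at 1 lets the sign
  vector be recovered from its action.\<close>

definition orient :: "(nat \<times> nat \<Rightarrow> int) \<Rightarrow> nat \<Rightarrow> int" where
  "orient v i = (if i < s \<and> sgn_bit i 0 v = 1 then -1 else 1)"

lemma orient_signs [simp]: "orient v \<in> signs"
  by (simp add: orient_def signs_def)

lemma flag_cell: "c \<in> flags \<Longrightarrow> j \<le> s * m \<Longrightarrow> c j \<in> cells"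
  by (simp add: flags_def)

lemma orient_based:
  assumes "c \<in> flags"
  shows "(\<lambda>j. flip (orient (c 0)) (c j)) \<in> based"
  using assms flip_flags[OF orient_signs assms]
  by (auto simp: based_def sgn_bit_flip flag_cell orient_def)

text \<open>Taking the partner at position l and returning to the representative of its orbit is an
  involution of \<open>based\<close> without fixed points, and it preserves
  \<open>w\<close>.\<close>

lemma sum_based_eq_0:
  assumes l: "l \<le> s * m"
    and flip: "\<And>c \<epsilon>. c \<in> flags \<Longrightarrow> \<epsilon> \<in> signs \<Longrightarrow> w (\<lambda>j. flip \<epsilon> (c j)) = w c"
    and indep: "\<And>c c'. c \<in> flags \<Longrightarrow> c' \<in> flags \<Longrightarrow> (\<And>j. j \<noteq> l \<Longrightarrow> c' j = c j) \<Longrightarrow> w c' = (w c :: bit)"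
  shows "sum w based = 0"
proof -
  define t where "t c = (\<lambda>j. flip (orient (partner l c 0)) (partner l c j))" for c
  show ?thesis
  proof (rule sum_involution_bit[of based t])
    fix c assume c: "c \<in> based"
    then have cf: "c \<in> flags" by (simp add: based_def)
    note p = partner[OF cf l]
    let ?p = "partner l c"
    define \<epsilon> where "\<epsilon> = orient (?p 0)"
    have \<epsilon>: "\<epsilon> \<in> signs" by (simp add: \<epsilon>_def)
    have tc: "t c = (\<lambda>j. flip \<epsilon> (?p j))" by (simp add: t_def \<epsilon>_def)
    show tb: "t c \<in> based" unfolding t_def by (rule orient_based[OF p(1)])
    then have tf: "t c \<in> flags" by (simp add: based_def)
    have pt: "partner l (t c) = (\<lambda>j. flip \<epsilon> (c j))"
    proof (rule partner(4)[OF tf l])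
      show "(\<lambda>j. flip \<epsilon> (c j)) \<in> flags" by (rule flip_flags[OF \<epsilon> cf])
      show "flip \<epsilon> (c l) \<noteq> t c l"
        using p(2) flip_flip[OF \<epsilon>] unfolding tc by metis
    qed (simp add: tc p(3))
    have "sgn_bit i 0 (flip \<epsilon> (c 0)) = of_bool (\<epsilon> i = -1)" if "i < s" for i
      using c that sgn_bit_flip[OF flag_cell[OF cf, of 0] that \<epsilon>] by (simp add: based_def)
    then have "orient (flip \<epsilon> (c 0)) = \<epsilon>"
      using signsD[OF \<epsilon>] by (auto simp: orient_def fun_eq_iff) (auto simp: \<epsilon>_def orient_def)
    then show "t (t c) = c"
      unfolding t_def[of "t c"] pt using \<epsilon> by simp
    show "t c \<noteq> c"
    proof
      assume eq: "t c = c"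
      \<comment> \<open>Some vertex other than l exists because sm > 0. A fixed flag would force the
        signs to fix that vertex, hence to be trivial, so the flag would be its own partner.\<close>
      define l' where "l' = (if l = 0 then s * m else 0)"
      have l': "l' \<noteq> l" "l' \<le> s * m" using s_pos m_pos by (auto simp: l'_def)
      have "flip \<epsilon> (c l') = c l'" using fun_cong[OF eq, of l'] p(3)[OF l'(1)] by (simp add: tc)
      then have "\<epsilon> i = 1" if "i < s" for i using flip_fixed[OF \<epsilon> flag_cell[OF cf l'(2)]] that by blast
      then have "\<epsilon> i = 1" for i by (cases "i < s") (auto simp: \<epsilon>_def orient_def)
      then have "t c = ?p" by (auto simp: tc flip_def)
      then show False using p(2) eq by simp
    qed
    show "w (t c) = w c"
      unfolding tc using flip[OF p(1) \<epsilon>] indep[OF cf p(1)] p(3) by simp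
  qed simp
qed

section \<open>Cochains on the quotient and Stokes' theorem\<close>

definition cocycle :: "((nat \<times> nat \<Rightarrow> int) \<Rightarrow> (nat \<times> nat \<Rightarrow> int) \<Rightarrow> bit) \<Rightarrow> bool" where
  "cocycle e \<longleftrightarrow> (\<forall>u v w. e u v + e v w = e u w) \<and>
     (\<forall>\<epsilon>\<in>signs. \<forall>u\<in>cells. \<forall>w\<in>cells. e (flip \<epsilon> u) (flip \<epsilon> w) = e u w)"

definition invariant :: "((nat \<times> nat \<Rightarrow> int) \<Rightarrow> bit) \<Rightarrow> bool" where
  "invariant b \<longleftrightarrow> (\<forall>\<epsilon>\<in>signs. \<forall>u\<in>cells. b (flip \<epsilon> u) = b u)"

text \<open>The cup product of the one-cochains \<open>e j\<close> on the quotient by the signs, evaluated on the mod 2 fundamental class.\<close>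

definition cup :: "(nat \<Rightarrow> (nat \<times> nat \<Rightarrow> int) \<Rightarrow> (nat \<times> nat \<Rightarrow> int) \<Rightarrow> bit) \<Rightarrow> bit" where
  "cup e = (\<Sum>c\<in>based. \<Prod>j<s*m. e j (c j) (c (Suc j)))"

lemma cocycle_add: "cocycle e \<Longrightarrow> e u v + e v w = e u w"
  by (simp add: cocycle_def)

lemma cocycle_flip: "cocycle e \<Longrightarrow> \<epsilon> \<in> signs \<Longrightarrow> u \<in> cells \<Longrightarrow> w \<in> cells \<Longrightarrow> e (flip \<epsilon> u) (flip \<epsilon> w) = e u w"
  by (simp add: cocycle_def)

lemma invariantD: "invariant b \<Longrightarrow> \<epsilon> \<in> signs \<Longrightarrow> u \<in> cells \<Longrightarrow> b (flip \<epsilon> u) = b u"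
  by (simp add: invariant_def)

text \<open>Stokes' theorem: with \<open>F\<close> and \<open>B\<close> the products of the cocycles before and after position \<open>i\<close>, the
  integrand is the coboundary of \<open>F \<union> b \<union> B\<close>, written as the sum of its faces by two telescoping products, and the sum
  over the flags of a cochain that ignores the \<open>l\<close>-th vertex vanishes by \<open>sum_based_eq_0\<close>.\<close>

lemma cup_coboundary:
  assumes e: "\<And>j. j < s * m \<Longrightarrow> cocycle (e j)" and b: "invariant b" and i: "i < s * m"
  shows "cup (e(i := \<lambda>u w. b u + b w)) = 0"
proof -
  let ?N = "s * m"
  define x where "x c k = e k (c k) (c (Suc k))" for c k
  define y where "y c k = e k (c (Suc k)) (c (Suc (Suc k)))" for c k
  define z where "z c k = e k (c (k - 1)) (c k)" for c k
  define F where "F c = (\<Prod>k\<in>{0..<i}. x c k)" for c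
  define B where "B c = (\<Prod>k\<in>{Suc i..<?N}. x c k)" for c
  have xf: "x (\<lambda>j. flip \<epsilon> (c j)) k = x c k" if "c \<in> flags" "\<epsilon> \<in> signs" "k < ?N" for c k \<epsilon>
    unfolding x_def using that by (intro cocycle_flip e) (auto simp: flag_cell)
  have yf: "y (\<lambda>j. flip \<epsilon> (c j)) k = y c k" if "c \<in> flags" "\<epsilon> \<in> signs" "Suc k < ?N" for c k \<epsilon>
    unfolding y_def using that by (intro cocycle_flip e) (auto simp: flag_cell)
  have zf: "z (\<lambda>j. flip \<epsilon> (c j)) k = z c k" if "c \<in> flags" "\<epsilon> \<in> signs" "k < ?N" for c k \<epsilon>
    unfolding z_def using that by (intro cocycle_flip e) (auto simp: flag_cell)
  have bf: "b (flip \<epsilon> (c k)) = b (c k)" if "c \<in> flags" "\<epsilon> \<in> signs" "k \<le> ?N" for c k \<epsilon>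
    using that b by (intro invariantD) (auto simp: flag_cell)
  have ef: "e k (flip \<epsilon> (c p)) (flip \<epsilon> (c q)) = e k (c p) (c q)"
    if "c \<in> flags" "\<epsilon> \<in> signs" "k < ?N" "p \<le> ?N" "q \<le> ?N" for c k \<epsilon> p q
    using that by (intro cocycle_flip e) (auto simp: flag_cell)
  note flips = xf yf zf bf ef
  have pw: "(\<Prod>j<?N. (e(i := \<lambda>u w. b u + b w)) j (c j) (c (Suc j))) =
      ((\<Prod>k\<in>{0..<i}. y c k) * b (c (Suc i)) * B c +
       (\<Sum>l\<in>{0..<i}. (\<Prod>k\<in>{0..<l}. x c k) * e l (c l) (c (Suc (Suc l))) * (\<Prod>k\<in>{Suc l..<i}. y c k) *
          b (c (Suc i)) * B c)) +
      (F c * b (c i) * (\<Prod>k\<in>{Suc i..<?N}. z c k) +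
       (\<Sum>l\<in>{Suc i..<?N}. F c * b (c i) * ((\<Prod>k\<in>{Suc i..<l}. z c k) * e l (c (l - 1)) (c (Suc l)) *
          (\<Prod>k\<in>{Suc l..<?N}. x c k))))" for c
  proof -
    have "{..<?N} = insert i ({0..<i} \<union> {Suc i..<?N})" using i by auto
    then have "(\<Prod>j<?N. (e(i := \<lambda>u w. b u + b w)) j (c j) (c (Suc j))) =
        (b (c i) + b (c (Suc i))) * (\<Prod>j\<in>{0..<i} \<union> {Suc i..<?N}. (e(i := \<lambda>u w. b u + b w)) j (c j) (c (Suc j)))"
      by simp
    also have "(\<Prod>j\<in>{0..<i} \<union> {Suc i..<?N}. (e(i := \<lambda>u w. b u + b w)) j (c j) (c (Suc j))) =
        (\<Prod>j\<in>{0..<i} \<union> {Suc i..<?N}. x c j)"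
      by (intro prod.cong) (auto simp: x_def)
    also have "\<dots> = F c * B c"
      unfolding F_def B_def by (intro prod.union_disjoint) auto
    finally have 1: "(\<Prod>j<?N. (e(i := \<lambda>u w. b u + b w)) j (c j) (c (Suc j))) =
        F c * b (c (Suc i)) * B c + F c * b (c i) * B c" by (simp add: algebra_simps)
    have "e l (c l) (c (Suc (Suc l))) = x c l + y c l" if "l < ?N" for l
      using cocycle_add[OF e[OF that]] by (simp add: x_def y_def)
    then have "(\<Sum>l\<in>{0..<i}. (\<Prod>k\<in>{0..<l}. x c k) * e l (c l) (c (Suc (Suc l))) * (\<Prod>k\<in>{Suc l..<i}. y c k)) =
        (\<Sum>l\<in>{0..<i}. (\<Prod>k\<in>{0..<l}. x c k) * (x c l + y c l) * (\<Prod>k\<in>{Suc l..<i}. y c k))"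
      using i by (intro sum.cong) auto
    then have 2: "F c = (\<Prod>k\<in>{0..<i}. y c k) +
        (\<Sum>l\<in>{0..<i}. (\<Prod>k\<in>{0..<l}. x c k) * e l (c l) (c (Suc (Suc l))) * (\<Prod>k\<in>{Suc l..<i}. y c k))"
      using telescope_bit[of 0 i "y c" "x c"] by (simp add: F_def)
    have "e l (c (l - 1)) (c (Suc l)) = z c l + x c l" if "l < ?N" for l
      using cocycle_add[OF e[OF that]] by (simp add: x_def z_def)
    then have "(\<Sum>l\<in>{Suc i..<?N}. (\<Prod>k\<in>{Suc i..<l}. z c k) * e l (c (l - 1)) (c (Suc l)) * (\<Prod>k\<in>{Suc l..<?N}. x c k)) =
        (\<Sum>l\<in>{Suc i..<?N}. (\<Prod>k\<in>{Suc i..<l}. z c k) * (z c l + x c l) * (\<Prod>k\<in>{Suc l..<?N}. x c k))"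
      by (intro sum.cong) auto
    then have "B c + (\<Sum>l\<in>{Suc i..<?N}. (\<Prod>k\<in>{Suc i..<l}. z c k) * e l (c (l - 1)) (c (Suc l)) * (\<Prod>k\<in>{Suc l..<?N}. x c k)) =
        (\<Prod>k\<in>{Suc i..<?N}. z c k)"
      using telescope_bit[of "Suc i" ?N "x c" "z c"] i by (simp add: B_def)
    then have 3: "B c = (\<Prod>k\<in>{Suc i..<?N}. z c k) +
        (\<Sum>l\<in>{Suc i..<?N}. (\<Prod>k\<in>{Suc i..<l}. z c k) * e l (c (l - 1)) (c (Suc l)) * (\<Prod>k\<in>{Suc l..<?N}. x c k))"
      by (rule bit_add_eq)
    have 4: "F c * b (c (Suc i)) * B c = (\<Prod>k\<in>{0..<i}. y c k) * b (c (Suc i)) * B c +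
       (\<Sum>l\<in>{0..<i}. (\<Prod>k\<in>{0..<l}. x c k) * e l (c l) (c (Suc (Suc l))) * (\<Prod>k\<in>{Suc l..<i}. y c k) *
          b (c (Suc i)) * B c)"
      by (subst 2) (simp add: distrib_right sum_distrib_right)
    have 5: "F c * b (c i) * B c = F c * b (c i) * (\<Prod>k\<in>{Suc i..<?N}. z c k) +
       (\<Sum>l\<in>{Suc i..<?N}. F c * b (c i) * ((\<Prod>k\<in>{Suc i..<l}. z c k) * e l (c (l - 1)) (c (Suc l)) *
          (\<Prod>k\<in>{Suc l..<?N}. x c k)))"
      by (subst 3) (simp add: distrib_left sum_distrib_left)
    show ?thesis unfolding 1 4 5 ..
  qed
  \<comment> \<open>The terms are the faces of the flag. \<open>A0\<close> omits vertex 0,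
    \<open>A\<close> a vertex from 1 to i, \<open>B0\<close> the vertex \<open>?N\<close>, and
    \<open>Bl\<close> a vertex from i + 1 to \<open>?N - 1\<close>.\<close>
  have A0: "(\<Sum>c\<in>based. (\<Prod>k\<in>{0..<i}. y c k) * b (c (Suc i)) * B c) = 0"
  proof (rule sum_based_eq_0[of 0])
    fix c c' :: "nat \<Rightarrow> nat \<times> nat \<Rightarrow> int"
    assume *: "\<And>j. j \<noteq> 0 \<Longrightarrow> c' j = c j"
    show "(\<Prod>k\<in>{0..<i}. y c' k) * b (c' (Suc i)) * B c' = (\<Prod>k\<in>{0..<i}. y c k) * b (c (Suc i)) * B c"
      by (intro arg_cong2[of _ _ _ _ "(*)"] prod.cong) (auto simp: y_def B_def x_def *)
  qed (use i in \<open>auto simp: flips B_def\<close>)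
  have A: "(\<Sum>c\<in>based. (\<Prod>k\<in>{0..<l}. x c k) * e l (c l) (c (Suc (Suc l))) * (\<Prod>k\<in>{Suc l..<i}. y c k) *
          b (c (Suc i)) * B c) = 0" if l: "l < i" for l
  proof (rule sum_based_eq_0[of "Suc l"])
    fix c c' :: "nat \<Rightarrow> nat \<times> nat \<Rightarrow> int"
    assume *: "\<And>j. j \<noteq> Suc l \<Longrightarrow> c' j = c j"
    show "(\<Prod>k\<in>{0..<l}. x c' k) * e l (c' l) (c' (Suc (Suc l))) * (\<Prod>k\<in>{Suc l..<i}. y c' k) *
          b (c' (Suc i)) * B c' = (\<Prod>k\<in>{0..<l}. x c k) * e l (c l) (c (Suc (Suc l))) * (\<Prod>k\<in>{Suc l..<i}. y c k) *
          b (c (Suc i)) * B c"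
      using l by (intro arg_cong2[of _ _ _ _ "(*)"] prod.cong) (auto simp: y_def B_def x_def *)
  qed (use i l in \<open>auto simp: flips B_def\<close>)
  have B0: "(\<Sum>c\<in>based. F c * b (c i) * (\<Prod>k\<in>{Suc i..<?N}. z c k)) = 0"
  proof (rule sum_based_eq_0[of ?N])
    fix c c' :: "nat \<Rightarrow> nat \<times> nat \<Rightarrow> int"
    assume *: "\<And>j. j \<noteq> ?N \<Longrightarrow> c' j = c j"
    show "F c' * b (c' i) * (\<Prod>k\<in>{Suc i..<?N}. z c' k) = F c * b (c i) * (\<Prod>k\<in>{Suc i..<?N}. z c k)"
      using i by (intro arg_cong2[of _ _ _ _ "(*)"] prod.cong) (auto simp: z_def F_def x_def *)
  qed (use i in \<open>auto simp: flips F_def\<close>)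
  have Bl: "(\<Sum>c\<in>based. F c * b (c i) * ((\<Prod>k\<in>{Suc i..<l}. z c k) * e l (c (l - 1)) (c (Suc l)) *
          (\<Prod>k\<in>{Suc l..<?N}. x c k))) = 0" if l: "l \<in> {Suc i..<?N}" for l
  proof (rule sum_based_eq_0[of l])
    fix c c' :: "nat \<Rightarrow> nat \<times> nat \<Rightarrow> int"
    assume *: "\<And>j. j \<noteq> l \<Longrightarrow> c' j = c j"
    show "F c' * b (c' i) * ((\<Prod>k\<in>{Suc i..<l}. z c' k) * e l (c' (l - 1)) (c' (Suc l)) *
          (\<Prod>k\<in>{Suc l..<?N}. x c' k)) = F c * b (c i) * ((\<Prod>k\<in>{Suc i..<l}. z c k) * e l (c (l - 1)) (c (Suc l)) *
          (\<Prod>k\<in>{Suc l..<?N}. x c k))"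
      using l by (intro arg_cong2[of _ _ _ _ "(*)"] prod.cong) (auto simp: z_def F_def x_def *)
  qed (use i l in \<open>auto simp: flips F_def\<close>)
  show ?thesis
    unfolding cup_def pw
    by (simp add: sum.distrib A0 B0 sum.swap[of _ _ based] A Bl[unfolded One_nat_def])
qed

end

section \<open>Evaluation of monomials in the generators\<close>

lemma ex_rank:
  fixes A :: "nat set"
  assumes "finite A" "r < card A"
  shows "\<exists>a\<in>A. card {a'\<in>A. a' < a} = r"
proof -
  let ?f = "\<lambda>a. card {a'\<in>A. a' < a}"
  have lt: "?f a < ?f b" if "a \<in> A" "a < b" for a b
    using that assms(1) by (intro psubset_card_mono) auto
  have "inj_on ?f A"
  proof (rule inj_onI)
    fix a b assume "a \<in> A" "b \<in> A" "?f a = ?f b"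
    then show "a = b" using lt[of a b] lt[of b a] by (cases a b rule: linorder_cases) auto
  qed
  then have "card (?f ` A) = card A" by (rule card_image)
  moreover have "?f ` A \<subseteq> {..<card A}"
    using assms(1) by (auto intro!: psubset_card_mono)
  ultimately have "?f ` A = {..<card A}" by (intro card_subset_eq) auto
  then have "r \<in> ?f ` A" using assms(2) by simp
  then show ?thesis by force
qed

context cube_power
begin

text \<open>On the product of spheres this is a coboundary, but \<open>sgn_bit i k\<close> is not
  invariant, so on the quotient it represents the generator x_i. The class is the same for all k,
  since two such bits differ by an invariant function.\<close>

definition sgn_edge :: "nat \<Rightarrow> nat \<Rightarrow> (nat \<times> nat \<Rightarrow> int) \<Rightarrow> (nat \<times> nat \<Rightarrow> int) \<Rightarrow> bit" where
  "sgn_edge i k u w = sgn_bit i k u + sgn_bit i k w"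

lemma cocycle_coboundary:
  assumes "\<And>\<epsilon> u. \<epsilon> \<in> signs \<Longrightarrow> u \<in> cells \<Longrightarrow> a (flip \<epsilon> u) = a u + h \<epsilon>"
  shows "cocycle (\<lambda>u w. a u + a w)"
  unfolding cocycle_def
proof (intro conjI allI ballI)
  show "(a u + a v) + (a v + a w) = a u + a w" for u v w by (simp add: add.assoc)
  show "a (flip \<epsilon> u) + a (flip \<epsilon> w) = a u + a w" if "\<epsilon> \<in> signs" "u \<in> cells" "w \<in> cells" for \<epsilon> u w
    by (simp add: assms that add.left_commute add.commute)
qed

lemma cocycle_sgn_edge: "i < s \<Longrightarrow> cocycle (sgn_edge i k)"
  unfolding sgn_edge_def by (rule cocycle_coboundary[OF sgn_bit_flip]) auto

lemma cup_add:
  assumes "i < s * m"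
  shows "cup (e(i := \<lambda>u w. f u w + g u w)) = cup (e(i := f)) + cup (e(i := g))"
proof -
  have split: "(\<Prod>j<s*m. (e(i := h)) j (c j) (c (Suc j))) =
      h (c i) (c (Suc i)) * (\<Prod>j\<in>{..<s*m} - {i}. e j (c j) (c (Suc j)))" for h c
    using assms by (subst prod.remove[of _ i]) (auto intro!: prod.cong)
  show ?thesis unfolding cup_def split by (simp add: sum.distrib distrib_right)
qed

lemma cocycle_add_coboundary:
  assumes "cocycle e" "invariant b"
  shows "cocycle (\<lambda>u w. e u w + (b u + b w))"
proof -
  have "e u v + (b u + b v) + (e v w + (b v + b w)) = (e u v + e v w) + (b u + b w)" for u v w
    by (simp add: ac_simps)
  then show ?thesis using assms by (simp add: cocycle_def invariant_def)
qed

text \<open>One factor is changed at a time; by additivity the difference is a cup product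
  containing a coboundary.\<close>

lemma cup_cohomologous:
  assumes e: "\<And>j. j < s * m \<Longrightarrow> cocycle (e j)"
    and b: "\<And>j. j < s * m \<Longrightarrow> invariant (b j)"
    and e': "\<And>j u w. j < s * m \<Longrightarrow> e' j u w = e j u w + (b j u + b j w)"
  shows "cup e' = cup e"
proof -
  define h where "h n j = (if j < n then (\<lambda>u w. e j u w + (b j u + b j w)) else e j)" for n j
  have h0: "h 0 = e" by (auto simp: h_def fun_eq_iff)
  have "cup (h n) = cup e" if "n \<le> s * m" for n
    using that
  proof (induction n)
    case (Suc n)
    have coc: "cocycle (h n j)" if "j < s * m" for j
      using that e b by (simp add: h_def cocycle_add_coboundary)
    have "h (Suc n) = (h n)(n := \<lambda>u w. e n u w + (b n u + b n w))"
      by (auto simp: h_def fun_eq_iff)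
    then have "cup (h (Suc n)) = cup ((h n)(n := e n)) + cup ((h n)(n := \<lambda>u w. b n u + b n w))"
      using cup_add[of n "h n" "e n" "\<lambda>u w. b n u + b n w"] Suc.prems by simp
    also have "cup ((h n)(n := \<lambda>u w. b n u + b n w)) = 0"
      using Suc.prems b coc by (intro cup_coboundary) auto
    also have "(h n)(n := e n) = h n" by (auto simp: h_def fun_eq_iff)
    finally show ?case using Suc by simp
  qed (simp add: h0)
  moreover have "cup e' = cup (h (s * m))"
    unfolding cup_def by (intro sum.cong prod.cong) (auto simp: h_def e')
  ultimately show ?thesis by simp
qed

text \<open>Successive occurrences of x_i use the signs of the coordinates 1, ..., m, 0, 1, ... of
  factor i, which puts the hyperplanes into general position. Coordinate 0 comes into play only at
  occurrence m + 1.\<close>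

definition rank_in_fibre :: "(nat \<Rightarrow> nat) \<Rightarrow> nat \<Rightarrow> nat" where
  "rank_in_fibre \<phi> j = Suc (card {j'. j' < j \<and> \<phi> j' = \<phi> j}) mod Suc m"

lemma rank_in_fibre_hits:
  assumes "k \<le> m" "m \<le> card {j. j < s * m \<and> \<phi> j = i}" "k = 0 \<Longrightarrow> m < card {j. j < s * m \<and> \<phi> j = i}"
  shows "\<exists>j<s*m. \<phi> j = i \<and> rank_in_fibre \<phi> j = k"
proof -
  let ?A = "{j. j < s * m \<and> \<phi> j = i}"
  \<comment> \<open>The rank, counted from zero, of the first occurrence that uses coordinate
    k.\<close>
  define r where "r = (if k = 0 then m else k - 1)"
  have "r < card ?A" using assms by (auto simp: r_def)
  then obtain a where a: "a \<in> ?A" "card {a'\<in>?A. a' < a} = r" using ex_rank[of ?A r] by auto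
  have "{j'. j' < a \<and> \<phi> j' = \<phi> a} = {a'\<in>?A. a' < a}" using a(1) by auto
  then have "rank_in_fibre \<phi> a = Suc r mod Suc m" using a(2) by (simp add: rank_in_fibre_def)
  then have "rank_in_fibre \<phi> a = k" using assms(1) by (auto simp: r_def)
  then show ?thesis using a(1) by blast
qed

text \<open>An extreme coordinate of the top cell is even, hence has not moved along the flag, and
  its sign is constant.\<close>

lemma flag_extreme_coord:
  assumes "c \<in> flags" "i < s"
  shows "\<exists>k\<le>m. (\<forall>j\<le>s*m. c j (i, k) = c (s * m) (i, k)) \<and> \<bar>c (s * m) (i, k)\<bar> = M \<and>
    (\<forall>j<s*m. sgn_edge i k (c j) (c (Suc j)) = 0)"
proof -
  have top: "c (s * m) \<in> cells" using assms(1) by (rule flag_cell) simp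
  obtain k where k: "k \<le> m" "(i, k) \<in> coords" "\<bar>c (s * m) (i, k)\<bar> = M" "even (c (s * m) (i, k))"
    by (rule cell_extreme[OF top assms(2)])
  have const: "c j (i, k) = c (s * m) (i, k)" if "j \<le> s * m" for j
    by (rule flag_even_const[OF assms(1) order_refl k(4) that])
  have zero: "sgn_edge i k (c j) (c (Suc j)) = 0" if "j < s * m" for j
    using k(3) M_pos const[of j] const[of "Suc j"] that by (auto simp: sgn_edge_def sgn_bit_def)
  show ?thesis by (intro exI[of _ k] conjI allI impI k(1,3); erule const zero)
qed

text \<open>This is the relation x_i^(m+1) = 0: all m + 1 coordinates of factor i would have to
  change sign somewhere, but the extreme one never does.\<close>

lemma cup_sgn_edge_eq_0:
  assumes "\<And>j. j < s * m \<Longrightarrow> \<phi> j < s" "i < s" "m < card {j. j < s * m \<and> \<phi> j = i}"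
  shows "cup (\<lambda>j. sgn_edge (\<phi> j) (rank_in_fibre \<phi> j)) = 0"
  unfolding cup_def
proof (rule sum.neutral, rule ballI)
  fix c assume "c \<in> based"
  then have c: "c \<in> flags" by (simp add: based_def)
  obtain k where k: "k \<le> m" "\<forall>j\<le>s*m. c j (i, k) = c (s * m) (i, k)"
    "\<bar>c (s * m) (i, k)\<bar> = M" "\<forall>j<s*m. sgn_edge i k (c j) (c (Suc j)) = 0"
    using flag_extreme_coord[OF c assms(2)] by blast
  have "\<exists>j<s*m. \<phi> j = i \<and> rank_in_fibre \<phi> j = k"
    by (rule rank_in_fibre_hits[OF k(1)]) (use assms(3) in simp_all)
  then obtain j where j: "j < s * m" "\<phi> j = i" "rank_in_fibre \<phi> j = k" by blast
  then have "sgn_edge (\<phi> j) (rank_in_fibre \<phi> j) (c j) (c (Suc j)) = 0" using k(4) by simp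
  then show "(\<Prod>j<s*m. sgn_edge (\<phi> j) (rank_in_fibre \<phi> j) (c j) (c (Suc j))) = 0"
    using j(1) by (intro prod_zero bexI[of _ j]) simp_all
qed

text \<open>The top monomial is nonzero because exactly one based flag contributes: its coordinates
  (i, 0) stay at M and the others drop from 0 to -1, in the order prescribed by
  \<open>pos\<close>.\<close>

lemma cup_sgn_edge_eq_1:
  assumes \<phi>: "\<And>j. j < s * m \<Longrightarrow> \<phi> j < s"
    and fib: "\<And>i. i < s \<Longrightarrow> card {j. j < s * m \<and> \<phi> j = i} = m"
  shows "cup (\<lambda>j. sgn_edge (\<phi> j) (rank_in_fibre \<phi> j)) = 1"
proof -
  define pos where "pos j = (\<phi> j, rank_in_fibre \<phi> j)" for j
  have rank: "0 < rank_in_fibre \<phi> j" "rank_in_fibre \<phi> j \<le> m" if "j < s * m" for j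
  proof -
    let ?A = "{j'. j' < s * m \<and> \<phi> j' = \<phi> j}"
    have "{j'. j' < j \<and> \<phi> j' = \<phi> j} \<subseteq> ?A - {j}"
      using that by (intro subsetI) simp
    then have "card {j'. j' < j \<and> \<phi> j' = \<phi> j} \<le> card (?A - {j})"
      by (intro card_mono) simp_all
    also have "\<dots> < card ?A" by (rule card_Diff1_less) (simp_all add: that)
    finally have "card {j'. j' < j \<and> \<phi> j' = \<phi> j} < card ?A" .
    then have *: "card {j'. j' < j \<and> \<phi> j' = \<phi> j} < m"
      unfolding fib[OF \<phi>[OF that]] .
    then have "Suc (card {j'. j' < j \<and> \<phi> j' = \<phi> j}) mod Suc m = Suc (card {j'. j' < j \<and> \<phi> j' = \<phi> j})"
      by (intro mod_less) (rule Suc_mono)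
    with * show "0 < rank_in_fibre \<phi> j" "rank_in_fibre \<phi> j \<le> m"
      unfolding rank_in_fibre_def by (simp_all only: zero_less_Suc Suc_le_eq)
  qed
  have img: "pos ` {..<s*m} = {..<s} \<times> {1..m}"
  proof
    show "pos ` {..<s*m} \<subseteq> {..<s} \<times> {1..m}"
    proof
      fix p assume "p \<in> pos ` {..<s*m}"
      then obtain j where "j < s * m" "p = pos j" by blast
      then show "p \<in> {..<s} \<times> {1..m}" using \<phi>[of j] rank[of j] by (simp add: pos_def)
    qed
    show "{..<s} \<times> {1..m} \<subseteq> pos ` {..<s*m}"
    proof
      fix p assume p: "p \<in> {..<s} \<times> {1..m}"
      have "\<exists>j<s*m. \<phi> j = fst p \<and> rank_in_fibre \<phi> j = snd p"
        by (rule rank_in_fibre_hits) (use p fib[of "fst p"] in \<open>simp_all add: mem_Times_iff\<close>)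
      then obtain j where "j < s * m" "\<phi> j = fst p" "rank_in_fibre \<phi> j = snd p" by blast
      then have "j \<in> {..<s*m}" "p = pos j" by (simp_all add: pos_def prod_eq_iff)
      then show "p \<in> pos ` {..<s*m}" by blast
    qed
  qed
  have inj: "inj_on pos {..<s*m}"
    by (rule eq_card_imp_inj_on) (simp_all add: img card_cartesian_product)
  have pos_ne: "pos j' \<noteq> pos j" if "j' < j" "j < s * m" for j j'
    using inj_onD[OF inj, of j' j] that by auto
  have pos_coords: "pos j \<in> coords" "snd (pos j) \<noteq> 0" if "j < s * m" for j
    using \<phi>[OF that] rank[OF that] by (auto simp: pos_def coords_def)
  define C :: "nat \<Rightarrow> nat \<times> nat \<Rightarrow> int" where
    "C j p = (if s * m < j then 0 else if snd p = 0 \<and> fst p < s then M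
              else if \<exists>j'<j. pos j' = p then -1 else 0)" for j p
  have CSuc: "C (Suc j) = (C j)(pos j := -1)" if "j < s * m" for j
    using that pos_coords[OF that] by (auto simp: C_def fun_eq_iff less_Suc_eq)
  have C_pos: "C j (pos j) = 0" if "j < s * m" for j
    using that pos_coords(2)[OF that] pos_ne[OF _ that] by (auto simp: C_def)
  \<comment> \<open>The positive leading coordinate breaks ties, so a coordinate 0 counts as
    positive.\<close>
  have lead: "sgn_bit i k v = of_bool (v (i, k) < 0)" if "v (i, 0) = M" for i k v
  proof -
    have "(LEAST k. v (i, k) \<noteq> 0) = 0" using that M_pos by (intro Least_eq_0) simp
    then show ?thesis using that M_pos by (simp add: sgn_bit_def leading_def)
  qed
  have C0: "C j (i, 0) = M" if "j \<le> s * m" "i < s" for i j using that by (simp add: C_def)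
  have "C \<in> flags"
  proof -
    have "C j \<in> cells" if j: "j \<le> s * m" for j
    proof -
      have "C j p = 0" if p: "p \<notin> coords" for p
      proof -
        have "pos j' \<noteq> p" if "j' < j" for j' using p pos_coords(1)[of j'] j that by auto
        moreover have "\<not> (snd p = 0 \<and> fst p < s)" using p by (cases p) (auto simp: coords_def)
        ultimately show ?thesis by (auto simp: C_def)
      qed
      moreover have "\<bar>C j p\<bar> \<le> M" if "p \<in> coords" for p
        using M_pos by (auto simp: C_def)
      moreover have "\<exists>k\<le>m. \<bar>C j (i, k)\<bar> = M" if "i < s" for i
        using C0[OF j that] M_pos by (intro exI[of _ 0]) simp
      ultimately show ?thesis unfolding cells_def by blast
    qed
    moreover have "C j = (\<lambda>_. 0)" if "s * m < j" for j using that by (auto simp: C_def)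
    moreover have "even (C 0 p)" for p using M_even by (simp add: C_def)
    moreover have "step (C j) (C (Suc j))" if "j < s * m" for j
      by (rule stepI[of "pos j" "-1"]) (use that CSuc C_pos pos_coords in auto)
    ultimately show ?thesis unfolding flags_def by blast
  qed
  then have C_based: "C \<in> based" using lead[of "C 0"] C0[of 0] M_pos by (simp add: based_def)
  let ?w = "\<lambda>c. \<Prod>j<s*m. sgn_edge (\<phi> j) (rank_in_fibre \<phi> j) (c j) (c (Suc j))"
  have wC: "?w C = 1"
  proof (rule prod.neutral, rule ballI)
    fix j assume "j \<in> {..<s*m}"
    then have j: "j < s * m" by simp
    have "sgn_edge (\<phi> j) (rank_in_fibre \<phi> j) (C j) (C (Suc j)) =
        of_bool (C j (pos j) < 0) + of_bool (C (Suc j) (pos j) < 0)"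
      using j \<phi>[OF j] by (simp add: sgn_edge_def lead C0 pos_def)
    then show "sgn_edge (\<phi> j) (rank_in_fibre \<phi> j) (C j) (C (Suc j)) = 1"
      using C_pos[OF j] CSuc[OF j] by simp
  qed
  have uniq: "c = C" if cb: "c \<in> based" and w: "?w c \<noteq> 0" for c
  proof -
    have c: "c \<in> flags" using cb by (simp add: based_def)
    have w1: "sgn_edge (\<phi> j) (rank_in_fibre \<phi> j) (c j) (c (Suc j)) = 1" if "j < s * m" for j
    proof (rule ccontr)
      assume "sgn_edge (\<phi> j) (rank_in_fibre \<phi> j) (c j) (c (Suc j)) \<noteq> 1"
      then have "?w c = 0" using that by (intro prod_zero bexI[of _ j]) simp_all
      then show False using w by simp
    qed
    have c0: "c j (i, 0) = M" if i: "i < s" and j: "j \<le> s * m" for i j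
    proof -
      obtain k where k: "k \<le> m" "\<forall>j\<le>s*m. c j (i, k) = c (s * m) (i, k)"
        "\<bar>c (s * m) (i, k)\<bar> = M" "\<forall>j<s*m. sgn_edge i k (c j) (c (Suc j)) = 0"
        using flag_extreme_coord[OF c i] by blast
      \<comment> \<open>The coordinates 1 to m each change sign at some step, so only coordinate 0
        can be the constant extreme one; being based makes it positive.\<close>
      have "k = 0"
      proof (rule ccontr)
        assume "k \<noteq> 0"
        then have "\<exists>j<s*m. \<phi> j = i \<and> rank_in_fibre \<phi> j = k"
          by (intro rank_in_fibre_hits k(1)) (simp_all add: fib[OF i])
        then obtain j where "j < s * m" "\<phi> j = i" "rank_in_fibre \<phi> j = k" by blast
        then show False using w1[of j] k(4) by simp
      qed
      moreover have "sgn_bit i 0 (c 0) = 0" using cb i by (simp add: based_def)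
      ultimately have "c 0 (i, 0) = M"
        using k(2)[rule_format, of 0] k(3) M_pos by (auto simp: sgn_bit_def split: if_splits)
      then show ?thesis using k(2)[rule_format, of 0] k(2)[rule_format, OF j] \<open>k = 0\<close> by simp
    qed
    have cstep: "c j (pos j) = 0 \<and> c (Suc j) = (c j)(pos j := -1)" if j: "j < s * m" for j
    proof -
      have "of_bool (c j (pos j) < 0) + of_bool (c (Suc j) (pos j) < 0) = (1::bit)"
        using w1[OF j] j \<phi>[OF j] by (simp add: sgn_edge_def lead c0 pos_def)
      then have sg: "c j (pos j) < 0 \<longleftrightarrow> \<not> c (Suc j) (pos j) < 0" by (auto split: if_splits)
      have "step (c j) (c (Suc j))" using c j by (simp add: flags_def)
      then obtain p d where p: "d \<in> {1, -1}" "even (c j p)" "c (Suc j) = (c j)(p := c j p + d)"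
        by (elim stepE)
      have "p = pos j" using sg p(3) by (auto split: if_splits)
      then have "c j (pos j) < 0 \<longleftrightarrow> \<not> c j (pos j) + d < 0" "even (c j (pos j))" using sg p by auto
      \<comment> \<open>An even integer moving by one and changing between negative and nonnegative,
        in either direction, can only go from 0 to -1.\<close>
      then have "c j (pos j) = 0 \<and> d = -1"
        using p(1) by (auto; presburger)
      then show ?thesis using p(3) \<open>p = pos j\<close> by simp
    qed
    have "c 0 p = C 0 p" for p
    proof (cases "p \<in> coords")
      case True
      show ?thesis
      proof (cases "snd p = 0")
        case True
        with \<open>p \<in> coords\<close> show ?thesis using c0[of "fst p" 0] C0[of 0 "fst p"]
          by (cases p) (auto simp: coords_def)
      next
        case False
        then have "p \<in> pos ` {..<s*m}" using True by (auto simp: img coords_def)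
        then obtain j where j: "j < s * m" "p = pos j" by auto
        have "c 0 p = c j p"
          using flag_even_const[OF c, of j p 0] j cstep by simp
        then show ?thesis using cstep j False by (simp add: C_def)
      qed
    next
      case False
      then have "c 0 p = 0" "C 0 p = 0"
        using flag_cell[OF c, of 0] flag_cell[OF \<open>C \<in> flags\<close>, of 0] by (auto simp: cells_def)
      then show ?thesis by simp
    qed
    then have "c j = C j" if "j \<le> s * m" for j
      using that by (induction j) (auto simp: CSuc cstep)
    moreover have "c j = C j" if "s * m < j" for j
      using c that by (auto simp: flags_def C_def)
    ultimately show "c = C" by (meson ext not_le)
  qed
  have "sum ?w based = sum ?w {C}"
  proof (intro sum.mono_neutral_right finite_based ballI)
    show "?w c = 0" if "c \<in> based - {C}" for c using uniq[of c] that by blast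
  qed (simp add: C_based)
  then show ?thesis unfolding cup_def using wC by (simp only: sum.insert_if sum.empty finite.emptyI) simp
qed

text \<open>The fibres of \<phi> have total size sm, so unless all have size m one of them is larger
  and its power of x_i vanishes.\<close>

lemma cup_sgn_edge:
  assumes \<phi>: "\<And>j. j < s * m \<Longrightarrow> \<phi> j < s"
  shows "cup (\<lambda>j. sgn_edge (\<phi> j) 0) = of_bool (\<forall>i<s. card {j. j < s * m \<and> \<phi> j = i} = m)"
proof -
  have "cup (\<lambda>j. sgn_edge (\<phi> j) 0) = cup (\<lambda>j. sgn_edge (\<phi> j) (rank_in_fibre \<phi> j))"
  proof (rule cup_cohomologous)
    let ?b = "\<lambda>j u. sgn_bit (\<phi> j) 0 u + sgn_bit (\<phi> j) (rank_in_fibre \<phi> j) u"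
    show "sgn_edge (\<phi> j) 0 u w = sgn_edge (\<phi> j) (rank_in_fibre \<phi> j) u w + (?b j u + ?b j w)" for j u w
      by (simp add: sgn_edge_def ac_simps)
    show "invariant (?b j)" if "j < s * m" for j
      using \<phi>[OF that] by (simp add: invariant_def sgn_bit_flip ac_simps)
  qed (simp add: cocycle_sgn_edge \<phi>)
  also have "\<dots> = of_bool (\<forall>i<s. card {j. j < s * m \<and> \<phi> j = i} = m)"
  proof (cases "\<exists>i<s. m < card {j. j < s * m \<and> \<phi> j = i}")
    case True
    then show ?thesis using cup_sgn_edge_eq_0[OF \<phi>] by auto
  next
    case False
    have "{..<s*m} = (\<Union>i<s. {j. j < s * m \<and> \<phi> j = i})" using \<phi> by auto
    then have "card {..<s*m} = (\<Sum>i<s. card {j. j < s * m \<and> \<phi> j = i})"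
      by (simp only:, subst card_UN_disjoint) auto
    then have eq: "(\<Sum>i<s. card {j. j < s * m \<and> \<phi> j = i}) = (\<Sum>i<s. m)" by simp
    have le: "card {j. j < s * m \<and> \<phi> j = i} \<le> m" if "i < s" for i
      using False that by (meson not_le)
    have "card {j. j < s * m \<and> \<phi> j = i} = m" if "i < s" for i
      by (rule sum_mono_inv[OF eq]) (use le that in auto)
    then show ?thesis using cup_sgn_edge_eq_1[OF \<phi>] by simp
  qed
  finally show ?thesis .
qed

text \<open>A combinatorial statement of Borsuk-Ulam type for arbitrary labels. Label j represents
  the sum of the x_i over \<open>S j\<close>. Expanding the product over all choices \<phi>, a
  monomial contributes 1 exactly if all its exponents are m; as the number of these is odd, some
  flag has a nonzero integrand.\<close>

theorem ex_alternating_flag: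
  assumes S: "\<And>j. j < s * m \<Longrightarrow> S j \<subseteq> {..<s}"
    and a: "\<And>j \<epsilon> v. j < s * m \<Longrightarrow> \<epsilon> \<in> signs \<Longrightarrow> v \<in> cells \<Longrightarrow>
              a j (flip \<epsilon> v) = a j v + (\<Sum>i\<in>S j. of_bool (\<epsilon> i = -1))"
    and odd: "odd (card {\<phi> \<in> PiE {..<s*m} S. \<forall>i<s. card {j. j < s * m \<and> \<phi> j = i} = m})"
  obtains c where "c \<in> flags" "\<And>j. j < s * m \<Longrightarrow> a j (c j) \<noteq> (a j (c (Suc j)) :: bit)"
proof -
  let ?\<Phi> = "PiE {..<s*m} S"
  have fin: "finite ?\<Phi>" using S by (intro finite_PiE) (auto intro: finite_subset)
  have "cup (\<lambda>j u w. a j u + a j w) = cup (\<lambda>j u w. \<Sum>i\<in>S j. sgn_edge i 0 u w)"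
  proof (rule cup_cohomologous)
    let ?b = "\<lambda>j u. a j u + (\<Sum>i\<in>S j. sgn_bit i 0 u)"
    show "a j u + a j w = (\<Sum>i\<in>S j. sgn_edge i 0 u w) + (?b j u + ?b j w)" for j u w
      by (simp add: sgn_edge_def sum.distrib ac_simps)
    show coc: "cocycle (\<lambda>u w. \<Sum>i\<in>S j. sgn_edge i 0 u w)" if "j < s * m" for j
      using S[OF that] cocycle_sgn_edge unfolding cocycle_def
      by (auto simp flip: sum.distrib intro!: sum.cong)
    show "invariant (?b j)" if "j < s * m" for j
      unfolding invariant_def
    proof (intro ballI)
      fix \<epsilon> u assume *: "\<epsilon> \<in> signs" "u \<in> cells"
      have "(\<Sum>i\<in>S j. sgn_bit i 0 (flip \<epsilon> u)) = (\<Sum>i\<in>S j. sgn_bit i 0 u + of_bool (\<epsilon> i = -1))"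
        using S[OF that] * by (intro sum.cong) (auto simp: sgn_bit_flip)
      then show "?b j (flip \<epsilon> u) = ?b j u" using a[OF that *] by (simp add: sum.distrib ac_simps)
    qed
  qed
  also have "\<dots> = (\<Sum>c\<in>based. \<Sum>\<phi>\<in>?\<Phi>. \<Prod>j<s*m. sgn_edge (\<phi> j) 0 (c j) (c (Suc j)))"
    unfolding cup_def using S by (intro sum.cong refl prod_sum_PiE) (auto intro: finite_subset)
  also have "\<dots> = (\<Sum>\<phi>\<in>?\<Phi>. cup (\<lambda>j. sgn_edge (\<phi> j) 0))"
    unfolding cup_def by (rule sum.swap)
  also have "\<dots> = (\<Sum>\<phi>\<in>?\<Phi>. of_bool (\<forall>i<s. card {j. j < s * m \<and> \<phi> j = i} = m))"
    using S by (intro sum.cong refl cup_sgn_edge) (auto simp: PiE_def Pi_def)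
  also have "\<dots> = of_nat (card {\<phi> \<in> ?\<Phi>. \<forall>i<s. card {j. j < s * m \<and> \<phi> j = i} = m})"
    using fin by (simp add: sum.If_cases of_bool_def Int_def)
  also have "\<dots> = 1" using odd by (elim oddE) simp
  finally have "\<exists>c\<in>based. (\<Prod>j<s*m. a j (c j) + a j (c (Suc j))) \<noteq> 0"
    unfolding cup_def by (metis (no_types, lifting) sum.neutral zero_neq_one)
  then obtain c where c: "c \<in> based" "(\<Prod>j<s*m. a j (c j) + a j (c (Suc j))) \<noteq> 0" by blast
  have "a j (c j) \<noteq> a j (c (Suc j))" if "j < s * m" for j
  proof
    assume "a j (c j) = a j (c (Suc j))"
    then have "(\<Prod>j<s*m. a j (c j) + a j (c (Suc j))) = 0"
      using that by (intro prod_zero bexI[of _ j]) simp_all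
    then show False using c(2) by simp
  qed
  then show thesis using c(1) that by (auto simp: based_def)
qed

end

section \<open>Projective classes\<close>

definition rp_class :: "nat \<Rightarrow> (nat \<Rightarrow> real) \<Rightarrow> (nat \<Rightarrow> real) set" where
  "rp_class m v = (\<lambda>x. {x, (\<lambda>i. - x i)}) (\<lambda>i. v i / sqrt (\<Sum>k\<le>m. (v k)\<^sup>2))"

lemma sum_squares_pos:
  fixes v :: "nat \<Rightarrow> real"
  assumes "k \<le> m" "v k \<noteq> 0"
  shows "0 < (\<Sum>k\<le>m. (v k)\<^sup>2)"
  using assms by (intro sum_pos2[of _ k]) auto

lemma topspace_nsphere: "topspace (nsphere m) = {x. (\<Sum>i\<le>m. (x i)\<^sup>2) = 1 \<and> (\<forall>i>m. x i = 0)}"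
  by (simp add: nsphere)

lemma quotient_map_real_projective_space:
  "quotient_map (nsphere m) (real_projective_space m) (\<lambda>x. {x, (\<lambda>i. - x i)})"
  unfolding real_projective_space_def by (rule quotient_map_quotient_topology)

lemma topspace_real_projective_space:
  "topspace (real_projective_space m) = (\<lambda>x. {x, (\<lambda>i. - x i)}) ` topspace (nsphere m)"
  unfolding real_projective_space_def by (rule topspace_quotient_topology)

lemma continuous_map_rp_class:
  assumes zero: "\<And>z i. z \<in> topspace Z \<Longrightarrow> m < i \<Longrightarrow> f z i = 0"
    and nz: "\<And>z. z \<in> topspace Z \<Longrightarrow> \<exists>k\<le>m. f z k \<noteq> 0"
    and cont: "\<And>k. k \<le> m \<Longrightarrow> continuous_map Z euclideanreal (\<lambda>z. f z k)"
  shows "continuous_map Z (real_projective_space m) (\<lambda>z. rp_class m (f z))"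
proof -
  let ?n = "\<lambda>z. sqrt (\<Sum>k\<le>m. (f z k)\<^sup>2)"
  have pos: "0 < (\<Sum>k\<le>m. (f z k)\<^sup>2)" if "z \<in> topspace Z" for z
    using nz[OF that] sum_squares_pos by blast
  have n: "continuous_map Z euclideanreal ?n"
    by (intro continuous_intros cont) auto
  have "continuous_map Z (nsphere m) (\<lambda>z i. f z i / ?n z)"
    unfolding nsphere continuous_map_in_subtopology continuous_map_componentwise_UNIV
  proof (intro conjI allI)
    fix i
    show "continuous_map Z euclideanreal (\<lambda>z. f z i / ?n z)"
    proof (cases "i \<le> m")
      case True
      show ?thesis
      proof (rule continuous_map_real_divide[OF cont[OF True] n])
        show "?n z \<noteq> 0" if "z \<in> topspace Z" for z using pos[OF that] by simp
      qed
    next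
      case False
      show ?thesis
        by (rule continuous_map_eq[of _ _ "\<lambda>_. 0"]) (use False zero in auto)
    qed
  next
    show "(\<lambda>z i. f z i / ?n z) \<in> topspace Z \<rightarrow> {x. (\<Sum>i\<le>m. (x i)\<^sup>2) = 1 \<and> (\<forall>i>m. x i = 0)}"
    proof
      fix z assume z: "z \<in> topspace Z"
      have "(\<Sum>i\<le>m. (f z i / ?n z)\<^sup>2) = (\<Sum>i\<le>m. (f z i)\<^sup>2) / (?n z)\<^sup>2"
        by (simp add: power_divide sum_divide_distrib)
      also have "\<dots> = 1" using pos[OF z] by simp
      finally show "(\<lambda>i. f z i / ?n z) \<in> {x. (\<Sum>i\<le>m. (x i)\<^sup>2) = 1 \<and> (\<forall>i>m. x i = 0)}"
        using zero[OF z] by simp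
    qed
  qed
  then have "continuous_map Z (real_projective_space m)
      ((\<lambda>x. {x, (\<lambda>i. - x i)}) \<circ> (\<lambda>z i. f z i / ?n z))"
    by (rule continuous_map_compose) (rule quotient_imp_continuous_map[OF quotient_map_real_projective_space])
  then show ?thesis by (simp add: o_def rp_class_def)
qed

lemma rp_class_scale:
  assumes "c \<noteq> 0"
  shows "rp_class m (\<lambda>i. c * v i) = rp_class m v"
proof -
  let ?n = "sqrt (\<Sum>k\<le>m. (v k)\<^sup>2)"
  have "(\<Sum>k\<le>m. (c * v k)\<^sup>2) = c\<^sup>2 * (\<Sum>k\<le>m. (v k)\<^sup>2)"
    by (simp add: power_mult_distrib sum_distrib_left)
  then have n: "sqrt (\<Sum>k\<le>m. (c * v k)\<^sup>2) = \<bar>c\<bar> * ?n"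
    by (simp add: real_sqrt_mult)
  show ?thesis
  proof (cases "c > 0")
    case True
    then show ?thesis using n by (simp add: rp_class_def)
  next
    case False
    then have "c * v i / (\<bar>c\<bar> * ?n) = - (v i / ?n)" for i
      using assms by (simp add: field_simps)
    then show ?thesis unfolding rp_class_def n by (simp add: insert_commute)
  qed
qed

lemma rp_class_sphere:
  assumes "x \<in> topspace (nsphere m)"
  shows "rp_class m x = {x, (\<lambda>i. - x i)}"
  using assms by (simp add: rp_class_def topspace_nsphere)

text \<open>The entries of the orthogonal projection onto a line, which do not depend on the chosen
  unit vector of the line.\<close>

definition rp_entry :: "(nat \<Rightarrow> real) set \<Rightarrow> nat \<Rightarrow> nat \<Rightarrow> real" where
  "rp_entry A k l = (SOME x. x \<in> A) k * (SOME x. x \<in> A) l"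

lemma rp_entry_eq: "rp_entry {x, (\<lambda>i. - x i)} k l = x k * x l"
proof -
  have "(SOME y. y \<in> {x, (\<lambda>i. - x i)}) \<in> {x, (\<lambda>i. - x i)}"
    by (rule someI[of _ x]) simp
  then show ?thesis unfolding rp_entry_def by auto
qed

lemma continuous_map_rp_entry:
  "continuous_map (real_projective_space m) euclideanreal (\<lambda>A. rp_entry A k l)"
proof (rule continuous_compose_quotient_map[OF quotient_map_real_projective_space])
  show "continuous_map (nsphere m) euclideanreal ((\<lambda>A. rp_entry A k l) \<circ> (\<lambda>x. {x, (\<lambda>i. - x i)}))"
    unfolding o_def rp_entry_eq by (intro continuous_intros continuous_map_nsphere_projection)
qed

lemma rp_pointE:
  assumes "A \<in> topspace (real_projective_space m)"
  obtains x where "x \<in> topspace (nsphere m)" "A = {x, (\<lambda>i. - x i)}" "\<And>k l. rp_entry A k l = x k * x l"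
  using assms rp_entry_eq unfolding topspace_real_projective_space by blast

text \<open>A column of the projection matrix is a multiple of the unit vector. Unlike the latter,
  it depends continuously on the line, and it represents the line wherever it does not
  vanish.\<close>

lemma rp_class_column:
  assumes "A \<in> topspace (real_projective_space m)" "rp_entry A i i \<noteq> 0"
  shows "rp_class m (\<lambda>k. rp_entry A k i) = A"
proof -
  obtain x where x: "x \<in> topspace (nsphere m)" "A = {x, (\<lambda>i. - x i)}" "\<And>k l. rp_entry A k l = x k * x l"
    using assms(1) by (rule rp_pointE) blast
  then have "(\<lambda>k. rp_entry A k i) = (\<lambda>k. x i * x k)" "x i \<noteq> 0" using assms(2) by auto
  then show ?thesis using rp_class_scale[of "x i" m x] rp_class_sphere[OF x(1)] x(2) by simp
qed

lemma rp_entry_nonneg: "A \<in> topspace (real_projective_space m) \<Longrightarrow> 0 \<le> rp_entry A i i"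
  by (elim rp_pointE) simp

section \<open>Maps into the mapping space of the wedge\<close>

lemma continuous_map_sum_topology:
  assumes "\<And>i. i \<in> I \<Longrightarrow> continuous_map (X i) Y (\<lambda>x. f (i, x))"
  shows "continuous_map (sum_topology X I) Y f"
  unfolding continuous_map_def
proof (intro conjI allI impI)
  show "f \<in> topspace (sum_topology X I) \<rightarrow> topspace Y"
    using assms by (force simp: continuous_map_def Pi_iff)
  fix U assume U: "openin Y U"
  show "openin (sum_topology X I) {x \<in> topspace (sum_topology X I). f x \<in> U}"
    unfolding openin_sum_topology
  proof (intro conjI ballI)
    fix i assume i: "i \<in> I"
    then have "{x. (i, x) \<in> {x \<in> topspace (sum_topology X I). f x \<in> U}} = {x \<in> topspace (X i). f (i, x) \<in> U}"
      by auto
    then show "openin (X i) {x. (i, x) \<in> {x \<in> topspace (sum_topology X I). f x \<in> U}}"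
      using openin_continuous_map_preimage[OF assms[OF i] U] by simp
  qed auto
qed

lemma quotient_map_interval_wedge:
  "quotient_map (sum_topology (\<lambda>_. top_of_set {0..1}) {..<s}) (interval_wedge s) wedge_proj"
  unfolding interval_wedge_def by (rule quotient_map_quotient_topology)

lemma topspace_interval_wedge: "topspace (interval_wedge s) = wedge_proj ` ({..<s} \<times> {0..1})"
  unfolding interval_wedge_def topspace_quotient_topology by (auto simp: o_def)

lemma continuous_map_wedge_arc:
  assumes "i < s"
  shows "continuous_map (top_of_set {0..1}) (interval_wedge s) (\<lambda>t. wedge_proj (i, t))"
proof -
  have "continuous_map (top_of_set {0..1}) (interval_wedge s) (wedge_proj \<circ> (\<lambda>t. (i, t)))"
    using assms by (intro continuous_map_compose[OF continuous_map_component_injection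
          quotient_imp_continuous_map[OF quotient_map_interval_wedge]]) simp
  then show ?thesis by (simp add: o_def)
qed

lemma continuous_map_from_wedge:
  assumes "\<And>i. i < s \<Longrightarrow> continuous_map (top_of_set {0..1}) Y (\<lambda>t. h (wedge_proj (i, t)))"
  shows "continuous_map (interval_wedge s) Y h"
  by (rule continuous_compose_quotient_map[OF quotient_map_interval_wedge])
    (auto intro!: continuous_map_sum_topology assms simp: o_def)

text \<open>The part of K on arc i is cut out by a closed condition, hence compact, and the
  parameter of the arc extends to a continuous function on the whole wedge.\<close>

lemma compactin_wedge_arc:
  assumes K: "compactin (interval_wedge s) K" and i: "i < s"
  shows "compactin (top_of_set {0..1}) {t\<in>{0..1}. wedge_proj (i, t) \<in> K}"
proof -
  let ?arc = "\<lambda>p. if fst p = i then snd p else 0" and ?off = "\<lambda>p. if fst p = i then 0 else snd p"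
  have cont: "continuous_map (interval_wedge s) (top_of_set {0..1}) ?arc"
    "continuous_map (interval_wedge s) (top_of_set {0..1}) ?off"
  proof -
    have 1: "(\<lambda>t. ?arc (wedge_proj (j, t))) = (if j = i then (\<lambda>t. t) else (\<lambda>t. 0))"
      and 2: "(\<lambda>t. ?off (wedge_proj (j, t))) = (if j = i then (\<lambda>t. 0) else (\<lambda>t. t))" for j
      by (auto simp: wedge_proj_def)
    show "continuous_map (interval_wedge s) (top_of_set {0..1}) ?arc"
      by (rule continuous_map_from_wedge) (auto simp: 1)
    show "continuous_map (interval_wedge s) (top_of_set {0..1}) ?off"
      by (rule continuous_map_from_wedge) (auto simp: 2)
  qed
  let ?C = "{p \<in> topspace (interval_wedge s). ?off p \<in> {0}}"
  have "closedin (interval_wedge s) ?C"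
    by (rule closedin_continuous_map_preimage[OF cont(2)]) (auto simp: closedin_closed_subtopology)
  then have "compactin (top_of_set {0..1}) (?arc ` (K \<inter> ?C))"
    by (intro image_compactin[OF _ cont(1)] compact_Int_closedin K)
  moreover have "?arc ` (K \<inter> ?C) = {t\<in>{0..1}. wedge_proj (i, t) \<in> K}"
  proof (intro equalityI subsetI)
    fix t assume "t \<in> ?arc ` (K \<inter> ?C)"
    then obtain j u where p: "j < s" "u \<in> {0..1}" "wedge_proj (j, u) \<in> K"
      "?off (wedge_proj (j, u)) = 0" "t = ?arc (wedge_proj (j, u))"
      by (auto simp: topspace_interval_wedge)
    then show "t \<in> {t\<in>{0..1}. wedge_proj (i, t) \<in> K}"
      by (auto simp: wedge_proj_def split: if_splits)
  next
    fix t assume t: "t \<in> {t\<in>{0..1}. wedge_proj (i, t) \<in> K}"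
    have "wedge_proj (i, t) \<in> ?C"
      using t i by (auto simp: topspace_interval_wedge) (auto simp: wedge_proj_def split: if_splits)
    moreover have "t = ?arc (wedge_proj (i, t))" by (auto simp: wedge_proj_def)
    ultimately show "t \<in> ?arc ` (K \<inter> ?C)" using t by blast
  qed
  ultimately show ?thesis by simp
qed

text \<open>Currying: a compact subset of the wedge is a finite union of images of compact sets of
  parameters, and the tube lemma applies to each of them.\<close>

lemma continuous_map_into_mapping_space_wedge:
  assumes s: "0 < s"
    and H: "\<And>i. i < s \<Longrightarrow> continuous_map (prod_topology Z (top_of_set {0..1})) Y (\<lambda>(z, t). H i z t)"
    and base: "\<And>i j z. z \<in> topspace Z \<Longrightarrow> i < s \<Longrightarrow> j < s \<Longrightarrow> H i z 0 = H j z 0"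
  obtains \<sigma> where "continuous_map Z (mapping_space (interval_wedge s) Y) \<sigma>"
    "\<And>i z t. z \<in> topspace Z \<Longrightarrow> i < s \<Longrightarrow> t \<in> {0..1} \<Longrightarrow> \<sigma> z (wedge_proj (i, t)) = H i z t"
proof -
  let ?J = "interval_wedge s"
  define \<sigma> where "\<sigma> z = (\<lambda>p\<in>topspace ?J. H (fst p) z (snd p))" for z
  have \<sigma>: "\<sigma> z (wedge_proj (i, t)) = H i z t" if "z \<in> topspace Z" "i < s" "t \<in> {0..1}" for i z t
  proof -
    have "wedge_proj (i, t) \<in> topspace ?J" using that by (auto simp: topspace_interval_wedge)
    \<comment> \<open>At t = 0 the index is lost, since \<open>wedge_proj\<close> yields (0, 0);
      \<open>base\<close> identifies \<open>H 0 z 0\<close> with \<open>H i z 0\<close>.\<close>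
    then show ?thesis using base[of z 0 i] that s by (auto simp: \<sigma>_def wedge_proj_def)
  qed
  have cont: "continuous_map ?J Y (\<sigma> z)" if z: "z \<in> topspace Z" for z
  proof (rule continuous_map_from_wedge)
    fix i assume i: "i < s"
    have "continuous_map (top_of_set {0..1}) Y ((\<lambda>(z, t). H i z t) \<circ> (\<lambda>t. (z, t)))"
      by (rule continuous_map_compose[OF _ H[OF i]]) (use z in \<open>auto simp: continuous_map_pairwise o_def\<close>)
    then show "continuous_map (top_of_set {0..1}) Y (\<lambda>t. \<sigma> z (wedge_proj (i, t)))"
      by (rule continuous_map_eq) (auto simp: \<sigma> z i)
  qed
  have "continuous_map Z (mapping_space ?J Y) \<sigma>"
    unfolding mapping_space_def
  proof (rule continuous_on_generated_topo)
    fix U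
    assume "U \<in> {{f \<in> extensional (topspace ?J). continuous_map ?J Y f \<and> f ` K \<subseteq> U} |K U.
              compactin ?J K \<and> openin Y U}"
    then obtain K V where U: "U = {f \<in> extensional (topspace ?J). continuous_map ?J Y f \<and> f ` K \<subseteq> V}"
      and K: "compactin ?J K" and V: "openin Y V" by blast
    let ?K = "\<lambda>i. {t\<in>{0..1}. wedge_proj (i, t) \<in> K}"
    have Keq: "K = (\<Union>i<s. (\<lambda>t. wedge_proj (i, t)) ` ?K i)"
    proof (intro equalityI subsetI)
      fix p assume p: "p \<in> K"
      then obtain i t where "i < s" "t \<in> {0..1}" "p = wedge_proj (i, t)"
        using compactin_subset_topspace[OF K] by (auto simp: topspace_interval_wedge)
      then show "p \<in> (\<Union>i<s. (\<lambda>t. wedge_proj (i, t)) ` ?K i)" using p by blast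
    qed auto
    have "\<sigma> -` U \<inter> topspace Z = {z \<in> topspace Z. \<sigma> z ` K \<subseteq> V}"
      using cont by (auto simp: U \<sigma>_def)
    also have "\<dots> = {z \<in> topspace Z. \<forall>i<s. \<forall>t\<in>?K i. H i z t \<in> V}"
      by (subst Keq) (auto simp: \<sigma> image_subset_iff)
    also have "openin Z \<dots>"
    proof (subst openin_subopen, intro ballI)
      fix z assume "z \<in> {z \<in> topspace Z. \<forall>i<s. \<forall>t\<in>?K i. H i z t \<in> V}"
      then have z: "z \<in> topspace Z" "\<And>i t. i < s \<Longrightarrow> t \<in> ?K i \<Longrightarrow> H i z t \<in> V" by blast+
      have "\<exists>T. openin Z T \<and> z \<in> T \<and> (\<forall>z'\<in>T. \<forall>t\<in>?K i. H i z' t \<in> V)" if i: "i < s" for i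
      proof -
        let ?W = "{p \<in> topspace (prod_topology Z (top_of_set {0..1})). (\<lambda>(z, t). H i z t) p \<in> V}"
        have W: "openin (prod_topology Z (top_of_set {0..1})) ?W"
          by (rule openin_continuous_map_preimage[OF H[OF i] V])
        have "{z} \<times> ?K i \<subseteq> ?W" using z i by auto
        from tube_lemma_right[OF W compactin_wedge_arc[OF K i] z(1) this]
        obtain T T' where T: "openin Z T" "z \<in> T" "?K i \<subseteq> T'" "T \<times> T' \<subseteq> ?W"
          by blast
        have "H i z' t \<in> V" if "z' \<in> T" "t \<in> ?K i" for z' t
        proof -
          have "(z', t) \<in> ?W" using T that by blast
          then show ?thesis by simp
        qed
        then show ?thesis using T by blast
      qed
      then have "\<forall>i\<in>{..<s}. \<exists>T. openin Z T \<and> z \<in> T \<and> (\<forall>z'\<in>T. \<forall>t\<in>?K i. H i z' t \<in> V)" by blast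
      from bchoice[OF this] obtain T where
        T: "\<forall>i\<in>{..<s}. openin Z (T i) \<and> z \<in> T i \<and> (\<forall>z'\<in>T i. \<forall>t\<in>?K i. H i z' t \<in> V)" by blast
      have "openin Z (\<Inter>i<s. T i)" using s T by (intro openin_Inter) auto
      moreover have "(\<Inter>i<s. T i) \<subseteq> {z \<in> topspace Z. \<forall>i<s. \<forall>t\<in>?K i. H i z t \<in> V}"
      proof (intro subsetI CollectI conjI allI impI ballI)
        fix z' assume z': "z' \<in> (\<Inter>i<s. T i)"
        have "openin Z (T 0)" using T s by blast
        then show "z' \<in> topspace Z" using z' s openin_subset by fastforce
        show "H i z' t \<in> V" if "i < s" "t \<in> ?K i" for i t using T z' that by blast
      qed
      ultimately show "\<exists>T. openin Z T \<and> z \<in> T \<and> T \<subseteq> {z \<in> topspace Z. \<forall>i<s. \<forall>t\<in>?K i. H i z t \<in> V}"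
        using T by blast
    qed
    finally show "openin Z (\<sigma> -` U \<inter> topspace Z)" .
  next
    have "\<sigma> ` topspace Z \<subseteq> topspace (mapping_space ?J Y)"
      using cont by (auto simp: topspace_mapping_space \<sigma>_def)
    then show "\<sigma> ` topspace Z \<subseteq> \<Union> {{f \<in> extensional (topspace ?J). continuous_map ?J Y f \<and> f ` K \<subseteq> U} |K U.
              compactin ?J K \<and> openin Y U}"
      unfolding mapping_space_def topology_generated_by_topspace .
  qed
  then show thesis using \<sigma> that by blast
qed

text \<open>Uncurrying, which rests on local compactness of the interval: a small closed ball around
  t supplies the compact set of a subbasic neighbourhood.\<close>

lemma continuous_map_wedge_evaluation:
  assumes \<sigma>: "continuous_map Z (mapping_space (interval_wedge s) Y) \<sigma>" and i: "i < s"
  shows "continuous_map (prod_topology Z (top_of_set {0..1})) Y (\<lambda>(z, t). \<sigma> z (wedge_proj (i, t)))"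
proof -
  let ?J = "interval_wedge s" and ?I = "top_of_set {0..1::real}"
  have path: "continuous_map ?I Y (\<lambda>t. \<sigma> z (wedge_proj (i, t)))" if "z \<in> topspace Z" for z
  proof -
    have "continuous_map ?J Y (\<sigma> z)"
      using continuous_map_image_subset_topspace[OF \<sigma>] that by (auto simp: topspace_mapping_space)
    from continuous_map_compose[OF continuous_map_wedge_arc[OF i] this] show ?thesis by (simp add: o_def)
  qed
  show ?thesis
    unfolding continuous_map_def
  proof (intro conjI allI impI)
    show "(\<lambda>(z, t). \<sigma> z (wedge_proj (i, t))) \<in> topspace (prod_topology Z ?I) \<rightarrow> topspace Y"
      using path by (force simp: continuous_map_def Pi_iff)
    fix V assume V: "openin Y V"
    let ?P = "{x \<in> topspace (prod_topology Z ?I). (\<lambda>(z, t). \<sigma> z (wedge_proj (i, t))) x \<in> V}"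
    show "openin (prod_topology Z ?I) ?P"
    proof (subst openin_subopen, intro ballI)
      fix x assume "x \<in> ?P"
      then obtain z t where x: "x = (z, t)" and z: "z \<in> topspace Z" and t: "t \<in> {0..1}"
        and zt: "\<sigma> z (wedge_proj (i, t)) \<in> V" by auto
      have "openin ?I {t \<in> {0..1}. \<sigma> z (wedge_proj (i, t)) \<in> V}"
        using openin_continuous_map_preimage[OF path[OF z] V] by simp
      then obtain e where e: "e > 0" "\<And>t'. t' \<in> {0..1} \<Longrightarrow> dist t' t < e \<Longrightarrow> \<sigma> z (wedge_proj (i, t')) \<in> V"
        using t zt unfolding openin_euclidean_subtopology_iff by force
      let ?C = "cball t (e/2) \<inter> {0..1}"
      have "compactin ?I ?C"
        by (auto simp: compactin_subtopology intro!: compact_Int)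
      then have K: "compactin ?J ((\<lambda>t. wedge_proj (i, t)) ` ?C)"
        by (rule image_compactin[OF _ continuous_map_wedge_arc[OF i]])
      let ?B = "{f \<in> extensional (topspace ?J). continuous_map ?J Y f \<and> f ` (\<lambda>t. wedge_proj (i, t)) ` ?C \<subseteq> V}"
      have "openin (mapping_space ?J Y) ?B"
        unfolding mapping_space_def using K V by (intro topology_generated_by_Basis) blast
      then have T: "openin Z {z \<in> topspace Z. \<sigma> z \<in> ?B}"
        by (rule openin_continuous_map_preimage[OF \<sigma>])
      have "\<sigma> z \<in> topspace (mapping_space ?J Y)"
        using continuous_map_image_subset_topspace[OF \<sigma>] z by auto
      then have zB: "\<sigma> z \<in> ?B"
        using e by (auto simp: topspace_mapping_space dist_commute)
      let ?T = "{z \<in> topspace Z. \<sigma> z \<in> ?B} \<times> (ball t (e/2) \<inter> {0..1})"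
      have "openin ?I (ball t (e/2) \<inter> {0..1})"
        by (metis inf_commute open_ball openin_open_Int)
      then have "openin (prod_topology Z ?I) ?T"
        using T by (simp add: openin_prod_Times_iff)
      moreover have "x \<in> ?T" using x z zB t e(1) by auto
      moreover have "?T \<subseteq> ?P" by (force simp: image_subset_iff)
      ultimately show "\<exists>T. openin (prod_topology Z ?I) T \<and> x \<in> T \<and> T \<subseteq> ?P" by blast
    qed
  qed
qed

section \<open>The upper bound\<close>

lemma topspace_power_space: "topspace (power_space s X) = PiE {..<s} (\<lambda>_. topspace X)"
  by (simp add: power_space_def)

lemma continuous_map_power_space_proj:
  "i < s \<Longrightarrow> continuous_map (power_space s X) X (\<lambda>x. x i)"
  unfolding power_space_def by (rule continuous_map_product_projection) simp

lemma has_eval_section_disjoint_Union: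
  assumes op: "\<And>a. a \<in> I \<Longrightarrow> openin (power_space s X) (U a)"
    and sec: "\<And>a. a \<in> I \<Longrightarrow> has_eval_section s X (U a)"
    and disj: "\<And>a b. a \<in> I \<Longrightarrow> b \<in> I \<Longrightarrow> a \<noteq> b \<Longrightarrow> U a \<inter> U b = {}"
  shows "has_eval_section s X (\<Union>a\<in>I. U a)"
proof -
  let ?P = "power_space s X" and ?W = "\<Union>a\<in>I. U a" and ?M = "mapping_space (interval_wedge s) X"
  have "\<forall>a\<in>I. \<exists>\<sigma>. continuous_map (subtopology ?P (U a)) ?M \<sigma> \<and> (\<forall>x\<in>U a. wedge_eval s (\<sigma> x) = x)"
    using sec unfolding has_eval_section_def by blast
  from bchoice[OF this] obtain \<tau> where
    \<tau>: "\<forall>a\<in>I. continuous_map (subtopology ?P (U a)) ?M (\<tau> a) \<and> (\<forall>x\<in>U a. wedge_eval s (\<tau> a x) = x)"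
    by blast
  define \<sigma> where "\<sigma> x = \<tau> (THE a. a \<in> I \<and> x \<in> U a) x" for x
  have \<sigma>: "\<sigma> x = \<tau> a x" if a: "a \<in> I" "x \<in> U a" for a x
  proof -
    have "(THE a. a \<in> I \<and> x \<in> U a) = a" using a disj by (intro the_equality) blast+
    then show ?thesis by (simp add: \<sigma>_def)
  qed
  have "continuous_map (subtopology ?P ?W) ?M \<sigma>"
  proof (rule pasting_lemma[where T = U and I = I and f = \<tau>])
    fix a assume a: "a \<in> I"
    then have sub: "U a \<subseteq> ?W" by blast
    show "openin (subtopology ?P ?W) (U a)"
      unfolding openin_subtopology using op[OF a] sub by (intro exI[of _ "U a"]) auto
    have "?W \<inter> U a = U a" using sub by blast
    then show "continuous_map (subtopology (subtopology ?P ?W) (U a)) ?M (\<tau> a)"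
      using \<tau> a by (simp add: subtopology_subtopology)
  next
    fix a b x assume "a \<in> I" "b \<in> I" "x \<in> topspace (subtopology ?P ?W) \<inter> U a \<inter> U b"
    then show "\<tau> a x = \<tau> b x" using disj by blast
  next
    fix x assume "x \<in> topspace (subtopology ?P ?W)"
    then show "\<exists>a. a \<in> I \<and> x \<in> U a \<and> \<sigma> x = \<tau> a x" using \<sigma> by auto
  qed
  moreover have "\<forall>x\<in>?W. wedge_eval s (\<sigma> x) = x" using \<tau> \<sigma> by auto
  ultimately show ?thesis unfolding has_eval_section_def by blast
qed

text \<open>The squared norm of the coordinates i to m of a unit vector of the line. For i = a + 1
  it vanishes exactly on the closure of the cell of dimension a.\<close>

definition rp_tail :: "nat \<Rightarrow> (nat \<Rightarrow> real) set \<Rightarrow> nat \<Rightarrow> real" where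
  "rp_tail m A i = (\<Sum>k\<in>{i..m}. rp_entry A k k)"

text \<open>A neighbourhood of the product of the open Schubert cells of dimensions \<open>a\<^sub>0, \<dots>, a\<^sub>s\<^sub>-\<^sub>1\<close>; the
  cross conditions make the neighbourhoods of different products of the same dimension disjoint.\<close>

definition rp_cell_nbhd :: "nat \<Rightarrow> nat \<Rightarrow> (nat \<Rightarrow> nat) \<Rightarrow> (nat \<Rightarrow> (nat \<Rightarrow> real) set) set" where
  "rp_cell_nbhd s m a = {x \<in> topspace (power_space s (real_projective_space m)).
     \<forall>p<s. \<forall>q<s. rp_tail m (x p) (Suc (a p)) < rp_tail m (x q) (a q)}"

lemma continuous_map_rp_tail:
  "continuous_map (real_projective_space m) euclideanreal (\<lambda>A. rp_tail m A i)"
  unfolding rp_tail_def by (intro continuous_map_sum continuous_map_rp_entry) auto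

lemma openin_rp_cell_nbhd:
  assumes "0 < s"
  shows "openin (power_space s (real_projective_space m)) (rp_cell_nbhd s m a)"
proof -
  let ?P = "power_space s (real_projective_space m)"
  let ?S = "\<lambda>(p, q). {x \<in> topspace ?P. rp_tail m (x p) (Suc (a p)) - rp_tail m (x q) (a q) \<in> {..<0}}"
  have cont: "continuous_map ?P euclideanreal (\<lambda>x. rp_tail m (x p) i)" if "p < s" for p i
    using continuous_map_compose[OF continuous_map_power_space_proj[OF that] continuous_map_rp_tail]
    by (simp add: o_def)
  have "openin ?P (\<Inter> (?S ` ({..<s} \<times> {..<s})))"
  proof (rule openin_Inter)
    fix T assume "T \<in> ?S ` ({..<s} \<times> {..<s})"
    then obtain p q where T: "p < s" "q < s" "T = ?S (p, q)" by blast
    have "openin ?P {x \<in> topspace ?P. rp_tail m (x p) (Suc (a p)) - rp_tail m (x q) (a q) \<in> {..<0}}"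
      by (rule openin_continuous_map_preimage[of _ euclideanreal])
        (auto intro!: continuous_intros cont T)
    then show "openin ?P T" using T by simp
  qed (use assms in auto)
  moreover have "\<Inter> (?S ` ({..<s} \<times> {..<s})) = rp_cell_nbhd s m a"
    using assms by (auto simp: rp_cell_nbhd_def)
  ultimately show ?thesis by simp
qed

lemma rp_tail_Suc: "i \<le> m \<Longrightarrow> rp_tail m A i = rp_entry A i i + rp_tail m A (Suc i)"
  unfolding rp_tail_def by (simp add: sum.atLeast_Suc_atMost)

lemma rp_tail_antimono:
  "A \<in> topspace (real_projective_space m) \<Longrightarrow> i \<le> j \<Longrightarrow> rp_tail m A j \<le> rp_tail m A i"
  unfolding rp_tail_def by (intro sum_mono2) (auto intro: rp_entry_nonneg)

text \<open>Distinct tuples with equal sum satisfy \<open>a p < b p\<close> and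
  \<open>b q < a q\<close> for some p and q. At a common point the cross conditions then close up to
  a strict cycle of tails.\<close>

lemma rp_cell_nbhd_disjoint:
  assumes ab: "a \<in> PiE {..<s} (\<lambda>_. {..m})" "b \<in> PiE {..<s} (\<lambda>_. {..m})"
    and eq: "sum a {..<s} = sum b {..<s}" and ne: "a \<noteq> b"
  shows "rp_cell_nbhd s m a \<inter> rp_cell_nbhd s m b = {}"
proof -
  have ex: "\<exists>p<s. a p < b p"
    if ab: "a \<in> PiE {..<s} (\<lambda>_. {..m})" "b \<in> PiE {..<s} (\<lambda>_. {..m})"
      and eq: "sum a {..<s} = sum b {..<s}" and ne: "a \<noteq> b" for a b
  proof (rule ccontr)
    assume "\<not> (\<exists>p<s. a p < b p)"
    then have le: "b p \<le> a p" if "p < s" for p using that by (meson not_le)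
    have "b p = a p" if "p < s" for p
      by (rule sum_mono_inv[OF eq[symmetric]]) (use le that in auto)
    then have "a = b" using ab by (intro PiE_ext) auto
    then show False using ne by blast
  qed
  obtain p where p: "p < s" "a p < b p" using ex[OF ab eq ne] by blast
  obtain q where q: "q < s" "b q < a q" using ex[OF ab(2,1) eq[symmetric] ne[symmetric]] by blast
  have False if x: "x \<in> rp_cell_nbhd s m a" "x \<in> rp_cell_nbhd s m b" for x
  proof -
    have mem: "x p \<in> topspace (real_projective_space m)" "x q \<in> topspace (real_projective_space m)"
      using x(1) p q by (auto simp: rp_cell_nbhd_def topspace_power_space)
    have "rp_tail m (x p) (b p) \<le> rp_tail m (x p) (Suc (a p))"
      using mem(1) p(2) by (intro rp_tail_antimono) auto
    also have "\<dots> < rp_tail m (x q) (a q)" using x(1) p q by (simp add: rp_cell_nbhd_def)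
    also have "\<dots> \<le> rp_tail m (x q) (Suc (b q))"
      using mem(2) q(2) by (intro rp_tail_antimono) auto
    also have "\<dots> < rp_tail m (x p) (b p)" using x(2) p q by (simp add: rp_cell_nbhd_def)
    finally show False .
  qed
  then show ?thesis by blast
qed

text \<open>Taking the last nonzero coordinate in each factor, all tails after it are 0 and all
  tails from it on are positive.\<close>

lemma rp_cell_nbhd_cover:
  assumes x: "x \<in> topspace (power_space s (real_projective_space m))"
  obtains a where "a \<in> PiE {..<s} (\<lambda>_. {..m})" "x \<in> rp_cell_nbhd s m a"
proof -
  have "\<exists>k\<le>m. 0 < rp_entry (x p) k k \<and> rp_tail m (x p) (Suc k) = 0" if "p < s" for p
  proof -
    have mem: "x p \<in> topspace (real_projective_space m)"
      using x that by (auto simp: topspace_power_space)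
    obtain v where v: "v \<in> topspace (nsphere m)" "\<And>k l. rp_entry (x p) k l = v k * v l"
      by (rule rp_pointE[OF mem]) blast
    let ?S = "{k. k \<le> m \<and> v k \<noteq> 0}"
    have "?S \<noteq> {}"
    proof
      assume "?S = {}"
      then have "(\<Sum>i\<le>m. (v i)\<^sup>2) = 0" by (intro sum.neutral) auto
      then show False using v(1) by (simp add: topspace_nsphere)
    qed
    moreover have fin: "finite ?S" by simp
    ultimately have M: "Max ?S \<in> ?S" by (rule Max_in[rotated])
    have "v k = 0" if "k \<in> {Suc (Max ?S)..m}" for k
    proof (rule ccontr)
      assume "v k \<noteq> 0"
      then have "k \<le> Max ?S" using that by (intro Max_ge fin) simp
      then show False using that by simp
    qed
    then have "rp_tail m (x p) (Suc (Max ?S)) = 0"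
      unfolding rp_tail_def by (intro sum.neutral) (simp add: v(2))
    moreover have "Max ?S \<le> m" "0 < v (Max ?S) * v (Max ?S)"
      using M not_real_square_gt_zero[of "v (Max ?S)"] by blast+
    ultimately show ?thesis unfolding v(2) by blast
  qed
  then have "\<forall>p\<in>{..<s}. \<exists>k. k \<le> m \<and> 0 < rp_entry (x p) k k \<and> rp_tail m (x p) (Suc k) = 0" by auto
  from bchoice[OF this] obtain a where
    a: "\<forall>p\<in>{..<s}. a p \<le> m \<and> 0 < rp_entry (x p) (a p) (a p) \<and> rp_tail m (x p) (Suc (a p)) = 0" by blast
  have "restrict a {..<s} \<in> PiE {..<s} (\<lambda>_. {..m})" using a by auto
  moreover have "x \<in> rp_cell_nbhd s m (restrict a {..<s})"
    using a x by (auto simp: rp_cell_nbhd_def rp_tail_Suc)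
  ultimately show thesis by (rule that)
qed

text \<open>The condition for equal indices makes the diagonal entry at \<open>a i\<close> positive,
  so column \<open>a i\<close> is a continuous nonzero vector of the line. It is joined to the basis
  vector of index 0, whose line is the common base point.\<close>

lemma has_eval_section_rp_cell_nbhd:
  assumes s: "0 < s" and a: "a \<in> PiE {..<s} (\<lambda>_. {..m})"
  shows "has_eval_section s (real_projective_space m) (rp_cell_nbhd s m a)"
proof -
  let ?P = "power_space s (real_projective_space m)" and ?U = "rp_cell_nbhd s m a"
  let ?Z = "subtopology ?P ?U" and ?I = "top_of_set {0..1::real}"
  \<comment> \<open>At t = 0 this is the basis vector of index 0, at t = 1 the column; for t > 0 its
    coordinate \<open>a i\<close> is positive.\<close>
  define V where "V i x t k = (1 - t) * of_bool (k = 0) + t * (1 - t) * of_bool (k = a i) + t * rp_entry (x i) k (a i)"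
    for i and x :: "nat \<Rightarrow> (nat \<Rightarrow> real) set" and t :: real and k
  have ai: "a i \<le> m" if "i < s" for i using a that by auto
  have mem: "x i \<in> topspace (real_projective_space m)" if "x \<in> ?U" "i < s" for x i
    using that by (auto simp: rp_cell_nbhd_def topspace_power_space)
  have pos: "0 < rp_entry (x i) (a i) (a i)" if "x \<in> ?U" "i < s" for x i
  proof -
    have "rp_tail m (x i) (Suc (a i)) < rp_tail m (x i) (a i)"
      using that by (simp add: rp_cell_nbhd_def)
    then show ?thesis using rp_tail_Suc[OF ai[OF that(2)]] by simp
  qed
  have cont: "continuous_map (prod_topology ?Z ?I) (real_projective_space m) (\<lambda>(x, t). rp_class m (V i x t))"
    if i: "i < s" for i
  proof -
    have "continuous_map (prod_topology ?Z ?I) (real_projective_space m) (\<lambda>z. rp_class m (V i (fst z) (snd z)))"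
    proof (rule continuous_map_rp_class)
      fix z k assume z: "z \<in> topspace (prod_topology ?Z ?I)" and k: "m < k"
      then have zU: "fst z \<in> ?U" by auto
      obtain v where "v \<in> topspace (nsphere m)" "\<And>k l. rp_entry (fst z i) k l = v k * v l"
        by (rule rp_pointE[OF mem[OF zU i]]) blast
      then show "V i (fst z) (snd z) k = 0"
        using k ai[OF i] by (auto simp: V_def topspace_nsphere)
    next
      fix z assume z: "z \<in> topspace (prod_topology ?Z ?I)"
      obtain x t where zx: "z = (x, t)" "x \<in> ?U" "0 \<le> t" "t \<le> 1" using z by (cases z) auto
      show "\<exists>k\<le>m. V i (fst z) (snd z) k \<noteq> 0"
      proof (cases "t = 0")
        case True
        then show ?thesis by (intro exI[of _ 0]) (simp add: V_def zx)
      next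
        case False
        then have "0 < t * rp_entry (x i) (a i) (a i)" using pos[OF zx(2) i] zx by simp
        moreover have "0 \<le> (1 - t) * of_bool (a i = 0) + t * (1 - t) * of_bool (a i = a i)"
          using zx by (intro add_nonneg_nonneg mult_nonneg_nonneg) auto
        ultimately have "0 < V i x t (a i)" unfolding V_def by linarith
        then show ?thesis using ai[OF i] zx by (intro exI[of _ "a i"]) simp
      qed
    next
      fix k
      have 1: "continuous_map (prod_topology ?Z ?I) euclideanreal snd"
        by (rule continuous_map_into_fulltopology[OF continuous_map_snd])
      have 2: "continuous_map (prod_topology ?Z ?I) euclideanreal (\<lambda>z. rp_entry (fst z i) k (a i))"
        using continuous_map_compose[OF continuous_map_compose[OF continuous_map_compose[OF continuous_map_fst
            continuous_map_from_subtopology[OF continuous_map_id]] continuous_map_power_space_proj[OF i]]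
            continuous_map_rp_entry[of m k "a i"]] by (simp add: o_def)
      show "continuous_map (prod_topology ?Z ?I) euclideanreal (\<lambda>z. V i (fst z) (snd z) k)"
        unfolding V_def by (intro continuous_intros 1 2)
    qed
    then show ?thesis by (simp add: case_prod_unfold)
  qed
  have base: "V i x 0 = V j x 0" for i j x by (simp add: V_def fun_eq_iff)
  have "\<exists>\<sigma>. continuous_map ?Z (mapping_space (interval_wedge s) (real_projective_space m)) \<sigma> \<and>
    (\<forall>x\<in>topspace ?Z. \<forall>i<s. \<forall>t\<in>{0..1}. \<sigma> x (wedge_proj (i, t)) = rp_class m (V i x t))"
  proof (rule continuous_map_into_mapping_space_wedge[OF s, where H = "\<lambda>i x t. rp_class m (V i x t)"])
    show "continuous_map (prod_topology ?Z ?I) (real_projective_space m) (\<lambda>(x, t). rp_class m (V i x t))"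
      if "i < s" for i using that by (rule cont)
    show "rp_class m (V i x 0) = rp_class m (V j x 0)" for i j x
      by (rule arg_cong[OF base])
  qed (intro exI conjI ballI allI impI, assumption, simp)
  then obtain \<sigma> where \<sigma>: "continuous_map ?Z (mapping_space (interval_wedge s) (real_projective_space m)) \<sigma>"
    "\<forall>x\<in>topspace ?Z. \<forall>i<s. \<forall>t\<in>{0..1}. \<sigma> x (wedge_proj (i, t)) = rp_class m (V i x t)" by blast
  have "wedge_eval s (\<sigma> x) = x" if x: "x \<in> ?U" for x
  proof -
    have xt: "x \<in> topspace ?P" using x by (simp add: rp_cell_nbhd_def)
    have "\<sigma> x (wedge_proj (i, 1)) = x i" if i: "i < s" for i
    proof -
      have "V i x 1 = (\<lambda>k. rp_entry (x i) k (a i))" by (auto simp: V_def)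
      then have "rp_class m (V i x 1) = x i"
        using rp_class_column[OF mem[OF x i], of "a i"] pos[OF x i] by simp
      then show ?thesis using \<sigma>(2) x xt i by simp
    qed
    then have "wedge_eval s (\<sigma> x) = restrict x {..<s}"
      unfolding wedge_eval_def by (intro restrict_ext) simp
    also have "\<dots> = x" using xt by (simp add: topspace_power_space PiE_restrict)
    finally show ?thesis .
  qed
  then show ?thesis using \<sigma>(1) unfolding has_eval_section_def by blast
qed

lemma enat_diff_one_le: "e \<le> enat (Suc n) \<Longrightarrow> e - 1 \<le> enat n"
  by (cases e) (auto simp: one_enat_def)

theorem higher_TC_real_projective_space_le:
  assumes s: "0 < s"
  shows "higher_TC s (real_projective_space m) \<le> enat (s * m)"
proof -
  let ?P = "power_space s (real_projective_space m)"
  let ?I = "\<lambda>n. {a \<in> PiE {..<s} (\<lambda>_. {..m}). sum a {..<s} = n}"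
  let ?W = "\<lambda>n. \<Union>a\<in>?I n. rp_cell_nbhd s m a"
  let ?U = "?W ` {..s * m}"
  have "openin ?P (?W n)" for n
    using openin_rp_cell_nbhd[OF s] by (intro openin_Union) auto
  moreover have "has_eval_section s (real_projective_space m) (?W n)" for n
    by (rule has_eval_section_disjoint_Union)
      (auto simp: openin_rp_cell_nbhd[OF s] intro!: has_eval_section_rp_cell_nbhd[OF s] dest: rp_cell_nbhd_disjoint)
  moreover have "\<Union>?U = topspace ?P"
  proof
    show "\<Union>?U \<subseteq> topspace ?P" by (auto simp: rp_cell_nbhd_def)
    show "topspace ?P \<subseteq> \<Union>?U"
    proof
      fix x assume "x \<in> topspace ?P"
      then obtain a where a: "a \<in> PiE {..<s} (\<lambda>_. {..m})" "x \<in> rp_cell_nbhd s m a"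
        by (rule rp_cell_nbhd_cover)
      have "sum a {..<s} \<le> (\<Sum>i<s. m)" using a(1) by (intro sum_mono) auto
      then have "sum a {..<s} \<le> s * m" by simp
      then show "x \<in> \<Union>?U" using a by blast
    qed
  qed
  ultimately have "Inf {enat (card \<U>) | \<U>. finite \<U> \<and> (\<forall>U\<in>\<U>. openin ?P U) \<and> \<Union>\<U> = topspace ?P \<and>
      (\<forall>U\<in>\<U>. has_eval_section s (real_projective_space m) U)} \<le> enat (card ?U)"
    by (intro Inf_lower CollectI exI[of _ ?U]) auto
  also have "card ?U \<le> Suc (s * m)" using card_image_le[of "{..s * m}" ?W] by simp
  then have "enat (card ?U) \<le> enat (Suc (s * m))" by simp
  finally show ?thesis unfolding higher_TC_def by (rule enat_diff_one_le)
qed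

section \<open>Sign functions obtained from sections\<close>

text \<open>Extension by zero places the product of cube boundaries in a metric function space,
  where it is compact by Tychonoff's theorem.\<close>

definition unit_cube_boundaries :: "nat \<Rightarrow> nat \<Rightarrow> (nat \<times> nat \<Rightarrow> real) set" where
  "unit_cube_boundaries s m =
     {y. (\<forall>p. p \<notin> {..<s} \<times> {..m} \<longrightarrow> y p = 0) \<and> (\<forall>p. \<bar>y p\<bar> \<le> 1) \<and> (\<forall>i<s. \<exists>k\<le>m. \<bar>y (i, k)\<bar> = 1)}"

lemma compact_unit_cube_boundaries: "compact (unit_cube_boundaries s m)"
proof -
  have "compactin (product_topology (\<lambda>_. euclideanreal) UNIV) (PiE UNIV (\<lambda>_::nat \<times> nat. {-1..1::real}))"
    by (subst compactin_PiE) auto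
  then have "compact (PiE UNIV (\<lambda>_::nat \<times> nat. {-1..1::real}))"
    by (simp add: euclidean_product_topology)
  moreover have "closed ({y. \<forall>p. p \<notin> {..<s} \<times> {..m} \<longrightarrow> y p = (0::real)} \<inter>
      (\<Inter>i\<in>{..<s}. \<Union>k\<in>{..m}. {y. \<bar>y (i, k)\<bar> = 1}))"
  proof (intro closed_Int closed_INT closed_UN ballI)
    show "closed {y. \<forall>p. p \<notin> {..<s} \<times> {..m} \<longrightarrow> y p = (0::real)}"
      by (intro closed_Collect_all closed_Collect_imp closed_Collect_eq) (auto intro!: continuous_intros)
    show "closed {y::nat \<times> nat \<Rightarrow> real. \<bar>y (i, k)\<bar> = 1}" for i k
      by (intro closed_Collect_eq continuous_intros) auto
  qed auto
  ultimately have "compact (PiE UNIV (\<lambda>_::nat \<times> nat. {-1..1::real}) \<inter>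
      ({y. \<forall>p. p \<notin> {..<s} \<times> {..m} \<longrightarrow> y p = (0::real)} \<inter>
      (\<Inter>i\<in>{..<s}. \<Union>k\<in>{..m}. {y. \<bar>y (i, k)\<bar> = 1})))"
    by (rule compact_Int_closed)
  also have "PiE UNIV (\<lambda>_::nat \<times> nat. {-1..1::real}) \<inter>
      ({y. \<forall>p. p \<notin> {..<s} \<times> {..m} \<longrightarrow> y p = (0::real)} \<inter>
      (\<Inter>i\<in>{..<s}. \<Union>k\<in>{..m}. {y. \<bar>y (i, k)\<bar> = 1})) = unit_cube_boundaries s m"
    by (auto simp: unit_cube_boundaries_def abs_le_iff PiE_iff)
  finally show ?thesis .
qed

lemma unit_cube_nonzero:
  assumes "y \<in> unit_cube_boundaries s m" "i < s"
  shows "\<exists>k\<le>m. y (i, k) \<noteq> 0"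
proof -
  obtain k where "k \<le> m" "\<bar>y (i, k)\<bar> = 1" using assms by (auto simp: unit_cube_boundaries_def)
  then show ?thesis by (intro exI[of _ k]) auto
qed

definition cube_to_rp :: "nat \<Rightarrow> nat \<Rightarrow> (nat \<times> nat \<Rightarrow> real) \<Rightarrow> nat \<Rightarrow> (nat \<Rightarrow> real) set" where
  "cube_to_rp s m y = (\<lambda>i\<in>{..<s}. rp_class m (\<lambda>k. y (i, k)))"

lemma continuous_map_cube_to_rp:
  "continuous_map (top_of_set (unit_cube_boundaries s m)) (power_space s (real_projective_space m)) (cube_to_rp s m)"
  unfolding power_space_def continuous_map_componentwise
proof (intro conjI ballI)
  fix i assume i: "i \<in> {..<s}"
  have "continuous_map (top_of_set (unit_cube_boundaries s m)) (real_projective_space m) (\<lambda>y. rp_class m (\<lambda>k. y (i, k)))"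
  proof (rule continuous_map_rp_class)
    show "continuous_map (top_of_set (unit_cube_boundaries s m)) euclideanreal (\<lambda>y. y (i, k))" for k
      using continuous_on_subset[OF continuous_on_product_coordinates[of "(i, k)"]] by simp
    show "\<exists>k\<le>m. z (i, k) \<noteq> 0" if "z \<in> topspace (top_of_set (unit_cube_boundaries s m))" for z
      using that unit_cube_nonzero[of z s m i] i by simp
  qed (auto simp: unit_cube_boundaries_def)
  then show "continuous_map (top_of_set (unit_cube_boundaries s m)) (real_projective_space m) (\<lambda>y. cube_to_rp s m y i)"
    using i by (simp add: cube_to_rp_def)
qed (simp add: cube_to_rp_def image_subset_iff)

section \<open>Transport of vectors between neighbouring lines\<close>

definition spans :: "nat \<Rightarrow> (nat \<Rightarrow> real) set \<Rightarrow> (nat \<Rightarrow> real) \<Rightarrow> bool" where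
  "spans m A v \<longleftrightarrow> (\<exists>x c. x \<in> topspace (nsphere m) \<and> A = {x, (\<lambda>i. - x i)} \<and> c \<noteq> 0 \<and> v = (\<lambda>k. c * x k))"

text \<open>The trace of the product of the two orthogonal projections, that is, the squared cosine
  of the angle between the lines.\<close>

definition rp_overlap :: "nat \<Rightarrow> (nat \<Rightarrow> real) set \<Rightarrow> (nat \<Rightarrow> real) set \<Rightarrow> real" where
  "rp_overlap m A B = (\<Sum>k\<le>m. \<Sum>l\<le>m. rp_entry A k l * rp_entry B k l)"

lemma rp_overlap_eq:
  "rp_overlap m {x, (\<lambda>i. - x i)} {y, (\<lambda>i. - y i)} = (\<Sum>k\<le>m. x k * y k)\<^sup>2"
proof -
  have "rp_overlap m {x, (\<lambda>i. - x i)} {y, (\<lambda>i. - y i)} = (\<Sum>k\<le>m. \<Sum>l\<le>m. (x k * y k) * (x l * y l))"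
    unfolding rp_overlap_def rp_entry_eq by (intro sum.cong refl) (simp add: ac_simps)
  also have "\<dots> = (\<Sum>k\<le>m. x k * y k)\<^sup>2" by (simp add: power2_eq_square sum_product)
  finally show ?thesis .
qed

lemma rp_overlap_self:
  assumes "A \<in> topspace (real_projective_space m)"
  shows "rp_overlap m A A = 1"
proof -
  obtain x where x: "x \<in> topspace (nsphere m)" "A = {x, (\<lambda>i. - x i)}"
    by (rule rp_pointE[OF assms]) blast
  then have "(\<Sum>k\<le>m. x k * x k) = 1" by (simp add: topspace_nsphere power2_eq_square)
  then show ?thesis unfolding x(2) rp_overlap_eq by simp
qed

lemma spans_class:
  assumes "\<exists>k\<le>m. v k \<noteq> 0" "\<And>k. m < k \<Longrightarrow> v k = 0"
  shows "spans m (rp_class m v) v"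
proof -
  let ?n = "sqrt (\<Sum>k\<le>m. (v k)\<^sup>2)"
  have pos: "0 < (\<Sum>k\<le>m. (v k)\<^sup>2)" using assms(1) sum_squares_pos by blast
  have "(\<Sum>i\<le>m. (v i / ?n)\<^sup>2) = (\<Sum>i\<le>m. (v i)\<^sup>2) / (?n)\<^sup>2"
    by (simp add: power_divide sum_divide_distrib)
  also have "\<dots> = 1" using pos by simp
  finally have "(\<lambda>i. v i / ?n) \<in> topspace (nsphere m)" using assms(2) by (simp add: topspace_nsphere)
  moreover have "v = (\<lambda>k. ?n * (v k / ?n))" "?n \<noteq> 0" using pos by (auto simp: fun_eq_iff)
  ultimately show ?thesis unfolding spans_def rp_class_def by blast
qed

lemma spans_project:
  assumes "spans m A v" and B: "B \<in> topspace (real_projective_space m)" and ov: "rp_overlap m B A \<noteq> 0"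
  shows "spans m B (\<lambda>k. \<Sum>l\<le>m. rp_entry B k l * v l)"
proof -
  obtain x c where x: "A = {x, (\<lambda>i. - x i)}" "c \<noteq> 0" "v = (\<lambda>k. c * x k)"
    using assms(1) unfolding spans_def by blast
  obtain y where y: "y \<in> topspace (nsphere m)" "B = {y, (\<lambda>i. - y i)}"
    by (rule rp_pointE[OF B]) blast
  let ?d = "\<Sum>k\<le>m. y k * x k"
  have "?d \<noteq> 0" using ov unfolding x(1) y(2) rp_overlap_eq by simp
  moreover have "(\<lambda>k. \<Sum>l\<le>m. rp_entry B k l * v l) = (\<lambda>k. (c * ?d) * y k)"
    unfolding x(3) y(2) rp_entry_eq by (simp add: fun_eq_iff sum_distrib_left sum_distrib_right ac_simps)
  ultimately show ?thesis unfolding spans_def using x(2) y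
    by (intro exI[of _ y] exI[of _ "c * ?d"]) simp
qed

lemma spans_inner_nonzero:
  assumes "spans m A v" "spans m A w"
  shows "(\<Sum>k\<le>m. v k * w k) \<noteq> 0"
proof -
  obtain x c where x: "x \<in> topspace (nsphere m)" "A = {x, (\<lambda>i. - x i)}" "c \<noteq> 0" "v = (\<lambda>k. c * x k)"
    using assms(1) unfolding spans_def by blast
  obtain y d where y: "A = {y, (\<lambda>i. - y i)}" "d \<noteq> 0" "w = (\<lambda>k. d * y k)"
    using assms(2) unfolding spans_def by blast
  have "y = x \<or> y = (\<lambda>i. - x i)" using x(2) y(1) by blast
  then obtain e where e: "e \<noteq> 0" "w = (\<lambda>k. e * x k)"
    using y(2,3) by (elim disjE) (auto intro: that[of "-d"])
  have "(\<Sum>k\<le>m. v k * w k) = (c * e) * (\<Sum>k\<le>m. (x k)\<^sup>2)"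
    unfolding x(4) e(2) by (simp add: sum_distrib_left power2_eq_square ac_simps)
  also have "(\<Sum>k\<le>m. (x k)\<^sup>2) = 1" using x(1) by (simp add: topspace_nsphere)
  finally show ?thesis using x(3) e(1) by simp
qed

text \<open>A vector of the line \<open>x\<^sub>i\<close> is transported along the two paths of the section, from \<open>x\<^sub>i\<close> to the base point
  and on to \<open>x\<^sub>i\<^sub>'\<close>, by successive orthogonal projections, and finally compared with the vector of \<open>x\<^sub>i\<^sub>'\<close>.
  This plays the role of lifting the path to the sphere.\<close>

lemma section_equivariant_function:
  fixes K :: "(nat \<times> nat \<Rightarrow> real) set"
  assumes K: "compact K" "K \<subseteq> unit_cube_boundaries s m"
    and sec: "has_eval_section s (real_projective_space m) U"
    and U: "\<And>y. y \<in> K \<Longrightarrow> cube_to_rp s m y \<in> U"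
    and i: "i < s" and i': "i' < s"
  shows "\<exists>g. continuous_on K g \<and> (\<forall>y\<in>K. g y \<noteq> (0::real)) \<and>
    (\<forall>y\<in>K. \<forall>y'\<in>K. \<forall>e e'. cube_to_rp s m y' = cube_to_rp s m y \<longrightarrow> (\<forall>k. y' (i, k) = e * y (i, k)) \<longrightarrow>
       (\<forall>k. y' (i', k) = e' * y (i', k)) \<longrightarrow> g y' = e * e' * g y)"
proof -
  let ?X = "real_projective_space m" and ?P = "power_space s (real_projective_space m)"
  let ?pr = "cube_to_rp s m" and ?I = "{0..1::real}"
  obtain \<sigma> where \<sigma>: "continuous_map (subtopology ?P U) (mapping_space (interval_wedge s) ?X) \<sigma>"
    "\<And>x. x \<in> U \<Longrightarrow> wedge_eval s (\<sigma> x) = x"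
    using sec unfolding has_eval_section_def by blast
  define B where "B j y t = \<sigma> (?pr y) (wedge_proj (j, t))" for j y t
  have contB: "continuous_map (top_of_set (K \<times> ?I)) ?X (\<lambda>(y, t). B j y t)" if j: "j < s" for j
  proof -
    have "continuous_map (top_of_set K) ?P ?pr"
      using continuous_map_from_subtopology_mono[OF continuous_map_cube_to_rp K(2)] .
    then have "continuous_map (top_of_set K) (subtopology ?P U) ?pr"
      using U by (auto simp: continuous_map_in_subtopology)
    then have "continuous_map (prod_topology (top_of_set K) (top_of_set ?I))
        (prod_topology (subtopology ?P U) (top_of_set ?I)) (\<lambda>(y, t). (?pr y, t))"
      by (simp only: continuous_map_prod_top continuous_map_id[unfolded id_def] simp_thms)
    from continuous_map_compose[OF this continuous_map_wedge_evaluation[OF \<sigma>(1) j]]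
    show ?thesis by (simp add: o_def case_prod_unfold B_def)
  qed
  have memB: "B j y t \<in> topspace ?X" if "j < s" "y \<in> K" "t \<in> ?I" for j y t
    using continuous_map_image_subset_topspace[OF contB[OF that(1)]] that(2,3) by force
  have B1: "B j y 1 = rp_class m (\<lambda>k. y (j, k))" if "j < s" "y \<in> K" for j y
  proof -
    have "B j y 1 = wedge_eval s (\<sigma> (?pr y)) j" using that(1) by (simp add: wedge_eval_def B_def)
    also have "\<dots> = rp_class m (\<lambda>k. y (j, k))" using \<sigma>(2)[OF U[OF that(2)]] that(1) by (simp add: cube_to_rp_def)
    finally show ?thesis .
  qed
  have contE: "continuous_on (K \<times> ?I) (\<lambda>z. rp_entry (B j (fst z) (snd z)) k l)" if j: "j < s" for j k l
    using continuous_map_compose[OF contB[OF j] continuous_map_rp_entry[of m k l]]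
    by (simp add: o_def case_prod_unfold)
  \<comment> \<open>The overlap is 1 for equal parameters; uniform continuity keeps it nonzero for
    close ones, with one bound for all y.\<close>
  have unif: "\<exists>\<delta>>0. \<forall>y\<in>K. \<forall>t\<in>?I. \<forall>t'\<in>?I. \<bar>t' - t\<bar> < \<delta> \<longrightarrow> rp_overlap m (B j y t') (B j y t) \<noteq> 0"
    if j: "j < s" for j
  proof -
    let ?f = "\<lambda>z. rp_overlap m (B j (fst z) (snd (snd z))) (B j (fst z) (fst (snd z)))"
    have 1: "continuous_on (K \<times> ?I \<times> ?I) (\<lambda>z. rp_entry (B j (fst z) (fst (snd z))) k l)" for k l
    proof -
      have f: "continuous_on (K \<times> ?I \<times> ?I) (\<lambda>z. (fst z, fst (snd z)))"
        by (intro continuous_intros)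
      have "(\<lambda>z. (fst z, fst (snd z))) ` (K \<times> ?I \<times> ?I) \<subseteq> K \<times> ?I" by auto
      from continuous_on_compose2[OF contE[OF j, of k l] f this] show ?thesis by simp
    qed
    have 2: "continuous_on (K \<times> ?I \<times> ?I) (\<lambda>z. rp_entry (B j (fst z) (snd (snd z))) k l)" for k l
    proof -
      have f: "continuous_on (K \<times> ?I \<times> ?I) (\<lambda>z. (fst z, snd (snd z)))"
        by (intro continuous_intros)
      have "(\<lambda>z. (fst z, snd (snd z))) ` (K \<times> ?I \<times> ?I) \<subseteq> K \<times> ?I" by auto
      from continuous_on_compose2[OF contE[OF j, of k l] f this] show ?thesis by simp
    qed
    have "uniformly_continuous_on (K \<times> ?I \<times> ?I) ?f"
      unfolding rp_overlap_def
      by (intro compact_uniformly_continuous continuous_intros 1 2 compact_Times K(1)) auto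
    then have "\<exists>\<delta>>0. \<forall>z\<in>K \<times> ?I \<times> ?I. \<forall>z'\<in>K \<times> ?I \<times> ?I. dist z' z < \<delta> \<longrightarrow> dist (?f z') (?f z) < 1"
      unfolding uniformly_continuous_on_def using zero_less_one by blast
    then obtain \<delta> where \<delta>: "\<delta> > 0" "\<And>z z'. z \<in> K \<times> ?I \<times> ?I \<Longrightarrow> z' \<in> K \<times> ?I \<times> ?I \<Longrightarrow>
        dist z' z < \<delta> \<Longrightarrow> dist (?f z') (?f z) < 1" by blast
    have "rp_overlap m (B j y t') (B j y t) \<noteq> 0"
      if y: "y \<in> K" "t \<in> ?I" "t' \<in> ?I" "\<bar>t' - t\<bar> < \<delta>" for y t t'
    proof -
      have "dist (y, t, t') (y, t, t) < \<delta>" using y(4) by (simp add: dist_Pair_Pair dist_real_def)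
      then have "dist (?f (y, t, t')) (?f (y, t, t)) < 1" using y by (intro \<delta>(2)) auto
      then have "dist (rp_overlap m (B j y t') (B j y t)) 1 < 1"
        using rp_overlap_self[OF memB[OF j y(1,2)]] by simp
      then show ?thesis by (auto simp: dist_real_def)
    qed
    then show ?thesis using \<delta>(1) by blast
  qed
  obtain \<delta>1 where \<delta>1: "\<delta>1 > 0" "\<And>y t t'. y \<in> K \<Longrightarrow> t \<in> ?I \<Longrightarrow> t' \<in> ?I \<Longrightarrow> \<bar>t' - t\<bar> < \<delta>1 \<Longrightarrow>
      rp_overlap m (B i y t') (B i y t) \<noteq> 0" using unif[OF i] by blast
  obtain \<delta>2 where \<delta>2: "\<delta>2 > 0" "\<And>y t t'. y \<in> K \<Longrightarrow> t \<in> ?I \<Longrightarrow> t' \<in> ?I \<Longrightarrow> \<bar>t' - t\<bar> < \<delta>2 \<Longrightarrow>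
      rp_overlap m (B i' y t') (B i' y t) \<noteq> 0" using unif[OF i'] by blast
  obtain n :: nat where n: "0 < n" "1 / n < min \<delta>1 \<delta>2"
    using real_arch_inverse[of "min \<delta>1 \<delta>2"] \<delta>1(1) \<delta>2(1) by (auto simp: inverse_eq_divide)
  \<comment> \<open>Lines with indices 0 to 2n: backwards along path i to the base point at index n,
    then forwards along path i'. Neighbouring lines are not orthogonal because 1 / n is below both
    bounds.\<close>
  define Q where "Q y j = (if j < n then B i y (real (n - j) / n) else B i' y (real (j - n) / n))" for y j
  have Qn: "Q y n = B i y 0" for y
    by (simp add: Q_def B_def wedge_proj_def)
  have frac: "real a / n \<in> ?I" if "a \<le> n" for a using that n(1) by (simp add: divide_simps)
  have memQ: "Q y j \<in> topspace ?X" if "y \<in> K" "j \<le> 2 * n" for y j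
  proof (cases "j < n")
    case True
    then show ?thesis using memB[OF i that(1) frac[of "n - j"]] by (simp add: Q_def)
  next
    case False
    then show ?thesis using memB[OF i' that(1) frac[of "j - n"]] that(2) by (simp add: Q_def)
  qed
  have ovQ: "rp_overlap m (Q y (Suc j)) (Q y j) \<noteq> 0" if y: "y \<in> K" and j: "j < 2 * n" for y j
  proof (cases "j < n")
    case True
    have 1: "Q y (Suc j) = B i y (real (n - Suc j) / n)"
    proof (cases "Suc j = n")
      case True
      then show ?thesis using Qn by simp
    next
      case False
      then show ?thesis using True by (simp add: Q_def)
    qed
    have "real (n - Suc j) / n - real (n - j) / n = - (1 / n)"
      using True by (simp add: of_nat_diff field_simps)
    then have "\<bar>real (n - Suc j) / n - real (n - j) / n\<bar> < \<delta>1" using n by simp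
    then show ?thesis unfolding 1 using True by (simp add: Q_def) (intro \<delta>1(2) y frac; simp)
  next
    case False
    have "real (Suc j - n) / n - real (j - n) / n = 1 / n"
      using False by (simp add: of_nat_diff Suc_diff_le add_divide_distrib diff_divide_distrib)
    then have "\<bar>real (Suc j - n) / n - real (j - n) / n\<bar> < \<delta>2" using n by simp
    then show ?thesis using False j by (simp add: Q_def) (intro \<delta>2(2) y frac; simp)
  qed
  have contQ: "continuous_on K (\<lambda>y. rp_entry (Q y j) k l)" if "j \<le> 2 * n" for j k l
  proof -
    have *: "continuous_on K (\<lambda>y. rp_entry (B p y t) k l)" if "p < s" "t \<in> ?I" for p t
    proof -
      have f: "continuous_on K (\<lambda>y. (y, t))" by (intro continuous_intros)
      have "(\<lambda>y. (y, t)) ` K \<subseteq> K \<times> ?I" using that(2) by auto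
      from continuous_on_compose2[OF contE[OF that(1), of k l] f this] show ?thesis by simp
    qed
    show ?thesis
    proof (cases "j < n")
      case True
      then show ?thesis using *[OF i frac[of "n - j"]] by (simp add: Q_def)
    next
      case False
      then show ?thesis using *[OF i' frac[of "j - n"]] that by (simp add: Q_def)
    qed
  qed
  define w where "w y = rec_nat (\<lambda>k. y (i, k)) (\<lambda>j v k. \<Sum>l\<le>m. rp_entry (Q y (Suc j)) k l * v l)"
    for y :: "nat \<times> nat \<Rightarrow> real"
  have w0: "w y 0 = (\<lambda>k. y (i, k))" and wSuc: "w y (Suc j) = (\<lambda>k. \<Sum>l\<le>m. rp_entry (Q y (Suc j)) k l * w y j l)"
    for y j by (simp_all add: w_def)
  have coord: "continuous_on K (\<lambda>y. y p)" for p :: "nat \<times> nat"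
    by (rule continuous_on_subset[OF continuous_on_product_coordinates]) simp
  have contw: "continuous_on K (\<lambda>y. w y j k)" if "j \<le> 2 * n" for j k
    using that
  proof (induction j arbitrary: k)
    case 0
    then show ?case using coord by (simp add: w0)
  next
    case (Suc j)
    then show ?case unfolding wSuc by (intro continuous_intros contQ) auto
  qed
  have supp: "y (j, k) = 0" if "y \<in> K" "m < k" for y j k
    using K(2) that by (auto simp: unit_cube_boundaries_def)
  have spanc: "spans m (rp_class m (\<lambda>k. y (j, k))) (\<lambda>k. y (j, k))" if "y \<in> K" "j < s" for y j
  proof (rule spans_class)
    show "\<exists>k\<le>m. y (j, k) \<noteq> 0" using K(2) that unit_cube_nonzero by blast
  qed (use that supp in auto)
  have spanw: "spans m (Q y j) (w y j)" if y: "y \<in> K" and j: "j \<le> 2 * n" for y j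
    using j
  proof (induction j)
    case 0
    have "Q y 0 = rp_class m (\<lambda>k. y (i, k))" using n(1) B1[OF i y] by (simp add: Q_def)
    then show ?case using spanc[OF y i] by (simp add: w0)
  next
    case (Suc j)
    show ?case unfolding wSuc
      by (rule spans_project[OF _ memQ[OF y Suc.prems] ovQ[OF y]]) (use Suc in auto)
  qed
  define g where "g y = (\<Sum>k\<le>m. w y (2 * n) k * y (i', k))" for y
  have "continuous_on K g" unfolding g_def by (intro continuous_intros contw coord) auto
  moreover have "g y \<noteq> 0" if y: "y \<in> K" for y
  proof -
    have "Q y (2 * n) = rp_class m (\<lambda>k. y (i', k))" using n(1) B1[OF i' y] by (simp add: Q_def)
    then show ?thesis unfolding g_def
      using spans_inner_nonzero[OF spanw[OF y order_refl]] spanc[OF y i'] by simp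
  qed
  moreover have "g y' = e * e' * g y"
    if pr: "?pr y' = ?pr y" and e: "\<forall>k. y' (i, k) = e * y (i, k)" "\<forall>k. y' (i', k) = e' * y (i', k)" for y y' e e'
  proof -
    \<comment> \<open>The lines depend only on the image in projective space, so y and y' are
      transported by the same linear map; only the first and the last vector are rescaled.\<close>
    have Q: "Q y' j = Q y j" for j using pr by (simp add: Q_def B_def)
    have "w y' j k = e * w y j k" for j k
    proof (induction j arbitrary: k)
      case 0
      then show ?case using e(1) by (simp add: w0)
    next
      case (Suc j)
      then show ?case by (simp add: wSuc Q sum_distrib_left ac_simps)
    qed
    then show ?thesis using e(2) by (simp add: g_def sum_distrib_left ac_simps)
  qed
  ultimately show ?thesis by blast
qed

text \<open>Distinct signs of nonzero values are 2 apart, and the sign is uniformly continuous on a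
  compact set.\<close>

lemma sign_locally_constant:
  fixes g :: "'a::metric_space \<Rightarrow> real"
  assumes "compact K" "continuous_on K g" "\<And>y. y \<in> K \<Longrightarrow> g y \<noteq> 0"
  shows "\<exists>\<eta>>0. \<forall>y\<in>K. \<forall>y'\<in>K. dist y' y < \<eta> \<longrightarrow> (g y' < 0 \<longleftrightarrow> g y < 0)"
proof -
  have "uniformly_continuous_on K (\<lambda>y. sgn (g y))"
    using assms by (intro compact_uniformly_continuous continuous_intros) auto
  then obtain \<eta> where \<eta>: "\<eta> > 0" "\<And>y y'. y \<in> K \<Longrightarrow> y' \<in> K \<Longrightarrow> dist y' y < \<eta> \<Longrightarrow> dist (sgn (g y')) (sgn (g y)) < 1"
    unfolding uniformly_continuous_on_def using zero_less_one by metis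
  have "g y' < 0 \<longleftrightarrow> g y < 0" if "y \<in> K" "y' \<in> K" "dist y' y < \<eta>" for y y'
    using \<eta>(2)[OF that] assms(3)[OF that(1)] assms(3)[OF that(2)] by (auto simp: dist_real_def sgn_if split: if_splits)
  then show ?thesis using \<eta>(1) by blast
qed

section \<open>The numbers of the theorem\<close>

text \<open>Choosing the term \<open>x\<^sub>i\<close> or \<open>x\<^sub>s\<^sub>-\<^sub>1\<close> in each factor of \<open>\<Prod>\<^sub>i (x\<^sub>i + x\<^sub>s\<^sub>-\<^sub>1)\<^bsup>b i\<^esup>\<close> so as to
  obtain the monomial in which every variable has exponent \<open>m\<close>.\<close>

lemma card_choices:
  fixes \<iota> :: "nat \<Rightarrow> nat"
  assumes s: "0 < s" and n: "n \<le> s * m" and \<iota>: "\<And>j. j < n \<Longrightarrow> \<iota> j < s - 1"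
  defines "S \<equiv> \<lambda>j. if j < n then {\<iota> j, s - 1} else {s - 1}"
  shows "card {\<phi> \<in> PiE {..<s * m} S. \<forall>i<s. card {j. j < s * m \<and> \<phi> j = i} = m} =
         (\<Prod>i<s - 1. card {j. j < n \<and> \<iota> j = i} choose m)"
proof -
  let ?N = "s * m" and ?B = "\<lambda>i. {j. j < n \<and> \<iota> j = i}"
  let ?\<Phi> = "{\<phi> \<in> PiE {..<?N} S. \<forall>i<s. card {j. j < ?N \<and> \<phi> j = i} = m}"
  let ?T = "PiE {..<s - 1} (\<lambda>i. {T. T \<subseteq> ?B i \<and> card T = m})"
  define F where "F \<phi> = (\<lambda>i\<in>{..<s - 1}. {j. j < ?N \<and> \<phi> j = i})" for \<phi> :: "nat \<Rightarrow> nat"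
  define G where "G T = (\<lambda>j\<in>{..<?N}. if j < n \<and> j \<in> T (\<iota> j) then \<iota> j else s - 1)" for T :: "nat \<Rightarrow> nat set"
  have val: "(j < n \<and> \<phi> j = \<iota> j) \<or> \<phi> j = s - 1" if "\<phi> \<in> PiE {..<?N} S" "j < ?N" for \<phi> j
  proof -
    have "\<phi> j \<in> S j" using that by auto
    then show ?thesis unfolding S_def by (auto split: if_splits)
  qed
  have G_val: "G T \<in> PiE {..<?N} S" for T
    by (auto simp: G_def S_def)
  have G_fib: "{j. j < ?N \<and> G T j = i} = T i" if "T \<in> ?T" "i < s - 1" for T i
  proof -
    have sub: "T i \<subseteq> ?B i" using that by auto
    have "j < ?N \<and> G T j = i \<longleftrightarrow> j \<in> T i" for j
      using sub that(2) n \<iota>[of j] by (auto simp: G_def split: if_splits)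
    then show ?thesis by blast
  qed
  \<comment> \<open>The last fibre is determined by the others: if these have size m, it has size sm
    - (s - 1)m = m.\<close>
  have fib_total: "card {j. j < ?N \<and> \<phi> j = s - 1} = ?N - (\<Sum>i<s - 1. card {j. j < ?N \<and> \<phi> j = i})"
    if "\<phi> \<in> PiE {..<?N} S" for \<phi>
  proof -
    have "\<phi> j < s" if "j < ?N" for j
      using val[OF \<open>\<phi> \<in> PiE {..<?N} S\<close> that] \<iota>[of j] s by auto
    then have "{..<?N} = (\<Union>i\<in>{..<Suc (s - 1)}. {j. j < ?N \<and> \<phi> j = i})" using s by auto
    then have "card {..<?N} = (\<Sum>i\<in>{..<Suc (s - 1)}. card {j. j < ?N \<and> \<phi> j = i})"
      by (simp only:, subst card_UN_disjoint) auto
    then show ?thesis by simp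
  qed
  \<comment> \<open>A choice function amounts to the m-element sets of positions at which x_i is
    chosen, for i < s - 1.\<close>
  have "bij_betw F ?\<Phi> ?T"
  proof (rule bij_betw_byWitness[where f' = G])
    show "F ` ?\<Phi> \<subseteq> ?T"
    proof
      fix T assume "T \<in> F ` ?\<Phi>"
      then obtain \<phi> where \<phi>: "\<phi> \<in> PiE {..<?N} S" "\<forall>i<s. card {j. j < ?N \<and> \<phi> j = i} = m" "T = F \<phi>"
        by blast
      have "{j. j < ?N \<and> \<phi> j = i} \<subseteq> ?B i" if "i < s - 1" for i
        using val[OF \<phi>(1)] that by force
      then show "T \<in> ?T" using \<phi>(2) unfolding \<phi>(3) F_def by auto
    qed
    show "G ` ?T \<subseteq> ?\<Phi>"
    proof
      fix \<phi> assume "\<phi> \<in> G ` ?T"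
      then obtain T where T: "T \<in> ?T" "\<phi> = G T" by blast
      have low: "card {j. j < ?N \<and> \<phi> j = i} = m" if "i < s - 1" for i
        using G_fib[OF T(1) that] T that by auto
      have "card {j. j < ?N \<and> \<phi> j = s - 1} = ?N - (s - 1) * m"
        using fib_total[OF G_val, of T] low T(2) by simp
      also have "\<dots> = m" using s by (cases s) auto
      finally have "card {j. j < ?N \<and> \<phi> j = i} = m" if "i < s" for i
        using low[of i] that by (cases "i = s - 1") auto
      then show "\<phi> \<in> ?\<Phi>" using G_val T(2) by simp
    qed
    show "\<forall>\<phi>\<in>?\<Phi>. G (F \<phi>) = \<phi>"
    proof
      fix \<phi> assume "\<phi> \<in> ?\<Phi>"
      then have \<phi>: "\<phi> \<in> PiE {..<?N} S" by simp
      show "G (F \<phi>) = \<phi>"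
      proof (rule PiE_ext[OF G_val \<phi>])
        fix j assume "j \<in> {..<?N}"
        then show "G (F \<phi>) j = \<phi> j"
          using val[OF \<phi>, of j] \<iota>[of j] by (auto simp: G_def F_def)
      qed
    qed
    show "\<forall>T\<in>?T. F (G T) = T"
    proof
      fix T assume T: "T \<in> ?T"
      show "F (G T) = T"
        by (rule extensionalityI[of _ "{..<s - 1}"]) (use T G_fib[OF T] in \<open>auto simp: F_def PiE_def\<close>)
    qed
  qed
  then have "card ?\<Phi> = card ?T" by (rule bij_betw_same_card)
  also have "\<dots> = (\<Prod>i<s - 1. card {T. T \<subseteq> ?B i \<and> card T = m})" by (rule card_PiE) simp
  also have "\<dots> = (\<Prod>i<s - 1. card (?B i) choose m)" by (intro prod.cong n_subsets) auto
  finally show ?thesis .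
qed

lemma ex_function_with_fibres:
  fixes b :: "nat \<Rightarrow> nat"
  obtains \<iota> where "\<And>j. j < (\<Sum>i<r. b i) \<Longrightarrow> \<iota> j < r"
    "\<And>i. i < r \<Longrightarrow> card {j. j < (\<Sum>i<r. b i) \<and> \<iota> j = i} = b i"
proof -
  have "\<exists>xs. length xs = (\<Sum>i<r. b i) \<and> set xs \<subseteq> {..<r} \<and> (\<forall>i<r. length (filter (\<lambda>x. x = i) xs) = b i)"
  proof (induction r)
    case (Suc r)
    then obtain xs where xs: "length xs = (\<Sum>i<r. b i)" "set xs \<subseteq> {..<r}"
      "\<forall>i<r. length (filter (\<lambda>x. x = i) xs) = b i" by blast
    have "filter (\<lambda>x. x = r) xs = []" using xs(2) by (auto simp: filter_empty_conv)
    then show ?case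
      using xs by (intro exI[of _ "xs @ replicate (b r) r"]) (auto simp: less_Suc_eq)
  qed simp
  then obtain xs where xs: "length xs = (\<Sum>i<r. b i)" "set xs \<subseteq> {..<r}"
    "\<forall>i<r. length (filter (\<lambda>x. x = i) xs) = b i" by blast
  show thesis
  proof (rule that[of "(!) xs"])
    show "xs ! j < r" if "j < (\<Sum>i<r. b i)" for j
    proof -
      have "xs ! j \<in> set xs" using that xs(1) by simp
      then show ?thesis using xs(2) by blast
    qed
    show "card {j. j < (\<Sum>i<r. b i) \<and> xs ! j = i} = b i" if "i < r" for i
    proof -
      have "card {j. j < (\<Sum>i<r. b i) \<and> xs ! j = i} = length (filter (\<lambda>x. x = i) xs)"
        unfolding xs(1)[symmetric] by (rule length_filter_conv_card[symmetric])
      then show ?thesis using xs(3) that by simp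
    qed
  qed
qed

section \<open>Arithmetic of the recursion defining r(m)\<close>

lemma rp_e_eq:
  assumes "m mod 4 \<noteq> 3"
  shows "rp_e m = m mod 2"
  unfolding rp_e_def
proof (rule the_equality)
  show "m mod 2 ^ (m mod 2 + 1) = 2 ^ (m mod 2) - 1"
  proof (cases "even m")
    case True
    then show ?thesis by (simp add: even_iff_mod_2_eq_zero)
  next
    case False
    then have "m mod 2 = 1" by presburger
    moreover have "m mod 4 = 1" using assms False by presburger
    ultimately show ?thesis by simp
  qed
  fix e assume e: "m mod 2 ^ (e + 1) = 2 ^ e - 1"
  show "e = m mod 2"
  proof (cases "e \<le> 1")
    case True
    then consider "e = 0" | "e = 1" by linarith
    then show ?thesis
    proof cases
      case 1
      then show ?thesis using e by simp
    next
      case 2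
      then have "m mod 4 = 1" using e by simp
      then show ?thesis using 2 by presburger
    qed
  next
    case False
    then have d: "(4::nat) dvd 2 ^ e" "(4::nat) dvd 2 ^ (e + 1)"
      using le_imp_power_dvd[of 2 e "2::nat"] le_imp_power_dvd[of 2 "e + 1" "2::nat"] by simp_all
    \<comment> \<open>Two or more trailing binary ones would leave remainder 3 modulo 4.\<close>
    have "m mod 4 = (m mod 2 ^ (e + 1)) mod 4" using d(2) by (simp add: mod_mod_cancel)
    also have "\<dots> = (2 ^ e - 1) mod 4" using e by simp
    also obtain q where q: "(2::nat) ^ e = 4 * q" using d(1) by (elim dvdE)
    have "0 < q" using q by (cases q) auto
    then have "(2 ^ e - 1) mod 4 = (3::nat)" unfolding q by (cases q) (simp_all add: mod_Suc)
    finally show ?thesis using assms by simp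
  qed
qed

text \<open>Here 4 divides \<open>2 ^ rp_k m\<close> but not m + 1, so the first divisor is
  positive; being a multiple of \<open>2 ^ rp_e m\<close>, it is counted down exactly to this
  number.\<close>

lemma rp_d_facts:
  assumes m: "m \<ge> 2" "m mod 4 \<noteq> 3"
  shows "rp_d m (rp_t m) = 2 ^ rp_e m" "2 ^ rp_e m dvd rp_d m l"
proof -
  let ?e = "rp_e m" and ?k = "rp_k m"
  have e: "?e = m mod 2" using rp_e_eq[OF m(2)] .
  have "0 < (m::nat) \<and> m < 2 ^ m" using m(1) by simp
  then have k: "0 < ?k" "m < 2 ^ ?k" unfolding rp_k_def by (metis (mono_tags, lifting) LeastI)+
  have "?k \<noteq> 1" using k(2) m(1) by auto
  then have "(4::nat) dvd 2 ^ ?k" using k(1) le_imp_power_dvd[of 2 ?k "2::nat"] by simp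
  then obtain q where q: "(2::nat) ^ ?k = 4 * q" by (elim dvdE)
  have dvd0: "2 ^ ?e dvd rp_d m 0"
  proof (cases "even m")
    case True
    then show ?thesis using e by (simp add: even_iff_mod_2_eq_zero)
  next
    case False
    then have "2 dvd (4 * q - m - 1)" using q k(2) by presburger
    moreover have "m mod 2 = 1" using False by presburger
    ultimately show ?thesis using e q by (simp add: rp_d_def)
  qed
  have pos: "0 < rp_d m 0"
  proof -
    have "m \<noteq> 4 * q - 1"
    proof
      assume "m = 4 * q - 1"
      moreover obtain q' where "q = Suc q'" using k(2) q by (cases q) auto
      ultimately have "m = 4 * q' + 3" by simp
      then have "m mod 4 = 3" by simp
      then show False using m(2) by simp
    qed
    then show ?thesis using k(2) q by (simp add: rp_d_def)
  qed
  show "2 ^ ?e dvd rp_d m l"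
  proof -
    have "rp_d m l = rp_d m 0 - 2 ^ ?e * l" by (simp add: rp_d_def)
    then show ?thesis using dvd_diff_nat[OF dvd0 dvd_triv_left] by simp
  qed
  obtain c where c: "rp_d m 0 = 2 ^ ?e * c" using dvd0 by (elim dvdE)
  then have cp: "0 < c" using pos by (cases c) auto
  have "rp_d m 0 - 2 ^ ?e = 2 ^ ?e * (c - 1)" using c by (simp add: algebra_simps)
  then have t: "rp_t m = c - 1" by (simp add: rp_t_def)
  have "rp_d m (rp_t m) = rp_d m 0 - 2 ^ ?e * (c - 1)" by (simp add: rp_d_def t)
  also have "\<dots> = 2 ^ ?e * (c - (c - 1))" by (simp only: c diff_mult_distrib2)
  also have "c - (c - 1) = 1" using cp by simp
  finally show "rp_d m (rp_t m) = 2 ^ ?e" by simp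
qed

lemma sum_rp_d_rp_r_seq:
  assumes m: "m \<ge> 2" "m mod 4 \<noteq> 3"
  shows "(\<Sum>l\<le>rp_t m. rp_d m l * rp_r_seq m l) = m - m mod 2"
proof -
  let ?e = "rp_e m" and ?t = "rp_t m" and ?M = "m - (2 ^ rp_e m - 1)"
  have e: "?e = m mod 2" using rp_e_eq[OF m(2)] .
  have M: "?M = m - m mod 2" unfolding e by (cases "even m") (auto simp: even_iff_mod_2_eq_zero odd_iff_mod_2_eq_one)
  have le: "(\<Sum>i<l. rp_d m i * rp_r_seq m i) \<le> ?M" for l
  proof (induction l)
    case (Suc l)
    have "rp_d m l * rp_r_seq m l \<le> ?M - (\<Sum>i<l. rp_d m i * rp_r_seq m i)"
      by (subst rp_r_seq.simps) (simp add: times_div_less_eq_dividend)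
    then show ?case using Suc by simp
  qed simp
  let ?S = "\<Sum>i<?t. rp_d m i * rp_r_seq m i"
  have dt: "rp_d m ?t = 2 ^ ?e" by (rule rp_d_facts(1)[OF m])
  \<comment> \<open>The coefficient is m + 1 for even m, and (m + 2) choose 2 for m congruent to 1
    modulo 4.\<close>
  have odd: "((m + rp_d m ?t) choose (rp_d m ?t)) mod 2 = 1"
  proof (cases "even m")
    case True
    then have "rp_d m ?t = 1" using dt e by (simp add: even_iff_mod_2_eq_zero)
    then show ?thesis using True by simp presburger
  next
    case False
    then have m4: "m mod 4 = 1" using m(2) by presburger
    then have "m mod 2 = 1" by presburger
    then have "rp_d m ?t = 2" using dt e by simp
    moreover have "(m + 2) choose 2 = (m + 2) * (m + 1) div 2" by (simp add: choose_two)
    moreover have "((m + 2) * (m + 1) div 2) mod 2 = 1"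
    proof -
      obtain q where "m = 4 * q + 1" using m4 by (metis mult_div_mod_eq)
      then have "(m + 2) * (m + 1) = 2 * ((4 * q + 3) * (2 * q + 1))" by (simp add: algebra_simps)
      then have "(m + 2) * (m + 1) div 2 = (4 * q + 3) * (2 * q + 1)" by simp
      moreover have "odd ((4 * q + 3) * (2 * q + 1))" by simp
      ultimately show ?thesis by (simp only: odd_iff_mod_2_eq_one)
    qed
    ultimately show ?thesis by simp
  qed
  have "2 ^ ?e dvd ?S" using rp_d_facts(2)[OF m] by (intro dvd_sum) simp
  moreover have "2 ^ (m mod 2) dvd m - m mod 2"
  proof (cases "even m")
    case False
    then have "m mod 2 = 1" "2 dvd m - 1" by presburger+
    then show ?thesis by simp
  qed (simp add: even_iff_mod_2_eq_zero)
  then have "2 ^ ?e dvd ?M" by (simp only: M flip: e)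
  ultimately have "2 ^ ?e dvd ?M - ?S" by (rule dvd_diff_nat[rotated])
  moreover have "rp_r_seq m ?t = (?M - ?S) div 2 ^ ?e"
    by (subst rp_r_seq.simps) (use odd dt in simp)
  ultimately have "rp_d m ?t * rp_r_seq m ?t = ?M - ?S" unfolding dt by simp
  moreover have "(\<Sum>l\<le>?t. rp_d m l * rp_r_seq m l) = ?S + rp_d m ?t * rp_r_seq m ?t"
    by (simp add: lessThan_Suc_atMost[symmetric])
  ultimately have "(\<Sum>l\<le>?t. rp_d m l * rp_r_seq m l) = ?S + (?M - ?S)" by (simp only:)
  also have "\<dots> = ?M" using le by (rule le_add_diff_inverse)
  finally show ?thesis unfolding M .
qed

text \<open>The excesses \<open>d i\<close> of the exponents \<open>m + d i\<close> of the factors \<open>x\<^sub>i + x\<^sub>s\<^sub>-\<^sub>1\<close>: each \<open>d\<^sub>\<ell>\<close> occurs \<open>r\<^sub>\<ell>\<close>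
  times, and the remaining ones vanish.\<close>

lemma ex_excesses:
  assumes m: "m \<ge> 2" "m mod 4 \<noteq> 3" and s: "s \<ge> rp_r m"
  obtains d where "(\<Sum>i<s - 1. d i) = m - m mod 2" "\<And>i. i < s - 1 \<Longrightarrow> odd ((m + d i) choose m)"
proof -
  define ds where "ds = concat (map (\<lambda>l. replicate (rp_r_seq m l) (rp_d m l)) [0..<Suc (rp_t m)])"
  have len: "length ds = (\<Sum>l\<le>rp_t m. rp_r_seq m l)"
    unfolding ds_def length_concat
    by (simp del: upt_Suc add: o_def interv_sum_list_conv_sum_set_nat atLeast0LessThan lessThan_Suc_atMost)
  have "sum_list ds = sum_list (map (\<lambda>l. rp_r_seq m l * rp_d m l) [0..<n])"
    if "ds = concat (map (\<lambda>l. replicate (rp_r_seq m l) (rp_d m l)) [0..<n])" for n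
    unfolding that by (induction n) (simp_all add: sum_list_replicate)
  from this[OF ds_def] have sum: "sum_list ds = m - m mod 2"
    by (simp del: upt_Suc add: interv_sum_list_conv_sum_set_nat atLeast0LessThan lessThan_Suc_atMost
        mult.commute sum_rp_d_rp_r_seq[OF m])
  have odd: "odd ((m + x) choose m)" if "x \<in> set ds" for x
  proof -
    have "\<exists>l. x \<in> set (replicate (rp_r_seq m l) (rp_d m l))"
      using that by (auto simp: ds_def simp del: upt_Suc)
    then obtain l where l: "x = rp_d m l" "rp_r_seq m l \<noteq> 0" by auto
    then have "((m + x) choose x) mod 2 = 1"
      by (subst (asm) rp_r_seq.simps) (auto split: if_splits)
    moreover have "(m + x) choose x = (m + x) choose m" by (subst binomial_symmetric) auto
    ultimately show ?thesis by (simp add: odd_iff_mod_2_eq_one)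
  qed
  \<comment> \<open>This is where s >= r(m) enters: \<open>ds\<close> has length r(m) - 1 and must
    fit into s - 1 places. A padding zero gives the coefficient 1.\<close>
  define xs where "xs = ds @ replicate (s - 1 - length ds) 0"
  have len_xs: "length xs = s - 1" using s len by (simp add: xs_def rp_r_def)
  show thesis
  proof (rule that[of "(!) xs"])
    have "(\<Sum>i<s - 1. xs ! i) = sum_list xs"
      by (simp add: sum_list_sum_nth len_xs atLeast0LessThan)
    then show "(\<Sum>i<s - 1. xs ! i) = m - m mod 2" by (simp add: xs_def sum sum_list_replicate)
    show "odd ((m + xs ! i) choose m)" if "i < s - 1" for i
    proof -
      have "xs ! i \<in> set xs" using that len_xs by simp
      then have "xs ! i \<in> set ds \<or> xs ! i = 0" by (auto simp: xs_def split: if_splits)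
      then show ?thesis using odd by auto
    qed
  qed
qed

section \<open>The lower bound\<close>

text \<open>The weights 1, 1/2, 1/4, ... of the product metric add up to 2.\<close>

lemma dist_fun_le:
  fixes x y :: "'a::countable \<Rightarrow> real"
  assumes "\<And>p. \<bar>x p - y p\<bar> \<le> c"
  shows "dist x y \<le> 2 * c"
proof -
  let ?f = "\<lambda>n. (1/2)^n * min (dist (x (from_nat n)) (y (from_nat n))) 1"
  have c: "0 \<le> c" using assms[of undefined] by linarith
  have le: "?f n \<le> (1/2)^n * c" for n
    using assms[of "from_nat n"] by (intro mult_left_mono) (auto simp: dist_real_def)
  have sums: "(\<lambda>n. (1/2)^n * c) sums (2 * c)"
    using sums_mult2[OF geometric_sums[of "1/2::real"], of c] by simp
  have "summable ?f"
    by (rule summable_comparison_test'[OF sums_summable[OF sums], of 0]) (use le c in auto)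
  then have "dist x y \<le> (\<Sum>n. (1/2)^n * c)"
    unfolding dist_fun_def by (intro suminf_le le sums_summable[OF sums])
  then show ?thesis using sums_unique[OF sums] by simp
qed

section \<open>Mesh estimates for flags\<close>

context cube_power
begin

text \<open>Each coordinate moves at most once along a flag, so the bound does not grow with the
  number of steps.\<close>

lemma flag_coord_diff:
  assumes "c \<in> flags" "j \<le> s * m"
  shows "\<bar>c j p - c 0 p\<bar> \<le> 1"
proof -
  have "\<bar>c j p - c 0 p\<bar> \<le> 1 \<and> (even (c j p) \<longrightarrow> c j p = c 0 p)"
    using assms(2)
  proof (induction j)
    case (Suc j)
    have "step (c j) (c (Suc j))" using assms(1) Suc.prems by (simp add: flags_def)
    then obtain q d where q: "d \<in> {1, -1}" "even (c j q)" "c (Suc j) = (c j)(q := c j q + d)"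
      by (elim stepE)
    show ?case
    proof (cases "q = p")
      case True
      then have "c j p = c 0 p" using Suc q(2) by simp
      then show ?thesis using q True by auto
    next
      case False
      then show ?thesis using Suc q(3) by simp
    qed
  qed simp
  then show ?thesis ..
qed

lemma flag_step_diff:
  assumes "c \<in> flags" "j < s * m"
  shows "\<bar>c (Suc j) p - c j p\<bar> \<le> 1"
proof -
  have "step (c j) (c (Suc j))" using assms by (simp add: flags_def)
  then show ?thesis by (elim stepE) auto
qed

definition scaled :: "(nat \<times> nat \<Rightarrow> int) \<Rightarrow> nat \<times> nat \<Rightarrow> real" where
  "scaled v p = real_of_int (v p) / real_of_int M"

lemma scaled_cell:
  assumes "v \<in> cells"
  shows "scaled v \<in> unit_cube_boundaries s m"
proof -
  have abs: "\<bar>scaled v p\<bar> = real_of_int \<bar>v p\<bar> / M" for p using M_pos by (simp add: scaled_def)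
  have "\<bar>v p\<bar> \<le> M" for p
    using assms M_pos unfolding cells_def by (cases "p \<in> coords") auto
  then have "\<bar>scaled v p\<bar> \<le> 1" for p
    unfolding abs using M_pos by (simp add: divide_le_eq_1_pos del: of_int_abs)
  moreover have "scaled v p = 0" if "p \<notin> {..<s} \<times> {..m}" for p
    using assms that by (simp add: cells_def coords_def scaled_def)
  moreover have "\<exists>k\<le>m. \<bar>scaled v (i, k)\<bar> = 1" if i: "i < s" for i
  proof -
    obtain k where "k \<le> m" "\<bar>v (i, k)\<bar> = M" using assms i by (auto simp: cells_def)
    then show ?thesis unfolding abs using M_pos by (intro exI[of _ k]) simp
  qed
  ultimately show ?thesis unfolding unit_cube_boundaries_def by blast
qed

lemma scaled_diff:
  assumes "\<And>p. \<bar>u p - v p\<bar> \<le> 1"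
  shows "dist (scaled u) (scaled v) \<le> 2 / M"
proof -
  have "\<bar>scaled u p - scaled v p\<bar> \<le> 1 / M" for p
  proof -
    have "\<bar>scaled u p - scaled v p\<bar> = real_of_int \<bar>u p - v p\<bar> / M"
      using M_pos by (simp add: scaled_def diff_divide_distrib[symmetric])
    also have "\<dots> \<le> 1 / M" using assms[of p] M_pos by (intro divide_right_mono) auto
    finally show ?thesis .
  qed
  from dist_fun_le[of "scaled u" "scaled v", OF this] show ?thesis by simp
qed

lemma scaled_flip: "scaled (flip \<epsilon> v) p = real_of_int (\<epsilon> (fst p)) * scaled v p"
  by (simp add: scaled_def flip_def)

lemma dist_scaled_flip:
  assumes "\<epsilon> \<in> signs"
  shows "dist (scaled (flip \<epsilon> v)) (\<lambda>p. real_of_int (\<epsilon> (fst p)) * z p) = dist (scaled v) z"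
proof -
  have "dist (scaled (flip \<epsilon> v) p) (real_of_int (\<epsilon> (fst p)) * z p) = dist (scaled v p) (z p)" for p
    using signsD[OF assms, of "fst p"] by (auto simp: scaled_flip dist_real_def)
  then show ?thesis by (simp add: dist_fun_def)
qed

end

lemma cube_to_rp_flip:
  assumes "\<And>i. e i = 1 \<or> e i = (-1::real)"
  shows "cube_to_rp s m (\<lambda>p. e (fst p) * y p) = cube_to_rp s m y"
proof -
  have "rp_class m (\<lambda>k. e i * y (i, k)) = rp_class m (\<lambda>k. y (i, k))" for i
    using assms[of i] by (intro rp_class_scale) auto
  then show ?thesis unfolding cube_to_rp_def by simp
qed

lemma flip_unit_cube_boundaries:
  assumes "\<And>i. e i = 1 \<or> e i = (-1::real)" "y \<in> unit_cube_boundaries s m"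
  shows "(\<lambda>p. e (fst p) * y p) \<in> unit_cube_boundaries s m"
proof -
  have "\<bar>e i * x\<bar> = \<bar>x\<bar>" for i x using assms(1)[of i] by auto
  then show ?thesis using assms(2) unfolding unit_cube_boundaries_def by simp
qed

section \<open>From a small cover to a contradiction\<close>

theorem no_small_section_cover:
  fixes U :: "nat \<Rightarrow> (nat \<Rightarrow> (nat \<Rightarrow> real) set) set"
  assumes s: "0 < s" and m: "0 < m" and n: "0 < n" "n \<le> s * m"
    and \<iota>: "\<And>j. j < n \<Longrightarrow> \<iota> j < s - 1"
    and odd: "odd (\<Prod>i<s - 1. card {j. j < n \<and> \<iota> j = i} choose m)"
    and op: "\<And>j. j < n \<Longrightarrow> openin (power_space s (real_projective_space m)) (U j)"
    and sec: "\<And>j. j < n \<Longrightarrow> has_eval_section s (real_projective_space m) (U j)"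
    and cover: "topspace (power_space s (real_projective_space m)) \<subseteq> (\<Union>j<n. U j)"
  shows False
proof -
  let ?C = "unit_cube_boundaries s m" and ?pr = "cube_to_rp s m"
  have "\<forall>j\<in>{..<n}. \<exists>T. open T \<and> {y \<in> ?C. ?pr y \<in> U j} = ?C \<inter> T"
  proof
    fix j assume "j \<in> {..<n}"
    then have "openin (top_of_set ?C) {y \<in> topspace (top_of_set ?C). ?pr y \<in> U j}"
      by (intro openin_continuous_map_preimage[OF continuous_map_cube_to_rp] op) simp
    then show "\<exists>T. open T \<and> {y \<in> ?C. ?pr y \<in> U j} = ?C \<inter> T" by (auto simp: openin_open)
  qed
  from bchoice[OF this] obtain T where T: "\<forall>j\<in>{..<n}. open (T j) \<and> {y \<in> ?C. ?pr y \<in> U j} = ?C \<inter> T j"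
    by blast
  have pr_mem: "?pr y \<in> topspace (power_space s (real_projective_space m))" if "y \<in> ?C" for y
    using continuous_map_image_subset_topspace[OF continuous_map_cube_to_rp] that by auto
  have "?C \<subseteq> \<Union> (T ` {..<n})"
  proof
    fix y assume y: "y \<in> ?C"
    then obtain j where "j < n" "?pr y \<in> U j" using cover pr_mem[OF y] by blast
    then show "y \<in> \<Union> (T ` {..<n})" using T y by blast
  qed
  then obtain \<epsilon> where \<epsilon>: "0 < \<epsilon>" "\<And>y. y \<in> ?C \<Longrightarrow> \<exists>G\<in>T ` {..<n}. ball y \<epsilon> \<subseteq> G"
    by (rule Heine_Borel_lemma[OF compact_unit_cube_boundaries]) (use T in auto)
  \<comment> \<open>Half of a Lebesgue number: one half for the distance along a flag, one half for
    the shrinking below.\<close>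
  define \<delta> where "\<delta> = \<epsilon> / 2"
  have \<delta>: "0 < \<delta>" using \<epsilon>(1) by (simp add: \<delta>_def)
  \<comment> \<open>A compact shrinking of the preimage of \<open>U j\<close>. The metric condition
    makes it invariant under signs, which are isometries compatible with the projection.\<close>
  define K where "K j = {y \<in> ?C. \<forall>z\<in>?C. dist y z < \<delta> \<longrightarrow> ?pr z \<in> U j}" for j
  have K_sub: "K j \<subseteq> ?C" and K_U: "\<And>y. y \<in> K j \<Longrightarrow> ?pr y \<in> U j" for j
    using \<delta> by (auto simp: K_def)
  have K_compact: "compact (K j)" for j
  proof -
    have "closed (\<Inter>z\<in>{z \<in> ?C. ?pr z \<notin> U j}. {y. \<delta> \<le> dist y z})"
      by (intro closed_INT ballI closed_Collect_le continuous_intros)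
    then have "compact (?C \<inter> (\<Inter>z\<in>{z \<in> ?C. ?pr z \<notin> U j}. {y. \<delta> \<le> dist y z}))"
      by (rule compact_Int_closed[OF compact_unit_cube_boundaries])
    also have "?C \<inter> (\<Inter>z\<in>{z \<in> ?C. ?pr z \<notin> U j}. {y. \<delta> \<le> dist y z}) = K j"
      by (force simp: K_def not_less[symmetric])
    finally show ?thesis .
  qed
  have s1: "s - 1 < s" using s by simp
  have "\<forall>j\<in>{..<n}. \<exists>g. continuous_on (K j) g \<and> (\<forall>y\<in>K j. g y \<noteq> (0::real)) \<and>
    (\<forall>y\<in>K j. \<forall>y'\<in>K j. \<forall>e e'. ?pr y' = ?pr y \<longrightarrow> (\<forall>k. y' (\<iota> j, k) = e * y (\<iota> j, k)) \<longrightarrow>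
       (\<forall>k. y' (s - 1, k) = e' * y (s - 1, k)) \<longrightarrow> g y' = e * e' * g y)"
  proof
    fix j assume "j \<in> {..<n}"
    then have j: "j < n" by simp
    have ij: "\<iota> j < s" using \<iota>[OF j] by simp
    show "\<exists>g. continuous_on (K j) g \<and> (\<forall>y\<in>K j. g y \<noteq> (0::real)) \<and>
    (\<forall>y\<in>K j. \<forall>y'\<in>K j. \<forall>e e'. ?pr y' = ?pr y \<longrightarrow> (\<forall>k. y' (\<iota> j, k) = e * y (\<iota> j, k)) \<longrightarrow>
       (\<forall>k. y' (s - 1, k) = e' * y (s - 1, k)) \<longrightarrow> g y' = e * e' * g y)"
      by (rule section_equivariant_function[OF K_compact K_sub sec[OF j] K_U ij s1])
  qed
  from bchoice[OF this] obtain g where g: "\<forall>j\<in>{..<n}. continuous_on (K j) (g j) \<and> (\<forall>y\<in>K j. g j y \<noteq> 0) \<and>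
    (\<forall>y\<in>K j. \<forall>y'\<in>K j. \<forall>e e'. ?pr y' = ?pr y \<longrightarrow> (\<forall>k. y' (\<iota> j, k) = e * y (\<iota> j, k)) \<longrightarrow>
       (\<forall>k. y' (s - 1, k) = e' * y (s - 1, k)) \<longrightarrow> g j y' = e * e' * g j y)" by blast
  have g_cont: "continuous_on (K j) (g j)" if "j < n" for j
    using g that by blast
  have g_nz: "g j y \<noteq> 0" if "j < n" "y \<in> K j" for j y
    using g that by blast
  have g_eq: "g j y' = e * e' * g j y"
    if "j < n" "y \<in> K j" "y' \<in> K j" "?pr y' = ?pr y" "\<forall>k. y' (\<iota> j, k) = e * y (\<iota> j, k)"
      "\<forall>k. y' (s - 1, k) = e' * y (s - 1, k)" for j y y' e e'
    using bspec[OF g, of j] that by simp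
  have "\<forall>j\<in>{..<n}. \<exists>\<eta>>0. \<forall>y\<in>K j. \<forall>y'\<in>K j. dist y' y < \<eta> \<longrightarrow> (g j y' < 0 \<longleftrightarrow> g j y < 0)"
    using sign_locally_constant[OF K_compact g_cont g_nz] by blast
  from bchoice[OF this] obtain \<eta> where \<eta>: "\<forall>j\<in>{..<n}. 0 < \<eta> j \<and>
      (\<forall>y\<in>K j. \<forall>y'\<in>K j. dist y' y < \<eta> j \<longrightarrow> (g j y' < 0 \<longleftrightarrow> g j y < 0))" by blast
  define \<gamma> where "\<gamma> = Min (insert \<delta> (\<eta> ` {..<n}))"
  have \<gamma>: "0 < \<gamma>" "\<gamma> \<le> \<delta>" "\<And>j. j < n \<Longrightarrow> \<gamma> \<le> \<eta> j"
    unfolding \<gamma>_def using \<eta> \<delta> by auto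
  obtain h :: nat where h: "0 < h" "1 / h < \<gamma>"
    using real_arch_inverse[of \<gamma>] \<gamma>(1) by (auto simp: inverse_eq_divide)
  \<comment> \<open>Even, as the cells require, with 2 / M = 1 / h below \<delta> and below every
    radius of constant sign.\<close>
  define M where "M = 2 * int h"
  have mesh: "2 / real_of_int M < \<gamma>" using h by (simp add: M_def)
  interpret cube_power s m M
    by unfold_locales (use s m h(1) in \<open>auto simp: M_def\<close>)
  define S where "S j = (if j < n then {\<iota> j, s - 1} else {s - 1})" for j
  \<comment> \<open>Outside \<open>K j\<close> the label is a sum of sign bits with the same
    behaviour under signs; for j >= n it represents the padding class x_(s-1).\<close>
  define a :: "nat \<Rightarrow> (nat \<times> nat \<Rightarrow> int) \<Rightarrow> bit" where
    "a j v = (if j < n \<and> scaled v \<in> K j then of_bool (g j (scaled v) < 0) else \<Sum>i\<in>S j. sgn_bit i 0 v)" for j v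
  have S: "S j \<subseteq> {..<s}" for j
    using \<iota>[of j] s by (auto simp: S_def)
  have a_flip: "a j (flip e v) = a j v + (\<Sum>i\<in>S j. of_bool (e i = -1))"
    if e: "e \<in> signs" and v: "v \<in> cells" for j e v
  proof -
    have e': "real_of_int (e i) = 1 \<or> real_of_int (e i) = -1" for i using signsD[OF e, of i] by auto
    let ?f = "\<lambda>z p. real_of_int (e (fst p)) * z p"
    have sf: "scaled (flip e v) = ?f (scaled v)" by (simp add: fun_eq_iff scaled_flip)
    have ff: "?f (?f z) = z" for z :: "nat \<times> nat \<Rightarrow> real"
    proof
      show "?f (?f z) p = z p" for p using e'[of "fst p"] by auto
    qed
    have fC: "?f z \<in> ?C" if "z \<in> ?C" for z
      using flip_unit_cube_boundaries[of "\<lambda>i. real_of_int (e i)", OF e' that] .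
    have ball: "(\<forall>z\<in>?C. P z) \<longleftrightarrow> (\<forall>z\<in>?C. P (?f z))" for P
    proof (intro iffI ballI)
      fix z assume z: "z \<in> ?C"
      show "P (?f z)" if "\<forall>z\<in>?C. P z" using that fC[OF z] by (rule bspec)
      show "P z" if "\<forall>z\<in>?C. P (?f z)" using bspec[OF that fC[OF z]] by (simp only: ff)
    qed
    have K_flip: "scaled (flip e v) \<in> K j \<longleftrightarrow> scaled v \<in> K j"
    proof -
      have C: "scaled (flip e v) \<in> ?C" "scaled v \<in> ?C" using scaled_cell v e by simp_all
      have "(\<forall>z\<in>?C. dist (scaled (flip e v)) z < \<delta> \<longrightarrow> ?pr z \<in> U j) \<longleftrightarrow>
          (\<forall>z\<in>?C. dist (scaled (flip e v)) (?f z) < \<delta> \<longrightarrow> ?pr (?f z) \<in> U j)"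
        by (rule ball)
      also have "\<dots> \<longleftrightarrow> (\<forall>z\<in>?C. dist (scaled v) z < \<delta> \<longrightarrow> ?pr z \<in> U j)"
        using dist_scaled_flip[OF e] cube_to_rp_flip[of "\<lambda>i. real_of_int (e i)" s m] e' by simp
      finally show ?thesis using C by (simp add: K_def)
    qed
    show ?thesis
    proof (cases "j < n \<and> scaled v \<in> K j")
      case True
      have ne: "\<iota> j \<noteq> s - 1" using \<iota> True by fastforce
      have "g j (scaled (flip e v)) = real_of_int (e (\<iota> j)) * real_of_int (e (s - 1)) * g j (scaled v)"
      proof (rule g_eq)
        show "?pr (scaled (flip e v)) = ?pr (scaled v)"
          unfolding sf by (rule cube_to_rp_flip[OF e'])
      qed (use True K_flip in \<open>auto simp: scaled_flip\<close>)
      moreover have "g j (scaled v) \<noteq> 0" using g_nz True by blast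
      ultimately show ?thesis
        using True K_flip ne signsD[OF e, of "\<iota> j"] signsD[OF e, of "s - 1"] by (auto simp: a_def S_def)
    next
      case False
      have "(\<Sum>i\<in>S j. sgn_bit i 0 (flip e v)) = (\<Sum>i\<in>S j. sgn_bit i 0 v + of_bool (e i = -1))"
        using S[of j] by (intro sum.cong refl sgn_bit_flip v e) auto
      then show ?thesis using False K_flip by (auto simp: a_def sum.distrib)
    qed
  qed
  have "odd (card {\<phi> \<in> PiE {..<s * m} S. \<forall>i<s. card {j. j < s * m \<and> \<phi> j = i} = m})"
    using card_choices[OF s n(2) \<iota>] odd unfolding S_def by simp
  then obtain c where c: "c \<in> flags" "\<And>j. j < s * m \<Longrightarrow> a j (c j) \<noteq> a j (c (Suc j))"
    using ex_alternating_flag[of S a] S a_flip by blast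
  have cell: "c j \<in> cells" if "j \<le> s * m" for j using flag_cell[OF c(1) that] .
  \<comment> \<open>The Lebesgue number at the vertex selects the set for the whole flag, and the
    index of that set is also the step at which the contradiction arises.\<close>
  obtain j where j: "j < n" "ball (scaled (c 0)) \<epsilon> \<subseteq> T j"
    using \<epsilon>(2)[OF scaled_cell[OF cell[of 0]]] by auto
  have K_mem: "scaled (c l) \<in> K j" if l: "l \<le> s * m" for l
    unfolding K_def
  proof (intro CollectI conjI ballI impI)
    show "scaled (c l) \<in> ?C" by (rule scaled_cell[OF cell[OF l]])
    fix z assume z: "z \<in> ?C" "dist (scaled (c l)) z < \<delta>"
    have "dist (scaled (c l)) (scaled (c 0)) < \<delta>"
      using scaled_diff[of "c l" "c 0"] flag_coord_diff[OF c(1) l] mesh \<gamma>(2) by fastforce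
    then have "dist (scaled (c 0)) z < \<epsilon>"
      using z(2) dist_triangle[of "scaled (c 0)" z "scaled (c l)"] by (simp add: \<delta>_def dist_commute)
    then have "z \<in> ?C \<inter> T j" using z(1) j(2) by auto
    then show "?pr z \<in> U j" using T j(1) by blast
  qed
  have jN: "j < s * m" using j(1) n(2) by simp
  have "dist (scaled (c (Suc j))) (scaled (c j)) < \<eta> j"
    using scaled_diff[of "c (Suc j)" "c j"] flag_step_diff[OF c(1) jN] mesh \<gamma>(3)[OF j(1)] by fastforce
  moreover have mem: "scaled (c j) \<in> K j" "scaled (c (Suc j)) \<in> K j"
    using jN by (auto intro!: K_mem)
  moreover have "\<forall>y\<in>K j. \<forall>y'\<in>K j. dist y' y < \<eta> j \<longrightarrow> (g j y' < 0 \<longleftrightarrow> g j y < 0)"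
    using \<eta> j(1) by blast
  ultimately have "g j (scaled (c (Suc j))) < 0 \<longleftrightarrow> g j (scaled (c j)) < 0" by blast
  then have "a j (c j) = a j (c (Suc j))" using mem j(1) by (simp add: a_def)
  then show False using c(2)[OF jN] by simp
qed

theorem higher_TC_real_projective_space_ge:
  assumes m: "m \<ge> 2" "m mod 4 \<noteq> 3" and s: "s \<ge> rp_r m"
  shows "enat (s * m - m mod 2) \<le> higher_TC s (real_projective_space m)"
proof -
  let ?P = "power_space s (real_projective_space m)" and ?n = "s * m - m mod 2"
  obtain d where d: "(\<Sum>i<s - 1. d i) = m - m mod 2" "\<And>i. i < s - 1 \<Longrightarrow> odd ((m + d i) choose m)"
    using ex_excesses[OF m s] by blast
  have s0: "0 < s" using s by (simp add: rp_r_def)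
  have mod_le: "m mod 2 \<le> 1" by simp
  \<comment> \<open>Of these factors (s - 1)m provide the powers of the x_i with i < s - 1. The
    excesses remain for x_(s-1), which for odd m leaves its exponent one short.\<close>
  have "(\<Sum>i<s - 1. m + d i) = (s - 1) * m + (m - m mod 2)"
    unfolding d(1)[symmetric] by (simp add: sum.distrib)
  also have "\<dots> = ?n" using s0 m(1) mod_le by (cases s) auto
  finally have sum: "(\<Sum>i<s - 1. m + d i) = ?n" .
  have "m \<le> s * m" using s0 by simp
  then have n0: "0 < ?n" using m(1) mod_le by linarith
  obtain \<iota> where \<iota>: "\<And>j. j < ?n \<Longrightarrow> \<iota> j < s - 1" "\<And>i. i < s - 1 \<Longrightarrow> card {j. j < ?n \<and> \<iota> j = i} = m + d i"
    using ex_function_with_fibres[where r = "s - 1" and b = "\<lambda>i. m + d i", unfolded sum] by blast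
  have "odd (\<Prod>i<s - 1. card {j. j < ?n \<and> \<iota> j = i} choose m)"
  proof -
    have "(\<Prod>i<s - 1. card {j. j < ?n \<and> \<iota> j = i} choose m) = (\<Prod>i<s - 1. (m + d i) choose m)"
      using \<iota>(2) by (intro prod.cong) auto
    moreover have "odd (\<Prod>i<s - 1. (m + d i) choose m)" using d(2) by (simp add: even_prod_iff)
    ultimately show ?thesis by simp
  qed
  note no_cover = no_small_section_cover[OF s0 _ n0 _ \<iota>(1) this]
  have large: "enat (Suc ?n) \<le> enat (card \<U>)"
    if \<U>: "finite \<U>" "\<forall>U\<in>\<U>. openin ?P U" "\<Union>\<U> = topspace ?P"
      "\<forall>U\<in>\<U>. has_eval_section s (real_projective_space m) U" for \<U>
  proof (rule ccontr)
    assume "\<not> ?thesis"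
    then have card: "card \<U> \<le> ?n" by simp
    obtain h where h: "bij_betw h {0..<card \<U>} \<U>" using ex_bij_betw_nat_finite[OF \<U>(1)] by blast
    have "topspace (real_projective_space m) \<noteq> {}"
      unfolding topspace_real_projective_space using in_topspace_nsphere by blast
    then have "topspace ?P \<noteq> {}" by (simp add: topspace_power_space PiE_eq_empty_iff)
    then have "\<U> \<noteq> {}" unfolding \<U>(3)[symmetric] by blast
    then have "0 < card \<U>" using \<U>(1) by (simp add: card_gt_0_iff)
    \<comment> \<open>A cover with fewer than \<open>?n\<close> members is enumerated with
      repetitions of one member.\<close>
    define U where "U j = h (if j < card \<U> then j else 0)" for j
    have U_mem: "U j \<in> \<U>" for j
      using h \<open>0 < card \<U>\<close> by (auto simp: U_def bij_betw_def)
    have "\<U> \<subseteq> U ` {..<?n}"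
    proof
      fix V assume "V \<in> \<U>"
      then have "V \<in> h ` {0..<card \<U>}" using bij_betw_imp_surj_on[OF h] by simp
      then obtain j where "j < card \<U>" "V = h j" by auto
      then show "V \<in> U ` {..<?n}" using card by (intro image_eqI[of _ _ j]) (auto simp: U_def)
    qed
    then have cover: "topspace ?P \<subseteq> (\<Union>j<?n. U j)"
      unfolding \<U>(3)[symmetric] by (rule Union_mono)
    show False
    proof (rule no_cover)
      show "openin ?P (U j)" for j using \<U>(2) U_mem by blast
      show "has_eval_section s (real_projective_space m) (U j)" for j using \<U>(4) U_mem by blast
    qed (use cover m(1) in simp_all)
  qed
  have "enat (Suc ?n) \<le> Inf {enat (card \<U>) | \<U>. finite \<U> \<and> (\<forall>U\<in>\<U>. openin ?P U) \<and> \<Union>\<U> = topspace ?P \<and>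
      (\<forall>U\<in>\<U>. has_eval_section s (real_projective_space m) U)}" (is "_ \<le> ?I")
    by (rule Inf_greatest) (use large in blast)
  then have "enat (Suc ?n) - 1 \<le> ?I - 1" by (cases ?I) (auto simp: one_enat_def)
  then show ?thesis unfolding higher_TC_def by (simp add: one_enat_def)
qed

theorem mainTheorem1:
  fixes m s :: nat
  assumes "m \<ge> 2" and "m mod 4 \<noteq> 3" and "s \<ge> rp_r m"
  shows "enat (s * m - 1) \<le> higher_TC s (real_projective_space m) \<and>
         higher_TC s (real_projective_space m) \<le> enat (s * m) \<and>
         (even m \<longrightarrow> higher_TC s (real_projective_space m) = enat (s * m))"
proof -
  have s: "0 < s" using assms(3) by (simp add: rp_r_def)
  have le: "higher_TC s (real_projective_space m) \<le> enat (s * m)"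
    by (rule higher_TC_real_projective_space_le[OF s])
  have ge: "enat (s * m - m mod 2) \<le> higher_TC s (real_projective_space m)"
    by (rule higher_TC_real_projective_space_ge[OF assms])
  have "s * m - 1 \<le> s * m - m mod 2" by (intro diff_le_mono2) simp
  then have "enat (s * m - 1) \<le> higher_TC s (real_projective_space m)"
    using order_trans[OF _ ge] by simp
  moreover have "higher_TC s (real_projective_space m) = enat (s * m)" if "even m"
  proof (rule antisym[OF le])
    have "m mod 2 = 0" using that by presburger
    then show "enat (s * m) \<le> higher_TC s (real_projective_space m)" using ge by simp
  qed
  ultimately show ?thesis using le by blast
qed

end
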